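(* Let $\alpha\in(0,2)$, let $l^{(\alpha)}=(l^{(\alpha)}_t)_{t\ge 0}$ be a non-Gaussian strictly $\alpha$-stable Lévy process, and let $A>0$. For each $\varepsilon>0$ let $(v^\varepsilon,x^\varepsilon)$ be the solution of $$v^\varepsilon_t=-A\int_0^t v^\varepsilon_s\,ds+\varepsilon\, l^{(\alpha)}_t,\qquad x^\varepsilon_t=\int_0^t v^\varepsilon_s\,ds,\qquad t\ge 0$$ (zero initial conditions). Then, as $\varepsilon\to 0$, $$\bigl(A\,x^\varepsilon_{t/\varepsilon^\alpha}\bigr)_{t\ge 0}\ \Rightarrow\ \bigl(l^{(\alpha)}_t\bigr)_{t\ge 0}$$ weakly in the space $D([0,\infty),\mathbb{R})$ equipped with the Skorokhod $M_1$-topology.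
   Context: All processes live on a filtered probability space satisfying the usual conditions. A Lévy process is real valued, starts at $0$ and has càdlàg paths. **Stable processes.** The process $l^{(\alpha)}$, $\alpha\in(0,2)$, has characteristic function $\mathbf{E}e^{iul^{(\alpha)}_t}=e^{t\Psi(u)}$, $u\in\mathbb{R}$, with $\Psi(u)=-c|u|^\alpha\bigl(1-i\beta\,\mathrm{sign}(u)\tan\frac{\pi\alpha}{2}\bigr)$ if $\alpha\ne 1$, and $\Psi(u)=-c|u|$ if $\alpha=1$, where $c>0$ and $\beta\in[-1,1]$. It is self-similar: $(\varepsilon l^{(\alpha)}_{t/\varepsilon^\alpha})_{t\ge0}$ and $(l^{(\alpha)}_t)_{t\ge0}$ have the same law for every $\varepsilon>0$. **Solution of the equations.** The system has a pathwise unique strong solution, given by $v^\varepsilon_t=\varepsilon\int_0^t e^{-A(t-s)}\,dl^{(\alpha)}_s=\varepsilon l^{(\alpha)}_t-\varepsilon A\int_0^t e^{-A(t-s)}l^{(\alpha)}_s\,ds$ and $x^\varepsilon_t=\int_0^t v^\varepsilon_s\,ds$. **$M_1$-topology.** $D([0,\infty),\mathbb{R})$ is the space of real-valued càdlàg functions on $[0,\infty)$. For $x\in D([0,\infty),\mathbb{R})$ and $T>0$ the completed graph is $\Gamma_x^T=\{(x_0,0)\}\cup\{(z,t)\in\mathbb{R}\times(0,T]: z=cx_{t-}+(1-c)x_t\text{ for some }c\in[0,1]\}$, ordered by: $(z,t)\le(z',t')$ if $t<t'$, or $t=t'$ and $|x_{t-}-z|\le|x_{t-}-z'|$. A parametric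 representation of $\Gamma_x^T$ is a continuous map $u\mapsto(z_u,t_u)$ from $[0,1]$ onto $\Gamma_x^T$ that is nondecreasing with respect to this order; $\Pi_x^T$ is the set of all of them. The $M_1$-topology is induced by the metric $d_{M_1}(x,x')=\int_0^\infty e^{-T}\bigl(1\wedge d_{M_1,T}(x,x')\bigr)\,dT$, where $d_{M_1,T}(x,x')=\inf\max_{u\in[0,1]}\{|z_u-z'_u|,|t_u-t'_u|\}$, the infimum being over $(z,t)\in\Pi_x^T$ and $(z',t')\in\Pi_{x'}^T$. *)

theory Defs
  imports "HOL-Probability.Probability"
begin

section \<open>Stochastic processes on a filtered probability space\<close>

text \<open>
  Time is the half-line \<open>[0,\<infinity>)\<close>, encoded as type \<open>real\<close>; the values of a function of
  time at negative arguments are never inspected.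
\<close>

definition cadlag :: "(real \<Rightarrow> real) \<Rightarrow> bool" where
  "cadlag x \<longleftrightarrow> (\<forall>t\<ge>0. (x \<longlongrightarrow> x t) (at_right t)) \<and> (\<forall>t>0. \<exists>y. (x \<longlongrightarrow> y) (at_left t))"

definition usual_conditions :: "'w measure \<Rightarrow> (real \<Rightarrow> 'w measure) \<Rightarrow> bool" where
  "usual_conditions M F \<longleftrightarrow>
     (\<forall>t\<ge>0. subalgebra M (F t)) \<and>
     (\<forall>s t. 0 \<le> s \<and> s \<le> t \<longrightarrow> sets (F s) \<subseteq> sets (F t)) \<and>
     (\<forall>t\<ge>0. sets (F t) = (\<Inter>s\<in>{t<..}. sets (F s))) \<and>
     complete_measure M \<and> null_sets M \<subseteq> sets (F 0)"

definition cadlag_adapted :: "'w measure \<Rightarrow> (real \<Rightarrow> 'w measure) \<Rightarrow> (real \<Rightarrow> 'w \<Rightarrow> real) \<Rightarrow> bool" where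
  "cadlag_adapted M F X \<longleftrightarrow>
     (\<forall>t\<ge>0. X t \<in> borel_measurable (F t)) \<and> (\<forall>\<omega>\<in>space M. cadlag (\<lambda>t. X t \<omega>))"

text \<open>Stochastic continuity is not listed: it follows from the regularity of the paths.\<close>

definition levy_process :: "'w measure \<Rightarrow> (real \<Rightarrow> 'w measure) \<Rightarrow> (real \<Rightarrow> 'w \<Rightarrow> real) \<Rightarrow> bool" where
  "levy_process M F l \<longleftrightarrow>
     cadlag_adapted M F l \<and>
     (\<forall>\<omega>\<in>space M. l 0 \<omega> = 0) \<and>
     (\<forall>s t. 0 \<le> s \<and> s < t \<longrightarrow>
        prob_space.indep_set M (sets (F s))
          {(\<lambda>\<omega>. l t \<omega> - l s \<omega>) -` B \<inter> space M | B. B \<in> sets borel}) \<and>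
     (\<forall>s t. 0 \<le> s \<and> s < t \<longrightarrow>
        distr M borel (\<lambda>\<omega>. l t \<omega> - l s \<omega>) = distr M borel (l (t - s)))"

definition stable_exponent :: "real \<Rightarrow> real \<Rightarrow> real \<Rightarrow> real \<Rightarrow> complex" where
  "stable_exponent \<alpha> c \<beta> u =
     (if \<alpha> = 1 then - complex_of_real (c * \<bar>u\<bar>)
      else - complex_of_real (c * \<bar>u\<bar> powr \<alpha>) *
             (1 - \<i> * complex_of_real (\<beta> * sgn u * tan (pi * \<alpha> / 2))))"

text \<open>
  For \<open>\<alpha> = 1\<close> this is the symmetric process without drift, which is the normalisation used here for
  strict \<open>1\<close>-stability. The constraint \<open>0 < \<alpha> < 2\<close> (no Gaussian case) is part of the definition.
\<close>

definition stable_levy_process ::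
    "'w measure \<Rightarrow> (real \<Rightarrow> 'w measure) \<Rightarrow> real \<Rightarrow> (real \<Rightarrow> 'w \<Rightarrow> real) \<Rightarrow> bool" where
  "stable_levy_process M F \<alpha> l \<longleftrightarrow>
     0 < \<alpha> \<and> \<alpha> < 2 \<and> levy_process M F l \<and>
     (\<exists>c \<beta>. c > 0 \<and> -1 \<le> \<beta> \<and> \<beta> \<le> 1 \<and>
        (\<forall>t\<ge>0. \<forall>u. char (distr M borel (l t)) u = exp (complex_of_real t * stable_exponent \<alpha> c \<beta> u)))"

text \<open>
  As usual for stochastic equations, the identities are required up to indistinguishability. The
  Lebesgue integrals exist because cadlag functions are bounded on compact intervals.
\<close>

definition langevin_solution ::
    "'w measure \<Rightarrow> (real \<Rightarrow> 'w measure) \<Rightarrow> (real \<Rightarrow> 'w \<Rightarrow> real) \<Rightarrow> real \<Rightarrow> real \<Rightarrow>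
     (real \<Rightarrow> 'w \<Rightarrow> real) \<Rightarrow> (real \<Rightarrow> 'w \<Rightarrow> real) \<Rightarrow> bool" where
  "langevin_solution M F l A \<epsilon> v x \<longleftrightarrow>
     cadlag_adapted M F v \<and> cadlag_adapted M F x \<and>
     (AE \<omega> in M. \<forall>t\<ge>0. v t \<omega> = - A * (LBINT s:{0..t}. v s \<omega>) + \<epsilon> * l t \<omega>) \<and>
     (AE \<omega> in M. \<forall>t\<ge>0. x t \<omega> = (LBINT s:{0..t}. v s \<omega>))"


section \<open>The space of cadlag functions with the \<open>M\<^sub>1\<close> topology\<close>

text \<open>Functions on \<open>[0,\<infinity>)\<close> are represented extensionally, so that equality is equality on \<open>[0,\<infinity>)\<close>.\<close>

definition skorokhod_space :: "(real \<Rightarrow> real) set" where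
  "skorokhod_space = {x \<in> extensional {0..}. cadlag x}"

definition left_limit :: "(real \<Rightarrow> real) \<Rightarrow> real \<Rightarrow> real" where
  "left_limit x t = Lim (at_left t) x"

definition completed_graph :: "real \<Rightarrow> (real \<Rightarrow> real) \<Rightarrow> (real \<times> real) set" where
  "completed_graph T x =
     {(x 0, 0)} \<union>
     {(z, t). 0 < t \<and> t \<le> T \<and> (\<exists>c\<in>{0..1}. z = c * left_limit x t + (1 - c) * x t)}"

text \<open>
  At time \<open>0\<close> the completed graph has a single point, so the unspecified value of \<open>left_limit x 0\<close>
  does not affect the order.
\<close>

fun graph_le :: "(real \<Rightarrow> real) \<Rightarrow> real \<times> real \<Rightarrow> real \<times> real \<Rightarrow> bool" where
  "graph_le x (z, t) (z', t') \<longleftrightarrow>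
     t < t' \<or> (t = t' \<and> \<bar>left_limit x t - z\<bar> \<le> \<bar>left_limit x t - z'\<bar>)"

definition parametric_representations :: "real \<Rightarrow> (real \<Rightarrow> real) \<Rightarrow> (real \<Rightarrow> real \<times> real) set" where
  "parametric_representations T x =
     {\<gamma>. continuous_on {0..1} \<gamma> \<and> \<gamma> ` {0..1} = completed_graph T x \<and>
         (\<forall>u\<in>{0..1}. \<forall>u'\<in>{0..1}. u \<le> u' \<longrightarrow> graph_le x (\<gamma> u) (\<gamma> u'))}"

definition M1_dist_on :: "real \<Rightarrow> (real \<Rightarrow> real) \<Rightarrow> (real \<Rightarrow> real) \<Rightarrow> real" where
  "M1_dist_on T x x' =
     (INF (\<gamma>, \<gamma>') \<in> parametric_representations T x \<times> parametric_representations T x'.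
        SUP u\<in>{0..1}. max \<bar>fst (\<gamma> u) - fst (\<gamma>' u)\<bar> \<bar>snd (\<gamma> u) - snd (\<gamma>' u)\<bar>)"

definition M1_dist :: "(real \<Rightarrow> real) \<Rightarrow> (real \<Rightarrow> real) \<Rightarrow> real" where
  "M1_dist x x' = (LBINT T:{0<..}. exp (- T) * min 1 (M1_dist_on T x x'))"

text \<open>
  This is what \<open>Metric_space.mtopology skorokhod_space M1_dist\<close> unfolds to. It is written out because
  the facts about \<open>mtopology\<close>, its defining equation included, are guarded by the metric axioms.
\<close>

definition M1_topology :: "(real \<Rightarrow> real) topology" where
  "M1_topology = topology (\<lambda>U. U \<subseteq> skorokhod_space \<and>
     (\<forall>x\<in>U. \<exists>r>0. {y \<in> skorokhod_space. M1_dist x y < r} \<subseteq> U))"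

lemma openin_M1_topology:
  "openin M1_topology U \<longleftrightarrow>
     U \<subseteq> skorokhod_space \<and> (\<forall>x\<in>U. \<exists>r>0. {y \<in> skorokhod_space. M1_dist x y < r} \<subseteq> U)"
proof -
  have "istopology (\<lambda>U. U \<subseteq> skorokhod_space \<and>
     (\<forall>x\<in>U. \<exists>r>0. {y \<in> skorokhod_space. M1_dist x y < r} \<subseteq> U))" (is "istopology ?P")
    unfolding istopology_def
  proof (rule conjI; intro allI impI)
    fix S T assume S: "?P S" and T: "?P T"
    show "?P (S \<inter> T)"
    proof (intro conjI ballI)
      show "S \<inter> T \<subseteq> skorokhod_space" using S by blast
      fix x assume x: "x \<in> S \<inter> T"
      obtain r where r: "r > 0" "{y \<in> skorokhod_space. M1_dist x y < r} \<subseteq> S"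
        using S x by blast
      obtain r' where r': "r' > 0" "{y \<in> skorokhod_space. M1_dist x y < r'} \<subseteq> T"
        using T x by blast
      have "min r r' > 0" "{y \<in> skorokhod_space. M1_dist x y < min r r'} \<subseteq> S \<inter> T"
        using r r' by auto
      then show "\<exists>r>0. {y \<in> skorokhod_space. M1_dist x y < r} \<subseteq> S \<inter> T" by blast
    qed
  next
    fix K assume K: "Ball K ?P"
    show "?P (\<Union>K)"
    proof (intro conjI ballI)
      show "\<Union>K \<subseteq> skorokhod_space" using K by blast
      fix x assume "x \<in> \<Union>K"
      then obtain S where S: "S \<in> K" "x \<in> S" by blast
      with K obtain r where "r > 0" "{y \<in> skorokhod_space. M1_dist x y < r} \<subseteq> S" by blast
      with S show "\<exists>r>0. {y \<in> skorokhod_space. M1_dist x y < r} \<subseteq> \<Union>K" by blast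
    qed
  qed
  then show ?thesis
    unfolding M1_topology_def by simp
qed

lemma topspace_M1_topology: "topspace M1_topology = skorokhod_space"
proof -
  have "openin M1_topology skorokhod_space"
    unfolding openin_M1_topology by (auto intro: exI[of _ 1])
  then show ?thesis
    by (meson openin_M1_topology openin_subset openin_topspace subset_antisym)
qed


section \<open>Weak convergence of random elements of a topological space\<close>

definition borel_of :: "'a topology \<Rightarrow> 'a measure" where
  "borel_of X = sigma (topspace X) {U. openin X U}"

text \<open>
  Being a random element, i.e. Borel measurability, is part of the notion, so that the
  Bochner integrals below are genuine expectations.
\<close>

definition converges_weakly ::
    "'w measure \<Rightarrow> 'a topology \<Rightarrow> ('i \<Rightarrow> 'w \<Rightarrow> 'a) \<Rightarrow> ('w \<Rightarrow> 'a) \<Rightarrow> 'i filter \<Rightarrow> bool" where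
  "converges_weakly M X Y Z G \<longleftrightarrow>
     (\<forall>\<^sub>F i in G. Y i \<in> measurable M (borel_of X)) \<and> Z \<in> measurable M (borel_of X) \<and>
     (\<forall>f. continuous_map X euclideanreal f \<and> bounded (f ` topspace X) \<longrightarrow>
        ((\<lambda>i. \<integral>\<omega>. f (Y i \<omega>) \<partial>M) \<longlongrightarrow> (\<integral>\<omega>. f (Z \<omega>) \<partial>M)) G)"

end

theory Submission
  imports Defs
begin

text \<open>
  Eliminating the velocity from the equations shows that \<open>A x\<close>, run at speed \<open>\<epsilon> powr - \<alpha>\<close>, is an
  average over the past of the rescaled noise \<open>L s = \<epsilon> * l (s / \<epsilon> powr \<alpha>)\<close>: its value at time \<open>t\<close>
  is the mean of \<open>L (max 0 (t - h * R))\<close>, where \<open>R\<close> is a standard exponential variable and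
  \<open>h = \<epsilon> powr \<alpha> / A\<close> (\<open>langevin_integral_eq_smoothing\<close>, \<open>smoothing_time_scale\<close>). By self-similarity \<open>L\<close>
  has the law of \<open>l\<close>. Hence the theorem reduces to a statement about a single cadlag path:
  its exponential averages converge to it in the \<open>M\<^sub>1\<close> sense as \<open>h\<close> tends to \<open>0\<close>
  (\<open>near_smoothing\<close>). Near a jump the average moves monotonically and continuously from the
  left limit to the new value, which is exactly what the \<open>M\<^sub>1\<close> topology tolerates.

  The pathwise convergence rests on a clock. To a cadlag path \<open>x\<close> one attaches a strictly
  increasing right-continuous function \<open>S\<close> that jumps precisely at the jump times of \<open>x\<close>. The inverse of \<open>S\<close>,
  together with linear interpolation of \<open>x\<close> across its jumps, gives a continuous injective curve
  \<open>p\<close> that runs through the completed graph of \<open>x\<close> and satisfies \<open>p (S t) = (x t, t)\<close>. On every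
  jump of \<open>S\<close> the curve \<open>p\<close> is affine. Averages over a short past essentially see one
  jump of \<open>S\<close> only, and affine functions commute with averages; therefore averaging
  \<open>p \<circ> S\<close> and applying \<open>p\<close> to the averaged clock give nearly the same result, uniformly on
  compact time intervals (\<open>smoothing_commutes\<close>). In other words the point of the averaged graph at
  time \<open>t\<close> is close to the point of the completed graph with parameter the averaged clock at
  \<open>t\<close>, and these two parametrizations are the ones to compare.

  Measurability with respect to the \<open>M\<^sub>1\<close> Borel sets is obtained through limits. For a fixed horizon the
  distance satisfies the triangle inequality (\<open>M1_dist_on_triangle_less\<close>), because all
  parametrizations of one graph are, up to a small error, reparametrizations of \<open>p\<close>.
  To avoid any question of measurability in the horizon, the relation \<open>near\<close> asks for smallness of
  the distance outside a small Borel set of horizons. It is finer than \<open>M\<^sub>1\<close> closeness, and limits of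
  measurable maps in its sense are measurable (\<open>near_measurable_limit\<close>). Averaged paths are such
  limits of fixed continuous functions weighted with finitely many values of the path on a grid
  (\<open>near_smooth_step\<close>), and the path itself is a limit of its averages. The same grid approximation transfers the equality of
  laws, which on a grid is an induction over independent increments (\<open>distr_grid_values_eq\<close>).
\<close>

section \<open>Cadlag functions\<close>

lemma cadlag_right: "cadlag x \<Longrightarrow> 0 \<le> t \<Longrightarrow> (x \<longlongrightarrow> x t) (at_right t)"
  by (simp add: cadlag_def)

lemma cadlag_left: "cadlag x \<Longrightarrow> 0 < t \<Longrightarrow> (x \<longlongrightarrow> left_limit x t) (at_left t)"
  unfolding cadlag_def left_limit_def
  by (metis tendsto_Lim trivial_limit_at_left_real)

lemma left_limit_eqI: "(x \<longlongrightarrow> c) (at_left t) \<Longrightarrow> left_limit x t = c"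
  unfolding left_limit_def by (rule tendsto_Lim) simp_all

lemma cadlag_right_bound:
  assumes "cadlag x" "0 \<le> t" "0 < e"
  obtains r where "0 < r" "\<And>s. t \<le> s \<Longrightarrow> s < t + r \<Longrightarrow> \<bar>x s - x t\<bar> < e"
proof -
  have "eventually (\<lambda>s. dist (x s) (x t) < e) (at_right t)"
    using cadlag_right[OF assms(1,2)] assms(3) by (rule tendstoD)
  then obtain b where b: "b > t" "\<And>s. t < s \<Longrightarrow> s < b \<Longrightarrow> dist (x s) (x t) < e"
    unfolding eventually_at_right_field by blast
  show ?thesis
  proof (rule that[of "b - t"])
    fix s assume "t \<le> s" "s < t + (b - t)"
    then show "\<bar>x s - x t\<bar> < e"
      using b(2)[of s] assms(3) by (cases "s = t") (auto simp: dist_real_def)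
  qed (use b in auto)
qed

lemma cadlag_left_bound:
  assumes "cadlag x" "0 < t" "0 < e"
  obtains r where "0 < r" "\<And>s. t - r < s \<Longrightarrow> s < t \<Longrightarrow> \<bar>x s - left_limit x t\<bar> < e"
proof -
  have "eventually (\<lambda>s. dist (x s) (left_limit x t) < e) (at_left t)"
    using cadlag_left[OF assms(1,2)] assms(3) by (rule tendstoD)
  then obtain b where b: "b < t" "\<And>s. b < s \<Longrightarrow> s < t \<Longrightarrow> dist (x s) (left_limit x t) < e"
    unfolding eventually_at_left_field by blast
  show ?thesis
  proof (rule that[of "t - b"])
    fix s assume "t - (t - b) < s" "s < t"
    then show "\<bar>x s - left_limit x t\<bar> < e"
      using b(2)[of s] by (auto simp: dist_real_def)
  qed (use b in auto)
qed

lemma left_limit_between: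
  assumes "cadlag x" "a < t" "0 < t" "\<And>s. a < s \<Longrightarrow> s < t \<Longrightarrow> \<bar>x s - c\<bar> \<le> e"
  shows "\<bar>left_limit x t - c\<bar> \<le> e"
proof (rule tendsto_upperbound)
  show "((\<lambda>s. \<bar>x s - c\<bar>) \<longlongrightarrow> \<bar>left_limit x t - c\<bar>) (at_left t)"
    using cadlag_left[OF assms(1,3)] by (intro tendsto_intros)
  show "eventually (\<lambda>s. \<bar>x s - c\<bar> \<le> e) (at_left t)"
    unfolding eventually_at_left_field using assms(2,4) by blast
qed simp

text \<open>
  Around a fixed time a cadlag function takes, up to a small error, only two values: its left limit
  and its value. This is the form in which regularity of paths is used below.
\<close>

lemma cadlag_two_values:
  assumes "cadlag x" "0 \<le> t" "0 < e"
  obtains r where "0 < r"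
    "\<And>s. t \<le> s \<Longrightarrow> s < t + r \<Longrightarrow> \<bar>x s - x t\<bar> < e"
    "\<And>s. t < s \<Longrightarrow> s < t + r \<Longrightarrow> \<bar>left_limit x s - x t\<bar> \<le> e"
    "\<And>s. 0 \<le> s \<Longrightarrow> t - r < s \<Longrightarrow> s < t \<Longrightarrow> \<bar>x s - left_limit x t\<bar> < e"
    "\<And>s. 0 < s \<Longrightarrow> t - r < s \<Longrightarrow> s < t \<Longrightarrow> \<bar>left_limit x s - left_limit x t\<bar> \<le> e"
proof -
  obtain r1 where r1: "0 < r1" "\<And>s. t \<le> s \<Longrightarrow> s < t + r1 \<Longrightarrow> \<bar>x s - x t\<bar> < e"
    using cadlag_right_bound[OF assms] by blast
  obtain r2 where r2: "0 < r2" "\<And>s. 0 \<le> s \<Longrightarrow> t - r2 < s \<Longrightarrow> s < t \<Longrightarrow> \<bar>x s - left_limit x t\<bar> < e"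
  proof (cases "t = 0")
    case True
    then show ?thesis by (intro that[of 1]) auto
  next
    case False
    then have "0 < t" using assms(2) by simp
    then show ?thesis using cadlag_left_bound[OF assms(1) _ assms(3)] that by metis
  qed
  show ?thesis
  proof (rule that[of "min r1 r2"])
    fix s assume s: "t < s" "s < t + min r1 r2"
    show "\<bar>left_limit x s - x t\<bar> \<le> e"
      by (rule left_limit_between[OF assms(1), of t]) (use s assms(2) in \<open>auto intro!: less_imp_le[OF r1(2)]\<close>)
  next
    fix s assume s: "0 < s" "t - min r1 r2 < s" "s < t"
    show "\<bar>left_limit x s - left_limit x t\<bar> \<le> e"
    proof (rule left_limit_between[OF assms(1), of "max 0 (t - r2)"])
      fix s' assume "max 0 (t - r2) < s'" "s' < s"
      then show "\<bar>x s' - left_limit x t\<bar> \<le> e" using s r2(2)[of s'] by auto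
    qed (use s in auto)
  qed (use r1 r2 in auto)
qed

lemma cadlag_bounded:
  assumes "cadlag x"
  obtains B where "0 < B" "\<And>t. 0 \<le> t \<Longrightarrow> t \<le> K \<Longrightarrow> \<bar>x t\<bar> \<le> B"
proof -
  have "\<exists>r B. 0 < r \<and> (\<forall>s. 0 \<le> s \<and> \<bar>s - t\<bar> < r \<longrightarrow> \<bar>x s\<bar> \<le> B)" if "t \<in> {0..K}" for t
  proof -
    have t0: "0 \<le> t" using that by simp
    obtain r where r: "0 < r"
      "\<And>s. t \<le> s \<Longrightarrow> s < t + r \<Longrightarrow> \<bar>x s - x t\<bar> < 1"
      "\<And>s. t < s \<Longrightarrow> s < t + r \<Longrightarrow> \<bar>left_limit x s - x t\<bar> \<le> 1"
      "\<And>s. 0 \<le> s \<Longrightarrow> t - r < s \<Longrightarrow> s < t \<Longrightarrow> \<bar>x s - left_limit x t\<bar> < 1"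
      "\<And>s. 0 < s \<Longrightarrow> t - r < s \<Longrightarrow> s < t \<Longrightarrow> \<bar>left_limit x s - left_limit x t\<bar> \<le> 1"
      using cadlag_two_values[OF assms t0 zero_less_one] by blast
    have "\<bar>x s\<bar> \<le> 1 + \<bar>x t\<bar> + \<bar>left_limit x t\<bar>" if s: "0 \<le> s" "\<bar>s - t\<bar> < r" for s
    proof (cases "t \<le> s")
      case True
      then show ?thesis using r(2)[of s] s by linarith
    next
      case False
      then show ?thesis using r(4)[of s] s by linarith
    qed
    with r(1) show ?thesis by blast
  qed
  then obtain r B where rB: "\<And>t. t \<in> {0..K} \<Longrightarrow> 0 < r t"
    "\<And>t s. t \<in> {0..K} \<Longrightarrow> 0 \<le> s \<Longrightarrow> \<bar>s - t\<bar> < r t \<Longrightarrow> \<bar>x s\<bar> \<le> B t"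
    by metis
  have "compact {0..K}" by simp
  moreover have "{0..K} \<subseteq> (\<Union>t\<in>{0..K}. ball t (r t))"
    using rB(1) by force
  ultimately obtain C where C: "C \<subseteq> {0..K}" "finite C" "{0..K} \<subseteq> (\<Union>t\<in>C. ball t (r t))"
    by (metis compactE_image[of "{0..K}" "{0..K}" "\<lambda>t. ball t (r t)"] open_ball)
  show ?thesis
  proof (rule that[of "1 + (\<Sum>t\<in>C. \<bar>B t\<bar>)"])
    show "0 < 1 + (\<Sum>t\<in>C. \<bar>B t\<bar>)" by (smt (verit) sum_nonneg abs_ge_zero)
    fix t assume "0 \<le> t" "t \<le> K"
    then obtain c where c: "c \<in> C" "\<bar>t - c\<bar> < r c"
      using C(3) by (force simp: dist_real_def)
    then have "\<bar>x t\<bar> \<le> B c" using rB(2)[of c t] C(1) \<open>0 \<le> t\<close> by blast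
    also have "\<dots> \<le> \<bar>B c\<bar>" by simp
    also have "\<dots> \<le> (\<Sum>t\<in>C. \<bar>B t\<bar>)" by (rule member_le_sum) (use c C in auto)
    finally show "\<bar>x t\<bar> \<le> 1 + (\<Sum>t\<in>C. \<bar>B t\<bar>)" by simp
  qed
qed

definition jumps :: "(real \<Rightarrow> real) \<Rightarrow> real set" where
  "jumps x = {t. 0 < t \<and> left_limit x t \<noteq> x t}"

text \<open>
  Jumps larger than a fixed size cannot accumulate, since near every time the values and the
  left limits are close to one of two numbers.
\<close>

lemma countable_jumps:
  assumes "cadlag x"
  shows "countable (jumps x)"
proof -
  define Jn where "Jn n = {t. 0 < t \<and> 1 / (real n + 1) < \<bar>x t - left_limit x t\<bar>}" for n
  have "countable (Jn n)" for n
  proof (rule no_limpt_imp_countable)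
    fix z
    define e where "e = 1 / (2 * (real n + 1))"
    have e: "0 < e" "2 * e = 1 / (real n + 1)" by (auto simp: e_def field_simps)
    show "\<not> z islimpt Jn n"
    proof
      assume lim: "z islimpt Jn n"
      have "closed {0::real..}" by simp
      moreover have "z islimpt {0..}" using lim by (rule islimpt_subset) (auto simp: Jn_def)
      ultimately have z: "0 \<le> z" by (auto simp: closed_limpt)
      obtain r where r: "0 < r"
        "\<And>s. z \<le> s \<Longrightarrow> s < z + r \<Longrightarrow> \<bar>x s - x z\<bar> < e"
        "\<And>s. z < s \<Longrightarrow> s < z + r \<Longrightarrow> \<bar>left_limit x s - x z\<bar> \<le> e"
        "\<And>s. 0 \<le> s \<Longrightarrow> z - r < s \<Longrightarrow> s < z \<Longrightarrow> \<bar>x s - left_limit x z\<bar> < e"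
        "\<And>s. 0 < s \<Longrightarrow> z - r < s \<Longrightarrow> s < z \<Longrightarrow> \<bar>left_limit x s - left_limit x z\<bar> \<le> e"
        using cadlag_two_values[OF assms z e(1)] by blast
      obtain s where s: "s \<in> Jn n" "s \<noteq> z" "dist s z < r"
        using lim r(1) unfolding islimpt_approachable by blast
      then have s0: "0 < s" "2 * e < \<bar>x s - left_limit x s\<bar>" "\<bar>s - z\<bar> < r"
        by (auto simp: Jn_def e(2) dist_real_def)
      show False
      proof (cases "z < s")
        case True
        then show ?thesis using s0 r(2)[of s] r(3)[of s] by linarith
      next
        case False
        then show ?thesis using s0 s(2) r(4)[of s] r(5)[of s] by linarith
      qed
    qed
  qed
  moreover have "jumps x \<subseteq> (\<Union>n. Jn n)"
  proof
    fix t assume t: "t \<in> jumps x"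
    then have "0 < \<bar>x t - left_limit x t\<bar>" by (simp add: jumps_def)
    from reals_Archimedean[OF this] obtain n where "1 / (real n + 1) < \<bar>x t - left_limit x t\<bar>"
      by (auto simp: inverse_eq_divide add.commute)
    with t show "t \<in> (\<Union>n. Jn n)" by (auto simp: Jn_def jumps_def)
  qed
  ultimately show ?thesis by (meson countable_UN countable_subset countableI_type)
qed

text \<open>
  The values at negative times carry no information, so functions of time are composed with
  \<open>max 0\<close>, which freezes them at their value at time \<open>0\<close>.
\<close>

lemma isCont_cadlag:
  assumes "cadlag x" "t \<notin> jumps x" "t \<noteq> 0"
  shows "isCont (\<lambda>s. x (max 0 s)) t"
proof (cases "0 < t")
  case True
  have ev: "\<forall>\<^sub>F s in at t. x s = x (max 0 s)"
    using eventually_at_in_open'[of "{0<..}" t] True by (auto elim!: eventually_mono)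
  have "(x \<longlongrightarrow> x t) (at_left t)" "(x \<longlongrightarrow> x t) (at_right t)"
    using cadlag_left[OF assms(1) True] cadlag_right[OF assms(1), of t] True assms(2)
    unfolding jumps_def by simp_all
  then have "(x \<longlongrightarrow> x t) (at t)" by (simp add: filterlim_split_at_real)
  then have "((\<lambda>s. x (max 0 s)) \<longlongrightarrow> x t) (at t)"
    using ev by (rule Lim_transform_eventually)
  then show ?thesis using True by (simp add: isCont_def)
next
  case False
  then have "t < 0" using assms(3) by simp
  then have "\<forall>\<^sub>F s in nhds t. s \<in> {..<0}"
    by (intro eventually_nhds_in_open) auto
  then have "\<forall>\<^sub>F s in nhds t. x (max 0 s) = x 0"
    by eventually_elim (simp add: max_def)
  then have "isCont (\<lambda>s. x (max 0 s)) t = isCont (\<lambda>_. x 0) t" by (rule isCont_cong)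
  then show ?thesis by simp
qed

lemma cadlag_measurable:
  assumes "cadlag x"
  shows "(\<lambda>s. x (max 0 s)) \<in> borel_measurable borel"
proof (rule borel_measurable_continuous_countable_exceptions)
  show "countable (insert 0 (jumps x))" using countable_jumps[OF assms] by simp
  show "continuous_on (- insert 0 (jumps x)) (\<lambda>s. x (max 0 s))"
    using isCont_cadlag[OF assms] by (auto intro!: continuous_at_imp_continuous_on)
qed

lemma cadlag_continuous_on:
  assumes "continuous_on {0..} w"
  shows "cadlag w"
  unfolding cadlag_def
proof (intro conjI allI impI)
  fix t :: real assume t: "0 \<le> t"
  have "(w \<longlongrightarrow> w t) (at t within {0..})" using assms t by (auto simp: continuous_on)
  then show "(w \<longlongrightarrow> w t) (at_right t)" by (rule tendsto_within_subset) (use t in auto)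
next
  fix t :: real assume t: "0 < t"
  have "(w \<longlongrightarrow> w t) (at t within {0<..})"
    by (rule tendsto_within_subset[of _ _ _ "{0..}"]) (use assms t in \<open>auto simp: continuous_on\<close>)
  then have "(w \<longlongrightarrow> w t) (at t)" using t by (simp add: at_within_open[of t "{0<..}"])
  then show "\<exists>y. (w \<longlongrightarrow> y) (at_left t)" by (auto simp: filterlim_at_split)
qed

lemma left_limit_continuous:
  assumes "continuous_on {0..} w" "0 < t"
  shows "left_limit w t = w t"
proof (rule left_limit_eqI)
  have "(w \<longlongrightarrow> w t) (at t within {0<..})"
    by (rule tendsto_within_subset[of _ _ _ "{0..}"]) (use assms in \<open>auto simp: continuous_on\<close>)
  then have "(w \<longlongrightarrow> w t) (at t)" using assms(2) by (simp add: at_within_open[of t "{0<..}"])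
  then show "(w \<longlongrightarrow> w t) (at_left t)" by (auto simp: filterlim_at_split)
qed

section \<open>A clock that runs through the jumps\<close>

text \<open>
  A probability on the line that charges every jump time. The point \<open>-1\<close> is added so that the set
  of atoms is nonempty; being negative, it does not influence the clock on \<open>[0,\<infinity>)\<close>.
\<close>

definition jump_pmf :: "(real \<Rightarrow> real) \<Rightarrow> real pmf" where
  "jump_pmf x = map_pmf (from_nat_into (insert (-1) (jumps x))) (geometric_pmf (1 / 2))"

text \<open>
  The drift makes the clock strictly increasing with a \<open>1\<close>-Lipschitz inverse, and the atoms open
  an interval of positive length at every jump of \<open>x\<close>.
\<close>

definition clock :: "(real \<Rightarrow> real) \<Rightarrow> real \<Rightarrow> real" where
  "clock x t = t + measure_pmf.prob (jump_pmf x) {0<..t}"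

definition clock_left :: "(real \<Rightarrow> real) \<Rightarrow> real \<Rightarrow> real" where
  "clock_left x t = clock x t - pmf (jump_pmf x) t"

definition clock_inv :: "(real \<Rightarrow> real) \<Rightarrow> real \<Rightarrow> real" where
  "clock_inv x u = Sup {t. 0 \<le> t \<and> clock x t \<le> u}"

definition fill_slope :: "(real \<Rightarrow> real) \<Rightarrow> real \<Rightarrow> real" where
  "fill_slope x t = (x t - left_limit x t) / pmf (jump_pmf x) t"

text \<open>
  The path read on the scale of the clock, interpolated linearly across each jump. At times
  without jump the slope is a division by \<open>0\<close>, hence \<open>0\<close>, and the formula still gives \<open>x t\<close>.
\<close>

definition fill :: "(real \<Rightarrow> real) \<Rightarrow> real \<Rightarrow> real" where
  "fill x u = (let t = clock_inv x u in x t - (clock x t - u) * fill_slope x t)"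

locale cadlag_path =
  fixes x :: "real \<Rightarrow> real"
  assumes cadlag: "cadlag x"
begin

abbreviation "jp t \<equiv> pmf (jump_pmf x) t"

lemma set_jump_pmf: "set_pmf (jump_pmf x) = insert (-1) (jumps x)"
  using countable_jumps[OF cadlag]
  by (simp add: jump_pmf_def set_pmf_geometric range_from_nat_into)

lemma jp_eq_0_iff: "0 \<le> t \<Longrightarrow> jp t = 0 \<longleftrightarrow> t \<notin> jumps x"
  using set_jump_pmf by (auto simp: pmf_eq_0_set_pmf)

lemma jp_0 [simp]: "jp 0 = 0"
  by (simp add: jp_eq_0_iff jumps_def)

lemma no_jump: "0 < t \<Longrightarrow> jp t = 0 \<Longrightarrow> left_limit x t = x t"
  using jp_eq_0_iff[of t] by (auto simp: jumps_def)

lemma clock_0 [simp]: "clock x 0 = 0"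
  by (simp add: clock_def)

lemma clock_left_0 [simp]: "clock_left x 0 = 0"
  by (simp add: clock_left_def)

lemma clock_left_le: "clock_left x t \<le> clock x t"
  by (simp add: clock_left_def)

lemma clock_diff: "0 \<le> s \<Longrightarrow> s \<le> t \<Longrightarrow> t - s \<le> clock x t - clock x s"
  unfolding clock_def
  using measure_pmf.finite_measure_mono[of "{0<..s}" "{0<..t}" "jump_pmf x"] by fastforce

lemma clock_mono: "0 \<le> s \<Longrightarrow> s \<le> t \<Longrightarrow> clock x s \<le> clock x t"
  using clock_diff[of s t] by linarith

lemma clock_ge: "0 \<le> t \<Longrightarrow> t \<le> clock x t"
  by (simp add: clock_def)

lemma clock_left_diff:
  assumes "0 \<le> s" "s < t"
  shows "t - s \<le> clock_left x t - clock x s"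
proof -
  have "measure_pmf.prob (jump_pmf x) ({0<..s} \<union> {t}) \<le> measure_pmf.prob (jump_pmf x) {0<..t}"
    by (rule measure_pmf.finite_measure_mono) (use assms in auto)
  moreover have "measure_pmf.prob (jump_pmf x) ({0<..s} \<union> {t})
      = measure_pmf.prob (jump_pmf x) {0<..s} + jp t"
    by (subst measure_pmf.finite_measure_Union) (use assms in \<open>auto simp: pmf.rep_eq\<close>)
  ultimately show ?thesis by (simp add: clock_left_def clock_def)
qed

lemma clock_left_nonneg: "0 \<le> t \<Longrightarrow> 0 \<le> clock_left x t"
  using clock_left_diff[of 0 t] by (cases "t = 0") auto

lemma
  shows clock_right_continuous: "0 \<le> t \<Longrightarrow> ((clock x) \<longlongrightarrow> clock x t) (at_right t)"
    and clock_tendsto_left: "0 < t \<Longrightarrow> ((clock x) \<longlongrightarrow> clock_left x t) (at_left t)"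
proof -
  define \<nu> where "\<nu> = distr (measure_pmf (jump_pmf x)) borel (\<lambda>t. t)"
  have m: "measure \<nu> B = measure_pmf.prob (jump_pmf x) B" if "B \<in> sets borel" for B
    using that by (simp add: \<nu>_def measure_distr)
  interpret \<nu>: finite_borel_measure \<nu>
    unfolding finite_borel_measure_def finite_borel_measure_axioms_def
    by (simp add: \<nu>_def measure_pmf.finite_measure_distr)
  have c: "clock x t = t + (cdf \<nu> t - cdf \<nu> 0)" if "0 \<le> t" for t
    using \<nu>.cdf_diff_eq[of 0 t] that m[of "{0<..t}"]
    by (cases "t = 0") (auto simp: clock_def)
  show "((clock x) \<longlongrightarrow> clock x t) (at_right t)" if t: "0 \<le> t"
  proof -
    have "((\<lambda>t. t + (cdf \<nu> t - cdf \<nu> 0)) \<longlongrightarrow> t + (cdf \<nu> t - cdf \<nu> 0)) (at_right t)"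
      using \<nu>.cdf_is_right_cont[of t] by (intro tendsto_intros) (simp add: continuous_within)
    moreover have "\<forall>\<^sub>F s in at_right t. s + (cdf \<nu> s - cdf \<nu> 0) = clock x s"
      using eventually_at_right_less[of t] by eventually_elim (use c t in auto)
    ultimately show ?thesis using c[OF t] by (simp add: filterlim_cong Lim_transform_eventually)
  qed
  show "((clock x) \<longlongrightarrow> clock_left x t) (at_left t)" if t: "0 < t"
  proof -
    have "measure \<nu> {..t} = measure \<nu> {..<t} + measure \<nu> {t}"
      by (subst \<nu>.finite_measure_Union[symmetric]) (auto intro!: arg_cong[where f = "measure \<nu>"])
    then have cl: "clock_left x t = t + (measure \<nu> {..<t} - cdf \<nu> 0)"
      using c[of t] t m[of "{t}"] by (simp add: clock_left_def cdf_def pmf.rep_eq)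
    have "((\<lambda>t. t + (cdf \<nu> t - cdf \<nu> 0)) \<longlongrightarrow> t + (measure \<nu> {..<t} - cdf \<nu> 0)) (at_left t)"
      using \<nu>.cdf_at_left[of t] by (intro tendsto_intros)
    moreover have "\<forall>\<^sub>F s in at_left t. s \<in> {0<..<t}"
      using eventually_at_left_real[OF t] .
    then have "\<forall>\<^sub>F s in at_left t. s + (cdf \<nu> s - cdf \<nu> 0) = clock x s"
      by eventually_elim (use c in auto)
    ultimately show ?thesis unfolding cl by (rule Lim_transform_eventually)
  qed
qed

lemma cadlag_clock: "cadlag (clock x)"
  unfolding cadlag_def using clock_right_continuous clock_tendsto_left by blast

lemma left_limit_clock: "0 < t \<Longrightarrow> left_limit (clock x) t = clock_left x t"
  by (rule left_limit_eqI) (rule clock_tendsto_left)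

lemma clock_inv_bounds:
  assumes "0 \<le> u"
  shows "0 \<le> clock_inv x u" "clock_left x (clock_inv x u) \<le> u" "u \<le> clock x (clock_inv x u)"
proof -
  define A where "A = {t. 0 \<le> t \<and> clock x t \<le> u}"
  define t where "t = clock_inv x u"
  have t_Sup: "t = Sup A" by (simp add: t_def A_def clock_inv_def)
  have A: "0 \<in> A" "\<And>s. s \<in> A \<Longrightarrow> s \<le> u"
    using assms clock_ge by (auto simp: A_def intro: order_trans)
  then have bdd: "bdd_above A" by (auto simp: bdd_above_def)
  show t0: "0 \<le> clock_inv x u" using cSup_upper[OF A(1) bdd] t_Sup t_def by simp
  have below: "clock x s \<le> u" if s: "0 \<le> s" "s < t" for s
  proof -
    obtain s' where "s' \<in> A" "s < s'" using less_cSupD[of A s] A(1) s(2) t_Sup by blast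
    then show ?thesis using clock_mono[of s s'] s by (auto simp: A_def)
  qed
  have above: "u < clock x s" if "t < s" for s
  proof (rule ccontr)
    assume "\<not> u < clock x s"
    then have "s \<in> A" using that t0 t_def by (simp add: A_def)
    then show False using cSup_upper[OF _ bdd, of s] that t_Sup by simp
  qed
  show "clock_left x (clock_inv x u) \<le> u"
  proof (cases "t = 0")
    case True
    then show ?thesis using assms by (simp flip: t_def)
  next
    case False
    then have tpos: "0 < t" using t0 t_def by simp
    have "clock_left x t \<le> u"
    proof (rule tendsto_upperbound[OF clock_tendsto_left[OF tpos]])
      show "\<forall>\<^sub>F s in at_left t. clock x s \<le> u"
        using eventually_at_left_real[OF tpos] by eventually_elim (use below in auto)
    qed simp
    then show ?thesis by (simp add: t_def)
  qed
  have "u \<le> clock x t"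
  proof (rule tendsto_lowerbound[OF clock_right_continuous])
    show "0 \<le> t" using t0 t_def by simp
    show "\<forall>\<^sub>F s in at_right t. u \<le> clock x s"
      using eventually_at_right_less[of t] by eventually_elim (use above in force)
  qed simp
  then show "u \<le> clock x (clock_inv x u)" by (simp add: t_def)
qed

text \<open>
  The intervals \<open>[clock_left x t, clock x t]\<close> are disjoint for different \<open>t\<close>, because the clock gains at least the
  elapsed time between two of them.
\<close>

lemma clock_inv_eqI:
  assumes "0 \<le> t" "clock_left x t \<le> u" "u \<le> clock x t"
  shows "clock_inv x u = t"
proof -
  have "0 \<le> u" using assms clock_left_nonneg[of t] by simp
  note b = clock_inv_bounds[OF this]
  show ?thesis
    using clock_left_diff[of t "clock_inv x u"] clock_left_diff[of "clock_inv x u" t] b assms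
    by (cases "clock_inv x u" t rule: linorder_cases) auto
qed

lemma clock_inv_clock [simp]: "0 \<le> t \<Longrightarrow> clock_inv x (clock x t) = t"
  by (rule clock_inv_eqI) (auto simp: clock_left_le)

lemma clock_inv_0 [simp]: "clock_inv x 0 = 0"
  using clock_inv_clock[of 0] by simp

lemma clock_inv_lipschitz:
  assumes "0 \<le> u" "u \<le> u'"
  shows "clock_inv x u \<le> clock_inv x u'" "clock_inv x u' - clock_inv x u \<le> u' - u"
proof -
  note b = clock_inv_bounds[OF assms(1)] and b' = clock_inv_bounds[of u']
  show 1: "clock_inv x u \<le> clock_inv x u'"
    using clock_left_diff[of "clock_inv x u'" "clock_inv x u"] b b' assms by fastforce
  show "clock_inv x u' - clock_inv x u \<le> u' - u"
    using clock_left_diff[of "clock_inv x u" "clock_inv x u'"] b b' assms 1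
    by (cases "clock_inv x u = clock_inv x u'") auto
qed

lemma clock_inv_dist: "0 \<le> u \<Longrightarrow> 0 \<le> u' \<Longrightarrow> \<bar>clock_inv x u' - clock_inv x u\<bar> \<le> \<bar>u' - u\<bar>"
  using clock_inv_lipschitz[of u u'] clock_inv_lipschitz[of u' u] by linarith

lemma continuous_clock_inv: "continuous_on {0..} (clock_inv x)"
  unfolding continuous_on_iff dist_real_def
  by (metis atLeast_iff clock_inv_dist le_less_trans)

lemma fill_right:
  assumes "0 \<le> t" "clock_left x t \<le> u" "u \<le> clock x t"
  shows "fill x u = x t - (clock x t - u) * fill_slope x t"
  using clock_inv_eqI[OF assms] by (simp add: fill_def Let_def)

lemma fill_left:
  assumes "0 < t" "clock_left x t \<le> u" "u \<le> clock x t"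
  shows "fill x u = left_limit x t + (u - clock_left x t) * fill_slope x t"
proof -
  have "jp t * fill_slope x t = x t - left_limit x t"
    using no_jump[OF assms(1)] by (simp add: fill_slope_def)
  then have "x t - (clock x t - u) * fill_slope x t
      = left_limit x t + (u - clock_left x t) * fill_slope x t"
    by (simp add: clock_left_def algebra_simps)
  with fill_right[OF _ assms(2,3)] assms(1) show ?thesis by simp
qed

lemma fill_clock [simp]: "0 \<le> t \<Longrightarrow> fill x (clock x t) = x t"
  by (subst fill_right[of t]) (auto simp: clock_left_le)

lemma fill_convex:
  assumes "0 < t" "clock_left x t \<le> u" "u \<le> clock x t"
  obtains c where "0 \<le> c" "c \<le> 1" "fill x u = c * left_limit x t + (1 - c) * x t"
proof (cases "jp t = 0")
  case True
  then show ?thesis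
    using that[of 0] fill_right[OF _ assms(2,3)] assms(1) by (simp add: fill_slope_def)
next
  case False
  then have "0 < jp t" by (simp add: order_less_le)
  show ?thesis
  proof (rule that[of "(clock x t - u) / jp t"])
    show "0 \<le> (clock x t - u) / jp t" using assms by simp
    show "(clock x t - u) / jp t \<le> 1"
      using assms \<open>0 < jp t\<close> by (simp add: clock_left_def)
    have "fill x u = x t - (clock x t - u) / jp t * (x t - left_limit x t)"
      using fill_right[OF _ assms(2,3)] assms(1) by (simp add: fill_slope_def)
    then show "fill x u = (clock x t - u) / jp t * left_limit x t + (1 - (clock x t - u) / jp t) * x t"
      by (simp only: algebra_simps)
  qed
qed

lemma fill_near:
  assumes "0 < t" "clock_left x t \<le> u" "u \<le> clock x t" "\<bar>x t - c\<bar> \<le> e" "\<bar>left_limit x t - c\<bar> \<le> e"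
  shows "\<bar>fill x u - c\<bar> \<le> e"
proof -
  obtain a where a: "0 \<le> a" "a \<le> 1" "fill x u = a * left_limit x t + (1 - a) * x t"
    using fill_convex[OF assms(1-3)] .
  have "fill x u - c = a * (left_limit x t - c) + (1 - a) * (x t - c)"
    using a(3) by (simp add: algebra_simps)
  also have "\<bar>\<dots>\<bar> \<le> a * \<bar>left_limit x t - c\<bar> + (1 - a) * \<bar>x t - c\<bar>"
    using a by (simp add: abs_mult order_trans[OF abs_triangle_ineq])
  also have "\<dots> \<le> a * e + (1 - a) * e"
    using a assms(4,5) by (intro add_mono mult_left_mono) auto
  finally show ?thesis by (simp add: algebra_simps)
qed

text \<open>
  Within the interval of one jump the function is affine. Leaving that interval means passing to
  nearby times, where values and left limits are close to \<open>x t0\<close> on the right and to the left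
  limit at \<open>t0\<close> on the left; these are the values of the interpolation at the two ends.
\<close>

lemma continuous_fill: "continuous_on {0..} (fill x)"
  unfolding continuous_on_iff
proof (intro ballI allI impI)
  fix u0 e :: real assume u0: "u0 \<in> {0..}" and e: "0 < e"
  define t0 where "t0 = clock_inv x u0"
  have t0: "0 \<le> t0" "clock_left x t0 \<le> u0" "u0 \<le> clock x t0"
    using clock_inv_bounds[of u0] u0 by (auto simp: t0_def)
  have e2: "0 < e / 2" using e by simp
  obtain r where r: "0 < r"
    "\<And>s. t0 \<le> s \<Longrightarrow> s < t0 + r \<Longrightarrow> \<bar>x s - x t0\<bar> < e / 2"
    "\<And>s. t0 < s \<Longrightarrow> s < t0 + r \<Longrightarrow> \<bar>left_limit x s - x t0\<bar> \<le> e / 2"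
    "\<And>s. 0 \<le> s \<Longrightarrow> t0 - r < s \<Longrightarrow> s < t0 \<Longrightarrow> \<bar>x s - left_limit x t0\<bar> < e / 2"
    "\<And>s. 0 < s \<Longrightarrow> t0 - r < s \<Longrightarrow> s < t0 \<Longrightarrow> \<bar>left_limit x s - left_limit x t0\<bar> \<le> e / 2"
    using cadlag_two_values[OF cadlag t0(1) e2] by blast
  define C where "C = \<bar>fill_slope x t0\<bar>"
  define d where "d = min r (e / (2 * (C + 1)))"
  have C: "0 \<le> C" by (simp add: C_def)
  have d: "0 < d" "d \<le> r" "C * d < e / 2"
  proof -
    show "0 < d" "d \<le> r" using r(1) e C by (auto simp: d_def)
    have "C * d \<le> C * (e / (2 * (C + 1)))" using C by (intro mult_left_mono) (auto simp: d_def)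
    also have "\<dots> < e / 2" using e C by (simp add: field_simps)
    finally show "C * d < e / 2" .
  qed
  show "\<exists>d>0. \<forall>u\<in>{0..}. dist u u0 < d \<longrightarrow> dist (fill x u) (fill x u0) < e"
  proof (intro exI[of _ d] conjI ballI impI d(1))
    fix u assume u: "u \<in> {0..}" "dist u u0 < d"
    define t where "t = clock_inv x u"
    have t: "0 \<le> t" "clock_left x t \<le> u" "u \<le> clock x t"
      using clock_inv_bounds[of u] u by (auto simp: t_def)
    have tt0: "\<bar>t - t0\<bar> < r"
      using clock_inv_dist[of u0 u] u u0 d by (auto simp: t_def t0_def dist_real_def)
    have Cu: "\<bar>u - u0\<bar> * C < e / 2"
      using mult_left_mono[of "\<bar>u - u0\<bar>" d C] u(2) C d(3) by (auto simp: dist_real_def mult.commute)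
    have "\<bar>fill x u - fill x u0\<bar> < e"
    proof (cases t t0 rule: linorder_cases)
      case equal
      then have "fill x u - fill x u0 = (u - u0) * fill_slope x t0"
        using fill_right[OF t] fill_right[OF t0] by (simp add: algebra_simps)
      then show ?thesis using Cu e by (simp add: abs_mult C_def)
    next
      case greater
      have 1: "\<bar>fill x u - x t0\<bar> \<le> e / 2"
        by (rule fill_near[of t]) (use t t0 greater tt0 r(2)[of t] r(3)[of t] in auto)
      have "clock x t0 \<le> u" using clock_left_diff[OF t0(1) greater] t(2) greater by linarith
      then have "(clock x t0 - u0) * C \<le> \<bar>u - u0\<bar> * C" using C by (intro mult_right_mono) auto
      then have 2: "\<bar>fill x u0 - x t0\<bar> < e / 2"
        using fill_right[OF t0] t0 Cu by (simp add: abs_mult C_def)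
      show ?thesis using 1 2 by linarith
    next
      case less
      have t0': "0 < t0" using less t(1) by simp
      have "\<bar>fill x u - left_limit x t0\<bar> \<le> e / 2"
      proof (cases "t = 0")
        case True
        then have "u = 0" using t by simp
        then have "fill x u = x t" using fill_clock[of 0] True by simp
        then show ?thesis using r(4)[of t] t tt0 less by auto
      next
        case False
        show ?thesis
          by (rule fill_near[of t]) (use t False less tt0 r(4)[of t] r(5)[of t] in auto)
      qed
      moreover have "u \<le> clock_left x t0" using clock_left_diff[OF t(1) less] t(3) less by linarith
      then have "(u0 - clock_left x t0) * C \<le> \<bar>u - u0\<bar> * C" using C by (intro mult_right_mono) auto
      then have "\<bar>fill x u0 - left_limit x t0\<bar> < e / 2"
        using fill_left[OF t0' t0(2,3)] t0 Cu by (simp add: abs_mult C_def)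
      ultimately show ?thesis by linarith
    qed
    then show "dist (fill x u) (fill x u0) < e" by (simp add: dist_real_def)
  qed
qed

end

section \<open>Parametric representations and the triangle inequality\<close>

text \<open>
  Intervals of constancy are allowed, since a parametrization may rest at a point of the graph.
\<close>

definition time_change :: "real \<Rightarrow> (real \<Rightarrow> real) \<Rightarrow> bool" where
  "time_change L \<phi> \<longleftrightarrow> continuous_on {0..1} \<phi> \<and> mono_on {0..1} \<phi> \<and> \<phi> ` {0..1} = {0..L}"

lemma time_changeI:
  assumes "continuous_on {0..1} \<phi>" "\<And>u v. 0 \<le> u \<Longrightarrow> u \<le> v \<Longrightarrow> v \<le> 1 \<Longrightarrow> \<phi> u \<le> \<phi> v" "\<phi> 0 = 0" "\<phi> 1 = L"
  shows "time_change L \<phi>"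
  unfolding time_change_def
proof (intro conjI subset_antisym subsetI)
  fix y assume "y \<in> {0..L}"
  then show "y \<in> \<phi> ` {0..1}"
    using IVT'[of \<phi> 0 y 1] assms by force
qed (use assms in \<open>auto simp: mono_on_def, metis order_refl\<close>)

lemma time_change_linear: "0 \<le> L \<Longrightarrow> time_change L (\<lambda>u. L * u)"
  by (rule time_changeI) (auto intro!: continuous_intros mult_left_mono)

lemma time_change_range: "time_change L \<phi> \<Longrightarrow> 0 \<le> u \<Longrightarrow> u \<le> 1 \<Longrightarrow> 0 \<le> \<phi> u \<and> \<phi> u \<le> L"
  unfolding time_change_def by (metis atLeastAtMost_iff imageI)

lemma time_change_mono: "time_change L \<phi> \<Longrightarrow> 0 \<le> u \<Longrightarrow> u \<le> v \<Longrightarrow> v \<le> 1 \<Longrightarrow> \<phi> u \<le> \<phi> v"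
  unfolding time_change_def mono_on_def by auto

lemma time_change_0:
  assumes "time_change L \<phi>" "0 \<le> L"
  shows "\<phi> 0 = 0"
proof -
  have "0 \<in> \<phi> ` {0..1}" using assms by (simp add: time_change_def)
  then obtain u where "0 \<le> u" "u \<le> 1" "\<phi> u = 0" by auto
  then show ?thesis
    using time_change_mono[OF assms(1), of 0 u] time_change_range[OF assms(1), of 0] by simp
qed

lemma time_change_1:
  assumes "time_change L \<phi>" "0 \<le> L"
  shows "\<phi> 1 = L"
proof -
  have "L \<in> \<phi> ` {0..1}" using assms by (simp add: time_change_def)
  then obtain u where "0 \<le> u" "u \<le> 1" "\<phi> u = L" by auto
  then show ?thesis
    using time_change_mono[OF assms(1), of u 1] time_change_range[OF assms(1), of 1] by simp
qed

lemma time_change_continuous: "time_change L \<phi> \<Longrightarrow> continuous_on {0..1} \<phi>"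
  by (simp add: time_change_def)

lemma reparametrization:
  assumes "\<gamma> \<in> parametric_representations T x" "time_change 1 \<psi>"
  shows "(\<lambda>u. \<gamma> (\<psi> u)) \<in> parametric_representations T x"
proof -
  have "continuous_on {0..1} (\<lambda>u. \<gamma> (\<psi> u))"
    by (rule continuous_on_compose2[of "{0..1}"])
      (use assms in \<open>auto simp: parametric_representations_def time_change_def\<close>)
  moreover have "(\<lambda>u. \<gamma> (\<psi> u)) ` {0..1} = \<gamma> ` \<psi> ` {0..1}" by (simp add: image_image)
  ultimately show ?thesis
    using assms time_change_mono[OF assms(2)] time_change_range[OF assms(2)]
    by (auto simp: parametric_representations_def time_change_def)
qed

lemma graph_parametrization:
  assumes w: "continuous_on {0..} w" and \<phi>: "time_change T \<phi>"
  shows "(\<lambda>u. (w (\<phi> u), \<phi> u)) \<in> parametric_representations T w"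
proof -
  have r: "0 \<le> \<phi> u" "\<phi> u \<le> T" if "u \<in> {0..1}" for u
    using time_change_range[OF \<phi>, of u] that by auto
  have "continuous_on {0..1} (\<lambda>u. w (\<phi> u))"
    by (rule continuous_on_compose2[OF w]) (use \<phi> r in \<open>auto simp: time_change_def\<close>)
  then have "continuous_on {0..1} (\<lambda>u. (w (\<phi> u), \<phi> u))"
    using \<phi> by (intro continuous_intros) (auto simp: time_change_def)
  moreover have "(\<lambda>u. (w (\<phi> u), \<phi> u)) ` {0..1} = completed_graph T w"
  proof -
    have "(\<lambda>u. (w (\<phi> u), \<phi> u)) ` {0..1} = (\<lambda>t. (w t, t)) ` \<phi> ` {0..1}" by (simp add: image_image)
    also have "\<dots> = (\<lambda>t. (w t, t)) ` {0..T}" using \<phi> by (simp add: time_change_def)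
    also have "\<dots> = completed_graph T w"
    proof -
      have "0 \<le> T" using r[of 0] by auto
      moreover have "c * left_limit w t + (1 - c) * w t = w t" if "0 < t" for c t
        using left_limit_continuous[OF w that] by (simp add: algebra_simps)
      ultimately show ?thesis
        unfolding completed_graph_def by (auto simp: image_iff less_le intro: bexI[of _ 0])
    qed
    finally show ?thesis .
  qed
  moreover have "graph_le w (w (\<phi> u), \<phi> u) (w (\<phi> v), \<phi> v)" if "u \<in> {0..1}" "v \<in> {0..1}" "u \<le> v" for u v
    using time_change_mono[OF \<phi>, of u v] that by auto
  ultimately show ?thesis by (simp add: parametric_representations_def)
qed

context cadlag_path
begin

abbreviation path :: "real \<Rightarrow> real \<times> real" where
  "path u \<equiv> (fill x u, clock_inv x u)"

text \<open>
  At a jump time the clock has an atom and the slope of the interpolation is nonzero, so distance from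
  the left limit measures the parameter. Elsewhere the time component alone decides.
\<close>

lemma path_order_iff:
  assumes "0 \<le> u" "0 \<le> u'"
  shows "graph_le x (path u) (path u') \<longleftrightarrow> u \<le> u'"
proof -
  define t t' where "t = clock_inv x u" and "t' = clock_inv x u'"
  have t: "0 \<le> t" "clock_left x t \<le> u" "u \<le> clock x t"
    using clock_inv_bounds[OF assms(1)] by (auto simp: t_def)
  have t': "0 \<le> t'" "clock_left x t' \<le> u'" "u' \<le> clock x t'"
    using clock_inv_bounds[OF assms(2)] by (auto simp: t'_def)
  show ?thesis
  proof (cases t t' rule: linorder_cases)
    case less
    then show ?thesis using clock_left_diff[OF t(1) less] t t' by (simp flip: t_def t'_def)
  next
    case greater
    then show ?thesis using clock_left_diff[OF t'(1) greater] t t' by (simp flip: t_def t'_def)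
  next
    case equal
    show ?thesis
    proof (cases "jp t = 0")
      case True
      then have "u = clock x t" "u' = clock x t"
        using t t' equal by (auto simp: clock_left_def)
      then show ?thesis by simp
    next
      case False
      then have j: "0 < jp t" by (simp add: order_less_le)
      then have "0 < t" using t(1) by (cases "t = 0") auto
      have "t \<in> jumps x" using False jp_eq_0_iff[OF t(1)] by simp
      then have C: "0 < \<bar>fill_slope x t\<bar>" using j by (simp add: fill_slope_def jumps_def)
      have "\<bar>left_limit x t - fill x u\<bar> = (u - clock_left x t) * \<bar>fill_slope x t\<bar>"
        using fill_left[OF \<open>0 < t\<close> t(2,3)] t(2) by (simp add: abs_mult)
      moreover have "\<bar>left_limit x t - fill x u'\<bar> = (u' - clock_left x t) * \<bar>fill_slope x t\<bar>"
        using fill_left[of t u'] \<open>0 < t\<close> t' equal by (simp add: abs_mult)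
      ultimately show ?thesis using C equal by (simp flip: t_def t'_def)
    qed
  qed
qed

lemma inj_on_path: "inj_on path {0..}"
proof (rule inj_onI)
  fix u u' assume "u \<in> {0..}" "u' \<in> {0..}" and eq: "path u = path u'"
  then have nn: "0 \<le> u" "0 \<le> u'" by simp_all
  have "graph_le x (path u) (path u')" "graph_le x (path u') (path u)"
    unfolding eq by (simp_all only: path_order_iff[OF nn(2,2)] order_refl)
  then show "u = u'" unfolding path_order_iff[OF nn] path_order_iff[OF nn(2,1)] by (rule antisym)
qed

lemma continuous_path: "continuous_on {0..} path"
  by (intro continuous_intros continuous_fill continuous_clock_inv)

lemma path_image:
  assumes "0 < T"
  shows "path ` {0..clock x T} = completed_graph T x"
proof (intro subset_antisym subsetI)
  fix q assume "q \<in> path ` {0..clock x T}"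
  then obtain u where u: "0 \<le> u" "u \<le> clock x T" "q = path u" by auto
  define t where "t = clock_inv x u"
  have t: "0 \<le> t" "clock_left x t \<le> u" "u \<le> clock x t"
    using clock_inv_bounds[OF u(1)] by (auto simp: t_def)
  have tT: "t \<le> T"
    using clock_inv_lipschitz(1)[OF u(1,2)] assms by (simp add: t_def)
  show "q \<in> completed_graph T x"
  proof (cases "t = 0")
    case True
    then have "u = 0" using t by simp
    then show ?thesis using u(3) fill_clock[of 0] by (simp add: completed_graph_def)
  next
    case False
    then have "0 < t" using t(1) by simp
    then obtain c where "0 \<le> c" "c \<le> 1" "fill x u = c * left_limit x t + (1 - c) * x t"
      using fill_convex[OF _ t(2,3)] by blast
    then show ?thesis using u(3) \<open>0 < t\<close> tT by (auto simp: completed_graph_def simp flip: t_def)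
  qed
next
  fix q assume "q \<in> completed_graph T x"
  then consider "q = (x 0, 0)" | c t where "0 < t" "t \<le> T" "0 \<le> c" "c \<le> 1"
      "q = (c * left_limit x t + (1 - c) * x t, t)"
    by (auto simp: completed_graph_def)
  then show "q \<in> path ` {0..clock x T}"
  proof cases
    case 1
    then have "q = path 0" using fill_clock[of 0] by simp
    moreover have "0 \<le> clock x T" using clock_ge[of T] assms by simp
    ultimately show ?thesis by auto
  next
    case 2
    define u where "u = clock x t - c * jp t"
    have cj: "0 \<le> c * jp t" "c * jp t \<le> jp t" using 2 by (auto intro: mult_left_le_one_le)
    then have u: "clock_left x t \<le> u" "u \<le> clock x t"
      by (auto simp: u_def clock_left_def)
    have "jp t * fill_slope x t = x t - left_limit x t"
      using no_jump[OF 2(1)] by (simp add: fill_slope_def)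
    then have "fill x u = x t - c * (x t - left_limit x t)"
      using fill_right[of t u] u 2(1) by (simp add: u_def)
    then have "q = path u"
      using 2 clock_inv_eqI[of t u] u by (simp add: algebra_simps)
    moreover have "0 \<le> u" "u \<le> clock x T"
      using u clock_left_nonneg[of t] clock_mono[of t T] 2 by auto
    ultimately show ?thesis by auto
  qed
qed

lemma path_parametrization:
  assumes "0 < T" "time_change (clock x T) \<phi>"
  shows "(\<lambda>u. path (\<phi> u)) \<in> parametric_representations T x"
proof -
  have r: "0 \<le> \<phi> u" "\<phi> u \<le> clock x T" if "u \<in> {0..1}" for u
    using time_change_range[OF assms(2), of u] that by auto
  have "continuous_on {0..1} (\<lambda>u. path (\<phi> u))"
    by (rule continuous_on_compose2[OF continuous_path])
      (use assms r in \<open>auto simp: time_change_def\<close>)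
  moreover have "(\<lambda>u. path (\<phi> u)) ` {0..1} = path ` \<phi> ` {0..1}" by (simp add: image_image)
  moreover have "graph_le x (path (\<phi> u)) (path (\<phi> v))" if "u \<in> {0..1}" "v \<in> {0..1}" "u \<le> v" for u v
    using time_change_mono[OF assms(2), of u v] path_order_iff[of "\<phi> u" "\<phi> v"] r that
    by auto
  ultimately show ?thesis
    using path_image[OF assms(1)] assms(2)
    by (simp add: parametric_representations_def time_change_def)
qed

text \<open>
  The curve \<open>path\<close> is a homeomorphism from a compact interval onto the completed graph that
  respects the orders, so composing with its inverse turns any parametrization into a
  monotone function of one real variable.
\<close>

lemma parametrization_factors:
  assumes "0 < T" "\<gamma> \<in> parametric_representations T x"
  obtains \<phi> where "time_change (clock x T) \<phi>" "\<And>u. 0 \<le> u \<Longrightarrow> u \<le> 1 \<Longrightarrow> \<gamma> u = path (\<phi> u)"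
proof -
  define L where "L = clock x T"
  define g where "g = the_inv_into {0..L} path"
  define \<phi> where "\<phi> = (\<lambda>u. g (\<gamma> u))"
  have inj: "inj_on path {0..L}" by (rule inj_on_subset[OF inj_on_path]) auto
  have im: "path ` {0..L} = completed_graph T x" using path_image[OF assms(1)] by (simp add: L_def)
  have \<gamma>: "continuous_on {0..1} \<gamma>" "\<gamma> ` {0..1} = completed_graph T x"
    "\<And>u v. 0 \<le> u \<Longrightarrow> u \<le> v \<Longrightarrow> v \<le> 1 \<Longrightarrow> graph_le x (\<gamma> u) (\<gamma> v)"
    using assms(2) by (auto simp: parametric_representations_def)
  have gp: "g (path u) = u" if "u \<in> {0..L}" for u
    unfolding g_def by (rule the_inv_into_f_f[OF inj that])
  have pg: "path (g q) = q" if "q \<in> completed_graph T x" for q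
    unfolding g_def by (rule f_the_inv_into_f[OF inj]) (use that im in simp)
  have "continuous_on (path ` {0..L}) g"
    by (rule continuous_on_inv)
      (use gp in \<open>auto intro!: continuous_on_subset[OF continuous_path]\<close>)
  then have g: "continuous_on (completed_graph T x) g" using im by simp
  have gim: "g ` completed_graph T x = {0..L}"
    unfolding im[symmetric] image_image using gp by simp
  show ?thesis
  proof (rule that[of \<phi>])
    show e: "\<gamma> u = path (\<phi> u)" if "0 \<le> u" "u \<le> 1" for u
    proof -
      have "\<gamma> u \<in> completed_graph T x" using \<gamma>(2) that by auto
      from pg[OF this] show ?thesis by (simp add: \<phi>_def)
    qed
    have im\<phi>: "\<phi> ` {0..1} = {0..L}"
    proof -
      have "\<phi> ` {0..1} = g ` \<gamma> ` {0..1}" by (simp add: \<phi>_def image_image)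
      then show ?thesis using \<gamma>(2) gim by simp
    qed
    have "mono_on {0..1} \<phi>"
    proof (rule mono_onI)
      fix u v :: real assume uv: "u \<in> {0..1}" "v \<in> {0..1}" "u \<le> v"
      have nn: "0 \<le> \<phi> u" "0 \<le> \<phi> v" using im\<phi> uv by (metis atLeastAtMost_iff imageI)+
      have "graph_le x (path (\<phi> u)) (path (\<phi> v))"
        using \<gamma>(3)[of u v] e[of u] e[of v] uv by (metis atLeastAtMost_iff)
      then show "\<phi> u \<le> \<phi> v" using path_order_iff[OF nn] by blast
    qed
    moreover have "continuous_on {0..1} \<phi>" unfolding \<phi>_def
      by (rule continuous_on_compose2[OF g \<gamma>(1)]) (use \<gamma>(2) in simp)
    ultimately show "time_change (clock x T) \<phi>"
      using im\<phi> by (simp add: time_change_def L_def)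
  qed
qed

lemma parametric_representations_nonempty:
  assumes "0 < T"
  shows "parametric_representations T x \<noteq> {}"
  using path_parametrization[OF assms time_change_linear] clock_ge[of T] assms by fastforce

end

text \<open>
  The distance between points of graphs that enters the \<open>M\<^sub>1\<close> metric.
\<close>

definition gap :: "real \<times> real \<Rightarrow> real \<times> real \<Rightarrow> real" where
  "gap a b = max \<bar>fst a - fst b\<bar> \<bar>snd a - snd b\<bar>"

lemma gap_triangle: "gap a c \<le> gap a b + gap b c"
  by (auto simp: gap_def)

lemma gap_commute: "gap a b = gap b a"
  by (simp add: gap_def abs_minus_commute)

lemma gap_nonneg: "0 \<le> gap a b"
  by (simp add: gap_def le_max_iff_disj)

lemma gap_le_dist: "gap a b \<le> dist a b"
  using dist_fst_le[of a b] dist_snd_le[of a b] by (simp add: gap_def dist_real_def)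

lemma bdd_above_gap:
  assumes "\<gamma> \<in> parametric_representations T x" "\<gamma>' \<in> parametric_representations T x'"
  shows "bdd_above ((\<lambda>u. gap (\<gamma> u) (\<gamma>' u)) ` {0..1})"
proof -
  have "continuous_on {0..1} \<gamma>" "continuous_on {0..1} \<gamma>'"
    using assms by (auto simp: parametric_representations_def)
  then have "continuous_on {0..1} (\<lambda>u. gap (\<gamma> u) (\<gamma>' u))"
    unfolding gap_def by (intro continuous_intros)
  then have "compact ((\<lambda>u. gap (\<gamma> u) (\<gamma>' u)) ` {0..1})" by (rule compact_continuous_image) simp
  then show ?thesis by (intro bounded_imp_bdd_above compact_imp_bounded)
qed

lemma M1_dist_on_alt:
  "M1_dist_on T x x' = (INF (\<gamma>, \<gamma>') \<in> parametric_representations T x \<times> parametric_representations T x'.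
     SUP u\<in>{0..1}. gap (\<gamma> u) (\<gamma>' u))"
  by (simp add: M1_dist_on_def gap_def)

lemma M1_dist_on_le:
  assumes "\<gamma> \<in> parametric_representations T x" "\<gamma>' \<in> parametric_representations T x'"
    and "\<And>u. 0 \<le> u \<Longrightarrow> u \<le> 1 \<Longrightarrow> gap (\<gamma> u) (\<gamma>' u) \<le> d"
  shows "M1_dist_on T x x' \<le> d"
proof -
  define S where "S = (\<lambda>(\<gamma>, \<gamma>'). SUP u\<in>{0..1::real}. gap (\<gamma> u) (\<gamma>' u))"
  define P where "P = parametric_representations T x \<times> parametric_representations T x'"
  have "0 \<le> S q" if "q \<in> P" for q
  proof -
    obtain \<gamma> \<gamma>' where q: "q = (\<gamma>, \<gamma>')" by (cases q)
    have "gap (\<gamma> 0) (\<gamma>' 0) \<le> S q" unfolding q S_def case_prod_conv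
      by (rule cSUP_upper) (use q that bdd_above_gap in \<open>auto simp: P_def\<close>)
    then show ?thesis using gap_nonneg order_trans by blast
  qed
  then have "bdd_below (S ` P)" by (rule bdd_belowI2)
  then have "Inf (S ` P) \<le> S (\<gamma>, \<gamma>')"
    by (rule cINF_lower) (use assms in \<open>auto simp: P_def\<close>)
  also have "\<dots> \<le> d" unfolding S_def case_prod_conv
    by (rule cSUP_least) (use assms in auto)
  finally show ?thesis by (simp add: M1_dist_on_alt S_def P_def)
qed

lemma M1_dist_on_less:
  assumes "cadlag x" "cadlag x'" "0 < T" "M1_dist_on T x x' < d"
  obtains \<gamma> \<gamma>' d' where "\<gamma> \<in> parametric_representations T x" "\<gamma>' \<in> parametric_representations T x'"
    "d' < d" "\<And>u. 0 \<le> u \<Longrightarrow> u \<le> 1 \<Longrightarrow> gap (\<gamma> u) (\<gamma>' u) \<le> d'"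
proof -
  define S where "S = (\<lambda>(\<gamma>, \<gamma>'). SUP u\<in>{0..1::real}. gap (\<gamma> u) (\<gamma>' u))"
  define P where "P = parametric_representations T x \<times> parametric_representations T x'"
  have "P \<noteq> {}"
    using cadlag_path.parametric_representations_nonempty[OF _ assms(3)] assms(1,2)
    by (auto simp: P_def cadlag_path_def)
  moreover have "Inf (S ` P) < d" using assms(4) by (simp add: M1_dist_on_alt S_def P_def)
  ultimately obtain q where q: "q \<in> P" "S q < d" using cInf_lessD[of "S ` P" d] by auto
  obtain \<gamma> \<gamma>' where g: "q = (\<gamma>, \<gamma>')" by (cases q)
  show ?thesis
  proof (rule that)
    show "\<gamma> \<in> parametric_representations T x" "\<gamma>' \<in> parametric_representations T x'"
      using q g by (auto simp: P_def)
    then show "gap (\<gamma> u) (\<gamma>' u) \<le> S q" if "0 \<le> u" "u \<le> 1" for u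
      unfolding g S_def case_prod_conv by (intro cSUP_upper bdd_above_gap) (use that in auto)
  qed (use q in auto)
qed

lemma M1_dist_on_commute: 
  assumes "cadlag x" "cadlag x'" "0 < T" 
  shows "M1_dist_on T x x' = M1_dist_on T x' x"
proof -
  have "M1_dist_on T x' x \<le> M1_dist_on T x x'" if c: "cadlag x" "cadlag x'" for x x'
  proof (rule dense_ge)
    fix d assume d: "M1_dist_on T x x' < d"
    then obtain \<gamma> \<gamma>' d' where g: "\<gamma> \<in> parametric_representations T x"
      "\<gamma>' \<in> parametric_representations T x'"
      "d' < d" "\<And>u. 0 \<le> u \<Longrightarrow> u \<le> 1 \<Longrightarrow> gap (\<gamma> u) (\<gamma>' u) \<le> d'"
      using M1_dist_on_less[OF c assms(3) d] by blast
    show "M1_dist_on T x' x \<le> d"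
      by (rule M1_dist_on_le[OF g(2,1)])
        (metis g(3,4) gap_commute less_imp_le order_trans)
  qed
  then show ?thesis using assms by (meson antisym)
qed

text \<open>
  In an almost optimal pair the parametrization of the second graph may be replaced by the
  standard one. Mixing a small multiple of the identity into its time change makes the latter
  strictly increasing at small cost; its inverse then reparametrizes the first graph.
\<close>

lemma path_nearly_optimal:
  assumes "cadlag x" "cadlag y" "0 < T" "M1_dist_on T x y < d"
  obtains \<gamma> d' where "\<gamma> \<in> parametric_representations T x" "d' < d"
    "\<And>u. 0 \<le> u \<Longrightarrow> u \<le> 1 \<Longrightarrow> gap (\<gamma> u) (cadlag_path.path y (clock y T * u)) \<le> d'"
proof -
  interpret y: cadlag_path y by unfold_locales (rule assms)
  define L where "L = clock y T"
  have L: "0 < L" using y.clock_ge[of T] assms(3) by (simp add: L_def)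
  obtain \<gamma> \<gamma>' d' where g: "\<gamma> \<in> parametric_representations T x"
    "\<gamma>' \<in> parametric_representations T y"
    "d' < d" "\<And>u. 0 \<le> u \<Longrightarrow> u \<le> 1 \<Longrightarrow> gap (\<gamma> u) (\<gamma>' u) \<le> d'"
    using M1_dist_on_less[OF assms] by blast
  obtain \<phi> where \<phi>: "time_change L \<phi>" "\<And>u. 0 \<le> u \<Longrightarrow> u \<le> 1 \<Longrightarrow> \<gamma>' u = y.path (\<phi> u)"
    using y.parametrization_factors[OF assms(3) g(2)] unfolding L_def by blast
  define e where "e = (d - d') / 2"
  have e: "0 < e" using g(3) by (simp add: e_def)
  have "uniformly_continuous_on {0..L} y.path"
    by (rule compact_uniformly_continuous) (auto intro: continuous_on_subset[OF y.continuous_path])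
  then obtain \<eta> where \<eta>: "0 < \<eta>" "\<And>a b. a \<in> {0..L} \<Longrightarrow> b \<in> {0..L} \<Longrightarrow> \<bar>a - b\<bar> < \<eta> \<Longrightarrow>
      dist (y.path a) (y.path b) < e"
    unfolding uniformly_continuous_on_def using e by (metis dist_real_def)
  define k where "k = min (1 / 2) (\<eta> / (2 * L))"
  have k: "0 < k" "k < 1" "k * L < \<eta>"
  proof -
    show "0 < k" "k < 1" using \<eta>(1) L by (auto simp: k_def)
    have "k * L \<le> \<eta> / (2 * L) * L" using L by (intro mult_right_mono) (auto simp: k_def)
    also have "\<dots> < \<eta>" using \<eta>(1) L by simp
    finally show "k * L < \<eta>" .
  qed
  define h where "h u = ((1 - k) * \<phi> u + k * (L * u)) / L" for u
  have h_strict: "h u < h v" if "0 \<le> u" "u < v" "v \<le> 1" for u v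
  proof -
    have "(1 - k) * \<phi> u \<le> (1 - k) * \<phi> v"
      using time_change_mono[OF \<phi>(1), of u v] that k by (intro mult_left_mono) auto
    moreover have "k * (L * u) < k * (L * v)" using that k L by simp
    ultimately show ?thesis unfolding h_def using L by (intro divide_strict_right_mono) auto
  qed
  have hc: "continuous_on {0..1} h"
    unfolding h_def using L by (intro continuous_intros time_change_continuous[OF \<phi>(1)]) auto
  have h01: "h 0 = 0" "h 1 = 1"
    using time_change_0[OF \<phi>(1)] time_change_1[OF \<phi>(1)] L by (auto simp: h_def field_simps)
  have htc: "time_change 1 h"
    by (rule time_changeI) (use hc h01 h_strict in \<open>force simp: le_less\<close>)+
  have hinj: "inj_on h {0..1}"
    by (rule linorder_inj_onI) (use h_strict in force)+
  define \<psi> where "\<psi> = the_inv_into {0..1} h"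
  have him: "h ` {0..1} = {0..1}" using htc by (simp add: time_change_def)
  have \<psi>h: "\<psi> (h u) = u" if "u \<in> {0..1}" for u
    unfolding \<psi>_def by (rule the_inv_into_f_f[OF hinj that])
  have h\<psi>: "h (\<psi> u) = u" if "u \<in> {0..1}" for u
    unfolding \<psi>_def by (rule f_the_inv_into_f[OF hinj]) (use that him in simp)
  have \<psi>r: "\<psi> u \<in> {0..1}" if "u \<in> {0..1}" for u
    unfolding \<psi>_def by (rule the_inv_into_into[OF hinj]) (use that him in auto)
  have \<psi>tc: "time_change 1 \<psi>"
  proof (rule time_changeI)
    have "continuous_on (h ` {0..1}) \<psi>" by (rule continuous_on_inv) (use hc \<psi>h in auto)
    then show "continuous_on {0..1} \<psi>" using him by simp
    show "\<psi> 0 = 0" "\<psi> 1 = 1" using \<psi>h[of 0] \<psi>h[of 1] h01 by auto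
    show "\<psi> u \<le> \<psi> v" if "0 \<le> u" "u \<le> v" "v \<le> 1" for u v
      using h_strict[of "\<psi> v" "\<psi> u"] h\<psi>[of u] h\<psi>[of v] \<psi>r[of u] \<psi>r[of v] that by force
  qed
  show ?thesis
  proof (rule that[of "\<lambda>u. \<gamma> (\<psi> u)" "d' + e"])
    show "(\<lambda>u. \<gamma> (\<psi> u)) \<in> parametric_representations T x" by (rule reparametrization[OF g(1) \<psi>tc])
    show "d' + e < d" using g(3) by (simp add: e_def field_simps)
    fix u :: real assume u: "0 \<le> u" "u \<le> 1"
    define v where "v = \<psi> u"
    have v: "0 \<le> v" "v \<le> 1" "h v = u" using \<psi>r[of u] h\<psi>[of u] u by (auto simp: v_def)
    then have Lu: "L * u = (1 - k) * \<phi> v + k * (L * v)" using L by (auto simp: h_def field_simps)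
    have \<phi>v: "0 \<le> \<phi> v" "\<phi> v \<le> L" using time_change_range[OF \<phi>(1) v(1,2)] by auto
    have Lv: "0 \<le> L * v" "L * v \<le> L" using v L by (auto simp: mult_left_le)
    have "\<phi> v - L * u = k * (\<phi> v - L * v)" using Lu by (simp add: algebra_simps)
    then have "\<bar>\<phi> v - L * u\<bar> \<le> k * L" using k \<phi>v Lv
      by (simp add: abs_mult abs_le_iff)
    then have "dist (y.path (\<phi> v)) (y.path (L * u)) < e"
      using k(3) \<phi>v u L by (intro \<eta>(2)) (auto simp: mult_left_le)
    then have "gap (y.path (\<phi> v)) (y.path (L * u)) \<le> e"
      using gap_le_dist[of "y.path (\<phi> v)" "y.path (L * u)"] by linarith
    moreover have "gap (\<gamma> v) (y.path (\<phi> v)) \<le> d'" using g(4)[OF v(1,2)] \<phi>(2)[OF v(1,2)] by simp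
    ultimately show "gap (\<gamma> (\<psi> u)) (y.path (clock y T * u)) \<le> d' + e"
      using gap_triangle[of "\<gamma> v" "y.path (L * u)" "y.path (\<phi> v)"] by (simp add: v_def L_def)
  qed
qed

text \<open>
  Both distances are compared with the same parametrization of the middle graph.
\<close>

lemma M1_dist_on_triangle_less:
  assumes "cadlag x" "cadlag y" "cadlag z" "0 < T" "M1_dist_on T x y < d" "M1_dist_on T y z < e"
  shows "M1_dist_on T x z < d + e"
proof -
  obtain \<gamma> d' where g: "\<gamma> \<in> parametric_representations T x" "d' < d"
    "\<And>u. 0 \<le> u \<Longrightarrow> u \<le> 1 \<Longrightarrow> gap (\<gamma> u) (cadlag_path.path y (clock y T * u)) \<le> d'"
    using path_nearly_optimal[OF assms(1,2,4,5)] by blast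
  have "M1_dist_on T z y < e" using assms(6) M1_dist_on_commute[OF assms(2,3,4)] by simp
  then obtain \<gamma>' e' where g': "\<gamma>' \<in> parametric_representations T z" "e' < e"
    "\<And>u. 0 \<le> u \<Longrightarrow> u \<le> 1 \<Longrightarrow> gap (\<gamma>' u) (cadlag_path.path y (clock y T * u)) \<le> e'"
    using path_nearly_optimal[OF assms(3,2,4)] by blast
  have "M1_dist_on T x z \<le> d' + e'"
  proof (rule M1_dist_on_le[OF g(1) g'(1)])
    fix u :: real assume u: "0 \<le> u" "u \<le> 1"
    show "gap (\<gamma> u) (\<gamma>' u) \<le> d' + e'"
      using gap_triangle[of "\<gamma> u" "\<gamma>' u" "cadlag_path.path y (clock y T * u)"] g(3)[OF u] g'(3)[OF u]
      by (simp add: gap_commute[of _ "\<gamma>' u"])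
  qed
  then show ?thesis using g(2) g'(2) by linarith
qed

section \<open>Closeness in the M1 sense\<close>

text \<open>
  The standard exponential law plays two roles: it is the weight \<open>exp (- T)\<close> on horizons in the
  \<open>M\<^sub>1\<close> metric, and the law of the random time lag by which the solution averages the noise.
\<close>

definition expo :: "real measure" where
  "expo = density lborel (exponential_density 1)"

lemma sets_expo [simp, measurable_cong]: "sets expo = sets borel"
  by (simp add: expo_def)

lemma space_expo [simp]: "space expo = UNIV"
  by (simp add: expo_def)

interpretation expo: prob_space expo
  unfolding expo_def by (rule prob_space_exponential_density) simp

lemma distributed_expo: "distributed expo lborel (\<lambda>x. x) (exponential_density 1)"
  unfolding distributed_def
proof (intro conjI)
  have "distr expo lborel (\<lambda>x. x) = distr expo expo (\<lambda>x. x)"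
    by (rule distr_cong) auto
  then show "distr expo lborel (\<lambda>x. x) = density lborel (exponential_density 1)"
    by (simp add: expo_def)
qed auto

lemma integral_expo:
  fixes g :: "real \<Rightarrow> real"
  assumes "g \<in> borel_measurable borel"
  shows "(\<integral>r. g r \<partial>expo) = (LBINT r:{0..}. exp (- r) * g r)"
proof -
  have "(\<integral>r. g r \<partial>expo) = (LBINT r. exponential_density 1 r * g r)"
    unfolding expo_def using assms
    by (subst integral_density) (auto simp: exponential_density_nonneg)
  also have "\<dots> = (LBINT r:{0..}. exp (- r) * g r)"
    unfolding set_lebesgue_integral_def
    by (intro Bochner_Integration.integral_cong) (auto simp: exponential_density_def)
  finally show ?thesis .
qed

lemma AE_expo_pos: "AE r in expo. 0 < r"
proof -
  have "AE r in lborel. r \<noteq> (0::real)" by (rule AE_lborel_singleton)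
  then show ?thesis unfolding expo_def
    by (subst AE_density) (auto simp: exponential_density_def)
qed

lemma AE_expo_countable:
  assumes "countable A"
  shows "AE r in expo. r \<notin> A"
proof -
  have "AE r in lborel. r \<notin> A" using countable_imp_null_set_lborel[OF assms] by (rule AE_not_in)
  then show ?thesis unfolding expo_def by (subst AE_density) auto
qed

lemma expectation_expo: "(\<integral>r. r \<partial>expo) = 1" "integrable expo (\<lambda>r. r)"
proof -
  show "(\<integral>r. r \<partial>expo) = 1"
    using expo.exponential_distributed_expectation[OF _ distributed_expo] by simp
  then show "integrable expo (\<lambda>r. r)" using not_integrable_integral_eq by force
qed

lemma expo_tail: "0 \<le> K \<Longrightarrow> measure expo {K<..} = exp (- K)"
  using expo.exponential_distributedD_gt[OF distributed_expo, of K] by (simp add: greaterThan_def)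

lemma integrable_expo_bounded:
  assumes "g \<in> borel_measurable borel" "\<And>r. \<bar>g r\<bar> \<le> (B::real)"
  shows "integrable expo g"
  by (rule expo.integrable_const_bound[of _ B]) (use assms in auto)

lemma exists_exp_less:
  assumes "0 < (d :: real)"
  obtains K where "0 < K" "exp (- K) \<le> d"
proof (rule that[of "max 1 (- ln d)"])
  have "exp (- max 1 (- ln d)) \<le> exp (ln d)" by (subst exp_le_cancel_iff) simp
  then show "exp (- max 1 (- ln d)) \<le> d" using assms by simp
qed simp

text \<open>
  The exceptional set accounts for the horizons at which a path jumps, where truncated graphs of
  close paths need not be close. Requiring it to be Borel makes the relation usable without
  measurability of the distance as a function of the horizon.
\<close>

definition near :: "real \<Rightarrow> (real \<Rightarrow> real) \<Rightarrow> (real \<Rightarrow> real) \<Rightarrow> bool" where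
  "near d x y \<longleftrightarrow> (\<exists>B\<in>sets borel. measure expo B \<le> d \<and> (\<forall>T>0. T \<notin> B \<longrightarrow> M1_dist_on T x y < d))"

lemma near_mono: "near d x y \<Longrightarrow> d \<le> e \<Longrightarrow> near e x y"
  unfolding near_def by (meson less_le_trans order_trans)

lemma near_commute: "cadlag x \<Longrightarrow> cadlag y \<Longrightarrow> near d x y \<Longrightarrow> near d y x"
  unfolding near_def by (metis M1_dist_on_commute)

lemma near_triangle:
  assumes "cadlag x" "cadlag y" "cadlag z" "near d x y" "near e y z"
  shows "near (d + e) x z"
proof -
  obtain B where B: "B \<in> sets borel" "measure expo B \<le> d"
    "\<And>T. 0 < T \<Longrightarrow> T \<notin> B \<Longrightarrow> M1_dist_on T x y < d"
    using assms(4) by (auto simp: near_def)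
  obtain C where C: "C \<in> sets borel" "measure expo C \<le> e"
    "\<And>T. 0 < T \<Longrightarrow> T \<notin> C \<Longrightarrow> M1_dist_on T y z < e"
    using assms(5) by (auto simp: near_def)
  show ?thesis unfolding near_def
  proof (intro bexI[of _ "B \<union> C"] conjI allI impI)
    show "measure expo (B \<union> C) \<le> d + e"
      using measure_Un_le[of B expo C] B C by auto
    show "M1_dist_on T x z < d + e" if "0 < T" "T \<notin> B \<union> C" for T
      by (rule M1_dist_on_triangle_less[OF assms(1-3)]) (use that B C in auto)
  qed (use B C in auto)
qed

text \<open>
  Up to the exponential weight, the integrand is bounded by \<open>d\<close> off the exceptional set and by \<open>1\<close> on it. If it is not
  measurable, its Bochner integral is \<open>0\<close> and the bound is trivial.
\<close>

lemma M1_dist_le_near: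
  assumes "near d x y" "0 \<le> d"
  shows "M1_dist x y \<le> 2 * d"
proof -
  obtain B where B: "B \<in> sets borel" "measure expo B \<le> d"
    "\<And>T. 0 < T \<Longrightarrow> T \<notin> B \<Longrightarrow> M1_dist_on T x y < d"
    using assms(1) by (auto simp: near_def)
  define g where "g T = d + indicator B T" for T :: real
  have gm: "g \<in> borel_measurable borel" unfolding g_def using B(1) by measurable
  have gi: "integrable expo g"
    by (rule integrable_expo_bounded[OF gm, of "d + 1"]) (use assms(2) in \<open>auto simp: g_def indicator_def\<close>)
  then have gi': "integrable lborel (\<lambda>T. exponential_density 1 T * g T)"
    unfolding expo_def using gm
    by (subst (asm) integrable_density) (auto simp: exponential_density_nonneg)
  have "M1_dist x y \<le> (LBINT T. exponential_density 1 T * g T)"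
    unfolding M1_dist_def set_lebesgue_integral_def
  proof (rule integral_mono'[OF gi'])
    fix T :: real
    have "exp (- T) * min 1 (M1_dist_on T x y) \<le> exp (- T) * g T" if "0 < T"
      using B(3)[OF that] assms(2) by (intro mult_left_mono) (auto simp: g_def indicator_def min_le_iff_disj)
    moreover have "0 \<le> g T" using assms(2) by (simp add: g_def)
    ultimately show "indicator {0<..} T *\<^sub>R (exp (- T) * min 1 (M1_dist_on T x y))
        \<le> exponential_density 1 T * g T"
      by (auto simp: exponential_density_def indicator_def)
    show "0 \<le> exponential_density 1 T * g T"
      using \<open>0 \<le> g T\<close> by (simp add: exponential_density_nonneg)
  qed
  also have "\<dots> = (\<integral>T. g T \<partial>expo)"
    unfolding expo_def using gm
    by (subst integral_density) (auto simp: exponential_density_nonneg)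
  also have "\<dots> = d + measure expo B"
    unfolding g_def using B(1)
    using expo.prob_space
    by (subst Bochner_Integration.integral_add)
      (auto simp: expo.emeasure_eq_measure intro!: integrable_real_indicator)
  finally show ?thesis using B(2) by simp
qed

lemma near_if_uniformly_close:
  assumes "continuous_on {0..} v" "continuous_on {0..} w" "0 < K" "exp (- K) \<le> d"
    and "\<And>t. 0 \<le> t \<Longrightarrow> t \<le> K \<Longrightarrow> \<bar>v t - w t\<bar> \<le> d'" "d' < d"
  shows "near d v w"
  unfolding near_def
proof (intro bexI[of _ "{K<..}"] conjI allI impI)
  show "measure expo {K<..} \<le> d" using expo_tail[of K] assms(3,4) by simp
  show "M1_dist_on T v w < d" if T: "0 < T" "T \<notin> {K<..}" for T
  proof -
    have tc: "time_change T (\<lambda>u. T * u)" using T by (intro time_change_linear) simp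
    have "M1_dist_on T v w \<le> d'"
    proof (rule M1_dist_on_le[OF graph_parametrization[OF assms(1) tc] graph_parametrization[OF assms(2) tc]])
      fix u :: real assume u: "0 \<le> u" "u \<le> 1"
      have "T * u \<le> T" using T u by (intro mult_left_le) auto
      also have "T \<le> K" using T by simp
      finally have "0 \<le> T * u" "T * u \<le> K" using T u by simp_all
      then show "gap (v (T * u), T * u) (w (T * u), T * u) \<le> d'"
        using assms(5)[of "T * u"] by (simp add: gap_def)
    qed
    then show ?thesis using assms(6) by simp
  qed
qed simp

lemma eventually_in_M1_open:
  assumes "openin M1_topology U" "x \<in> U"
    and "\<And>d. 0 < d \<Longrightarrow> \<forall>\<^sub>F i in G. near d x (y i)" "\<forall>\<^sub>F i in G. y i \<in> skorokhod_space"
  shows "\<forall>\<^sub>F i in G. y i \<in> U"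
proof -
  obtain r where r: "0 < r" "{y \<in> skorokhod_space. M1_dist x y < r} \<subseteq> U"
    using assms(1,2) unfolding openin_M1_topology by blast
  have "\<forall>\<^sub>F i in G. near (r / 3) x (y i)" using r(1) assms(3) by simp
  with assms(4) show ?thesis
  proof eventually_elim
    case (elim i)
    then have "M1_dist x (y i) < r" using M1_dist_le_near[of "r / 3" x "y i"] r(1) by simp
    then show ?case using r(2) elim by auto
  qed
qed

lemma tendsto_M1_continuous:
  assumes "continuous_map M1_topology euclideanreal f" "x \<in> skorokhod_space"
    and "\<And>d. 0 < d \<Longrightarrow> \<forall>\<^sub>F i in G. near d x (y i)" "\<forall>\<^sub>F i in G. y i \<in> skorokhod_space"
  shows "((\<lambda>i. f (y i)) \<longlongrightarrow> f x) G"
proof (rule topological_tendstoI)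
  fix S :: "real set" assume S: "open S" "f x \<in> S"
  have "openin M1_topology {z \<in> topspace M1_topology. f z \<in> S}"
    using assms(1) S(1) by (simp add: continuous_map_def)
  moreover have "x \<in> {z \<in> topspace M1_topology. f z \<in> S}"
    using assms(2) S(2) by (simp add: topspace_M1_topology)
  ultimately have "\<forall>\<^sub>F i in G. y i \<in> {z \<in> topspace M1_topology. f z \<in> S}"
    using eventually_in_M1_open assms(3,4) by blast
  then show "\<forall>\<^sub>F i in G. f (y i) \<in> S" by eventually_elim simp
qed

section \<open>Measurability of limits\<close>

text \<open>
  Open sets and measurability for the topology of closeness in the above sense. It is finer than the
  \<open>M\<^sub>1\<close> topology, and its triangle inequality is available.
\<close>

definition near_open :: "(real \<Rightarrow> real) set \<Rightarrow> bool" where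
  "near_open U \<longleftrightarrow> U \<subseteq> skorokhod_space \<and>
     (\<forall>x\<in>U. \<exists>d>0. \<forall>y\<in>skorokhod_space. near d x y \<longrightarrow> y \<in> U)"

definition near_measurable :: "'w measure \<Rightarrow> ('w \<Rightarrow> real \<Rightarrow> real) \<Rightarrow> bool" where
  "near_measurable M X \<longleftrightarrow> X \<in> space M \<rightarrow> skorokhod_space \<and>
     (\<forall>U. near_open U \<longrightarrow> X -` U \<inter> space M \<in> sets M)"

lemma near_open_M1_open:
  assumes "openin M1_topology U"
  shows "near_open U"
  unfolding near_open_def
proof (intro conjI ballI)
  show "U \<subseteq> skorokhod_space" using assms unfolding openin_M1_topology by blast
  fix x assume "x \<in> U"
  then obtain r where r: "0 < r" "{y \<in> skorokhod_space. M1_dist x y < r} \<subseteq> U"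
    using assms unfolding openin_M1_topology by blast
  show "\<exists>d>0. \<forall>y\<in>skorokhod_space. near d x y \<longrightarrow> y \<in> U"
  proof (intro exI[of _ "r / 3"] conjI ballI impI)
    fix y assume "y \<in> skorokhod_space" "near (r / 3) x y"
    then show "y \<in> U" using M1_dist_le_near[of "r / 3" x y] r by auto
  qed (use r in auto)
qed

lemma near_measurable_imp_measurable:
  assumes "near_measurable M X"
  shows "X \<in> measurable M (borel_of M1_topology)"
  unfolding borel_of_def topspace_M1_topology
proof (rule measurable_sigma_sets)
  show "sets (sigma skorokhod_space {U. openin M1_topology U})
      = sigma_sets skorokhod_space {U. openin M1_topology U}"
    by (rule sets_measure_of) (auto simp: openin_M1_topology)
  show "X \<in> space M \<rightarrow> skorokhod_space" using assms by (simp add: near_measurable_def)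
  show "X -` U \<inter> space M \<in> sets M" if "U \<in> {U. openin M1_topology U}" for U
    using assms near_open_M1_open[of U] that by (simp add: near_measurable_def)
qed (auto simp: openin_M1_topology)

lemma skorokhod_cadlag: "x \<in> skorokhod_space \<Longrightarrow> cadlag x"
  by (simp add: skorokhod_space_def)

text \<open>
  A point of an open set stays in it under all perturbations of some size \<open>1 / (k + 1)\<close>; the points with
  this property for a fixed \<open>k\<close> again form an open set, and the limit lies in the original set
  iff the sequence eventually stays in one of these smaller sets.
\<close>

lemma near_measurable_limit:
  assumes X: "\<And>n. near_measurable M (X n)" and Z: "Z \<in> space M \<rightarrow> skorokhod_space"
    and lim: "\<And>\<omega> d. \<omega> \<in> space M \<Longrightarrow> 0 < d \<Longrightarrow> \<forall>\<^sub>F n in sequentially. near d (Z \<omega>) (X n \<omega>)"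
  shows "near_measurable M Z"
  unfolding near_measurable_def
proof (intro conjI allI impI Z)
  fix U assume U: "near_open U"
  define V where "V k = {x \<in> skorokhod_space. \<exists>d>1 / (real k + 1). \<forall>y\<in>skorokhod_space. near d x y \<longrightarrow> y \<in> U}"
    for k :: nat
  have V: "near_open (V k)" for k
    unfolding near_open_def
  proof (intro conjI ballI)
    show "V k \<subseteq> skorokhod_space" by (auto simp: V_def)
    fix x assume "x \<in> V k"
    then obtain d where d: "x \<in> skorokhod_space" "1 / (real k + 1) < d"
      "\<And>y. y \<in> skorokhod_space \<Longrightarrow> near d x y \<Longrightarrow> y \<in> U"
      by (auto simp: V_def)
    define e where "e = (d - 1 / (real k + 1)) / 2"
    have e: "0 < e" "1 / (real k + 1) < d - e" 
    proof -
      have "0 < (d - q) / 2" "q < d - (d - q) / 2" if "q < d" for q using that by (auto simp: field_simps)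
      then show "0 < e" "1 / (real k + 1) < d - e" using d(2) unfolding e_def by blast+
    qed
    show "\<exists>d>0. \<forall>y\<in>skorokhod_space. near d x y \<longrightarrow> y \<in> V k"
    proof (intro exI[of _ e] conjI ballI impI e(1))
      fix y assume y: "y \<in> skorokhod_space" "near e x y"
      have "z \<in> U" if z: "z \<in> skorokhod_space" "near (d - e) y z" for z
        using near_triangle[OF _ _ _ y(2) z(2)] d y z by (auto simp: skorokhod_cadlag)
      then show "y \<in> V k" using y e by (auto simp: V_def)
    qed
  qed
  have "Z -` U \<inter> space M = (\<Union>k. \<Union>m. \<Inter>n\<in>{m..}. X n -` V k \<inter> space M)"
  proof (intro subset_antisym subsetI)
    fix \<omega> assume \<omega>: "\<omega> \<in> Z -` U \<inter> space M"
    then have ZS: "Z \<omega> \<in> skorokhod_space" using Z by auto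
    obtain d where d: "0 < d" "\<And>y. y \<in> skorokhod_space \<Longrightarrow> near d (Z \<omega>) y \<Longrightarrow> y \<in> U"
      using U \<omega> unfolding near_open_def by blast
    obtain k where k: "1 / (real k + 1) < d / 2"
      using reals_Archimedean[of "d / 2"] d(1) by (auto simp: inverse_eq_divide add.commute)
    have "\<forall>\<^sub>F n in sequentially. near (d / 2) (Z \<omega>) (X n \<omega>)" using lim[of \<omega> "d / 2"] \<omega> d by auto
    then obtain m where m: "\<And>n. m \<le> n \<Longrightarrow> near (d / 2) (Z \<omega>) (X n \<omega>)"
      unfolding eventually_sequentially by blast
    have "X n \<omega> \<in> V k" if "m \<le> n" for n
    proof -
      have XS: "X n \<omega> \<in> skorokhod_space" using X[of n] \<omega> by (auto simp: near_measurable_def)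
      have "z \<in> U" if z: "z \<in> skorokhod_space" "near (d / 2) (X n \<omega>) z" for z
        using near_triangle[OF _ _ _ m[OF \<open>m \<le> n\<close>] z(2)] ZS XS z d(2)[of z] by (simp add: skorokhod_cadlag)
      then show ?thesis unfolding V_def using XS k by blast
    qed
    then show "\<omega> \<in> (\<Union>k. \<Union>m. \<Inter>n\<in>{m..}. X n -` V k \<inter> space M)" using \<omega> by auto
  next
    fix \<omega> assume "\<omega> \<in> (\<Union>k. \<Union>m. \<Inter>n\<in>{m..}. X n -` V k \<inter> space M)"
    then obtain k m where km: "\<And>n. m \<le> n \<Longrightarrow> X n \<omega> \<in> V k" "\<omega> \<in> space M" by auto
    have ZS: "Z \<omega> \<in> skorokhod_space" using Z km by auto
    have "\<forall>\<^sub>F n in sequentially. near (1 / (real k + 1)) (Z \<omega>) (X n \<omega>)"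
      by (rule lim) (use km in auto)
    then obtain n where n: "m \<le> n" "near (1 / (real k + 1)) (Z \<omega>) (X n \<omega>)"
      unfolding eventually_sequentially by (metis nat_le_linear order_refl)
    obtain d where d: "X n \<omega> \<in> skorokhod_space" "1 / (real k + 1) < d"
      "\<And>y. y \<in> skorokhod_space \<Longrightarrow> near d (X n \<omega>) y \<Longrightarrow> y \<in> U"
      using km(1)[OF n(1)] by (auto simp: V_def)
    have "near d (X n \<omega>) (Z \<omega>)"
      using near_mono[OF near_commute[OF _ _ n(2)], of d] ZS d by (simp add: skorokhod_cadlag)
    then show "\<omega> \<in> Z -` U \<inter> space M" using d(3) ZS km by auto
  qed
  moreover have "(\<Inter>n\<in>{m..}. X n -` V k \<inter> space M) \<in> sets M" for m k
  proof (rule sets.countable_INT')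
    show "(\<lambda>n. X n -` V k \<inter> space M) ` {m..} \<subseteq> sets M"
      using X V[of k] by (auto simp: near_measurable_def)
  qed auto
  then have "(\<Union>k. \<Union>m. \<Inter>n\<in>{m..}. X n -` V k \<inter> space M) \<in> sets M"
    by (intro sets.countable_UN image_subsetI)
  ultimately show "Z -` U \<inter> space M \<in> sets M" by (simp only:)
qed

section \<open>Exponential smoothing\<close>

text \<open>
  The functions that can be averaged: locally bounded with countably many discontinuities. Besides cadlag
  functions they include the indicators of the half-open cells used for the grid approximation, which are continuous
  from the left.
\<close>

definition regular :: "(real \<Rightarrow> real) \<Rightarrow> bool" where
  "regular f \<longleftrightarrow> (\<exists>D. countable D \<and> (\<forall>s. s \<notin> D \<longrightarrow> isCont (\<lambda>s. f (max 0 s)) s)) \<and>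
     (\<forall>K. \<exists>B. \<forall>t. 0 \<le> t \<longrightarrow> t \<le> K \<longrightarrow> \<bar>f t\<bar> \<le> B)"

definition smoothing :: "real \<Rightarrow> (real \<Rightarrow> real) \<Rightarrow> real \<Rightarrow> real" where
  "smoothing h f t = (\<integral>r. f (max 0 (t - h * r)) \<partial>expo)"

lemma regular_bounded:
  assumes "regular f"
  obtains B where "0 < B" "\<And>t. 0 \<le> t \<Longrightarrow> t \<le> K \<Longrightarrow> \<bar>f t\<bar> \<le> B"
proof -
  obtain B where "\<forall>t. 0 \<le> t \<longrightarrow> t \<le> K \<longrightarrow> \<bar>f t\<bar> \<le> B" using assms unfolding regular_def by blast
  then show ?thesis by (intro that[of "\<bar>B\<bar> + 1"]) force+
qed

lemma regular_measurable: "regular f \<Longrightarrow> (\<lambda>s. f (max 0 s)) \<in> borel_measurable borel"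
  unfolding regular_def
  by (auto intro!: borel_measurable_continuous_countable_exceptions continuous_at_imp_continuous_on)

lemma regular_cadlag:
  assumes "cadlag x"
  shows "regular x"
  unfolding regular_def
proof (intro conjI allI)
  show "\<exists>D. countable D \<and> (\<forall>s. s \<notin> D \<longrightarrow> isCont (\<lambda>s. x (max 0 s)) s)"
    using countable_jumps[OF assms] isCont_cadlag[OF assms]
    by (intro exI[of _ "insert 0 (jumps x)"]) auto
  show "\<exists>B. \<forall>t. 0 \<le> t \<longrightarrow> t \<le> K \<longrightarrow> \<bar>x t\<bar> \<le> B" for K
    using cadlag_bounded[OF assms, of K] by metis
qed

lemma smoothing_integrable:
  assumes "regular f" "0 \<le> h" "0 \<le> t"
  shows "integrable expo (\<lambda>r. f (max 0 (t - h * r)))"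
proof -
  obtain B where B: "0 < B" "\<And>s. 0 \<le> s \<Longrightarrow> s \<le> t \<Longrightarrow> \<bar>f s\<bar> \<le> B"
    using regular_bounded[OF assms(1)] by blast
  have "AE r in expo. norm (f (max 0 (t - h * r))) \<le> B"
    using AE_expo_pos by eventually_elim (use assms(2,3) B(2) in auto)
  moreover have "(\<lambda>r. f (max 0 (t - h * r))) \<in> borel_measurable expo"
    using measurable_compose[OF _ regular_measurable[OF assms(1)], of "\<lambda>r. t - h * r" expo] by simp
  ultimately show ?thesis by (rule expo.integrable_const_bound)
qed

text \<open>
  For almost every lag \<open>r\<close> the function is continuous at \<open>t - h * r\<close>, as a countable set is missed; dominated convergence
  applies.
\<close>

lemma continuous_smoothing:
  assumes "regular f" "0 < h"
  shows "continuous_on {0..} (smoothing h f)"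
  unfolding continuous_on_sequentially comp_def
proof (intro allI ballI impI, elim conjE)
  fix s :: "nat \<Rightarrow> real" and t assume t: "t \<in> {0..}" and s: "\<forall>n. s n \<in> {0..}" "s \<longlonglongrightarrow> t"
  obtain D where D: "countable D" "\<And>s. s \<notin> D \<Longrightarrow> isCont (\<lambda>s. f (max 0 s)) s"
    using assms(1) by (auto simp: regular_def)
  obtain T where T: "\<And>n. s n \<le> T"
    using convergent_imp_Bseq[OF convergentI[OF s(2)]] by (metis BseqE abs_le_iff real_norm_def)
  obtain B where B: "0 < B" "\<And>s. 0 \<le> s \<Longrightarrow> s \<le> T \<Longrightarrow> \<bar>f s\<bar> \<le> B"
    using regular_bounded[OF assms(1)] by blast
  show "(\<lambda>n. smoothing h f (s n)) \<longlonglongrightarrow> smoothing h f t"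
    unfolding smoothing_def
  proof (rule integral_dominated_convergence[where w = "\<lambda>_. B"])
    show "AE r in expo. (\<lambda>n. f (max 0 (s n - h * r))) \<longlonglongrightarrow> f (max 0 (t - h * r))"
      using AE_expo_countable[OF countable_image[OF D(1), of "\<lambda>a. (t - a) / h"]]
    proof eventually_elim
      case (elim r)
      have "t - h * r \<notin> D"
      proof
        assume "t - h * r \<in> D"
        then have "(t - (t - h * r)) / h \<in> (\<lambda>a. (t - a) / h) ` D" by (rule imageI)
        then show False using elim assms(2) by simp
      qed
      then have "isCont (\<lambda>s. f (max 0 s)) (t - h * r)" by (rule D)
      then show ?case by (rule isCont_tendsto_compose) (intro tendsto_intros s)
    qed
    show "AE r in expo. norm (f (max 0 (s n - h * r))) \<le> B" for n
      using AE_expo_pos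
    proof eventually_elim
      case (elim r)
      have "0 \<le> h * r" using elim assms(2) by simp
      moreover have "0 \<le> s n" using s(1) by simp
      ultimately show ?case using B(2) T[of n] by simp
    qed
  qed (use smoothing_integrable[OF assms(1), of h] assms(2) s t in \<open>auto intro: borel_measurable_integrable\<close>)
qed

text \<open>
  The substitution \<open>s = t - h * r\<close>; lags that reach beyond time \<open>0\<close> contribute \<open>f 0 = 0\<close>.
\<close>

lemma smoothing_formula:
  assumes "regular f" "f 0 = 0" "0 < h" "0 \<le> t"
  shows "smoothing h f t = 1 / h * (LBINT s:{0..t}. exp (- ((t - s) / h)) * f s)"
proof -
  define G where "G r = indicator {0..} r * (exp (- r) * f (max 0 (t - h * r)))" for r :: real
  have "(\<lambda>r. f (max 0 (t - h * r))) \<in> borel_measurable borel"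
    using measurable_compose[OF _ regular_measurable[OF assms(1)], of "\<lambda>r. t - h * r" borel] by simp
  then have "smoothing h f t = (LBINT r. G r)"
    unfolding smoothing_def G_def by (subst integral_expo) (auto simp: set_lebesgue_integral_def)
  also have "\<dots> = \<bar>- (1 / h)\<bar> *\<^sub>R (LBINT s. G (t / h + - (1 / h) * s))"
    by (rule lborel_integral_real_affine) (use assms(3) in simp)
  also have "\<dots> = 1 / h * (LBINT s. G (t / h + - (1 / h) * s))"
    using assms(3) by simp
  also have "(LBINT s. G (t / h + - (1 / h) * s)) = (LBINT s:{0..t}. exp (- ((t - s) / h)) * f s)"
    unfolding set_lebesgue_integral_def
  proof (intro Bochner_Integration.integral_cong refl)
    fix s :: real
    have "t - h * (t / h + - (1 / h) * s) = s" "t / h + - (1 / h) * s = (t - s) / h"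
      using assms(3) by (auto simp: field_simps)
    moreover have "0 \<le> (t - s) / h \<longleftrightarrow> s \<le> t" using assms(3) by (simp add: zero_le_divide_iff)
    ultimately show "G (t / h + - (1 / h) * s) = indicator {0..t} s *\<^sub>R (exp (- ((t - s) / h)) * f s)"
      using assms by (auto simp: G_def indicator_def max_def)
  qed
  finally show ?thesis .
qed

context cadlag_path
begin

lemma regular_clock: "regular (clock x)"
  by (rule regular_cadlag[OF cadlag_clock])

text \<open>
  Near a time \<open>t0\<close> the smoothed clock averages values that lie, up to rare exceptions and a small error,
  between \<open>clock_left x t0\<close> and \<open>clock x t0\<close>, where \<open>f\<close> is affine; and affine functions
  commute with averages.
\<close>

lemma smoothing_commutes_locally:
  assumes f: "continuous_on {0..} f"
    and aff: "\<And>u. clock_left x t0 \<le> u \<Longrightarrow> u \<le> clock x t0 \<Longrightarrow> f u = a + b * u"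
    and e: "0 < e" and t0: "0 \<le> t0" "t0 \<le> K" and K: "0 < K"
  obtains \<rho> h0 where "0 < \<rho>" "0 < h0"
    "\<And>t h. 0 \<le> t \<Longrightarrow> t \<le> K \<Longrightarrow> \<bar>t - t0\<bar> < \<rho> \<Longrightarrow> 0 < h \<Longrightarrow> h < h0 \<Longrightarrow>
       \<bar>smoothing h (\<lambda>s. f (clock x s)) t - f (smoothing h (clock x) t)\<bar> \<le> e"
proof -
  define L where "L = clock x K"
  have L: "0 < L" using clock_ge[of K] K by (simp add: L_def)
  have comp: "compact (f ` {0..L})"
    by (intro compact_continuous_image) (auto intro: continuous_on_subset[OF f])
  then obtain B where B: "0 < B" "\<And>u. 0 \<le> u \<Longrightarrow> u \<le> L \<Longrightarrow> \<bar>f u\<bar> \<le> B"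
    using compact_imp_bounded[OF comp] unfolding bounded_pos by auto
  have "uniformly_continuous_on {0..L} f"
    by (rule compact_uniformly_continuous) (auto intro: continuous_on_subset[OF f])
  then obtain \<kappa> where \<kappa>: "0 < \<kappa>"
    "\<And>u v. u \<in> {0..L} \<Longrightarrow> v \<in> {0..L} \<Longrightarrow> \<bar>u - v\<bar> < 2 * \<kappa> \<Longrightarrow> \<bar>f u - f v\<bar> < e / 4"
  proof -
    obtain d where "0 < d" "\<And>u v. u \<in> {0..L} \<Longrightarrow> v \<in> {0..L} \<Longrightarrow> \<bar>u - v\<bar> < d \<Longrightarrow> \<bar>f u - f v\<bar> < e / 4"
      using \<open>uniformly_continuous_on {0..L} f\<close> e unfolding uniformly_continuous_on_def dist_real_def
      by (metis zero_less_divide_iff zero_less_numeral)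
    then show ?thesis using that[of "d / 2"] by simp
  qed
  define l where "l = clock_left x t0"
  define r where "r = clock x t0"
  have lr: "0 \<le> l" "l \<le> r" "r \<le> L"
    using clock_left_nonneg[OF t0(1)] clock_left_le clock_mono[OF t0] by (auto simp: l_def r_def L_def)
  obtain R where R: "0 < R"
    "\<And>s. t0 \<le> s \<Longrightarrow> s < t0 + R \<Longrightarrow> \<bar>clock x s - r\<bar> < \<kappa>"
    "\<And>s. 0 \<le> s \<Longrightarrow> t0 - R < s \<Longrightarrow> s < t0 \<Longrightarrow> \<bar>clock x s - l\<bar> < \<kappa>"
  proof -
    obtain R where "0 < R"
      "\<And>s. t0 \<le> s \<Longrightarrow> s < t0 + R \<Longrightarrow> \<bar>clock x s - clock x t0\<bar> < \<kappa>"
      "\<And>s. 0 \<le> s \<Longrightarrow> t0 - R < s \<Longrightarrow> s < t0 \<Longrightarrow> \<bar>clock x s - left_limit (clock x) t0\<bar> < \<kappa>"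
      using cadlag_two_values[OF cadlag_clock t0(1) \<kappa>(1)] by metis
    then show ?thesis using that[of R] left_limit_clock[of t0] by (auto simp: r_def l_def)
  qed
  define \<rho> where "\<rho> = R / 2"
  have \<rho>: "0 < \<rho>" using R(1) by (simp add: \<rho>_def)
  define h0 where "h0 = \<rho> * min (\<kappa> / (L + 1)) (e / (8 * B))"
  show ?thesis
  proof (rule that[OF \<rho>, of h0])
    show "0 < h0" using \<rho> \<kappa>(1) L e B(1) by (simp add: h0_def)
    fix t h assume t: "0 \<le> t" "t \<le> K" "\<bar>t - t0\<bar> < \<rho>" and h: "0 < h" "h < h0"
    have "h / \<rho> < min (\<kappa> / (L + 1)) (e / (8 * B))"
      unfolding pos_divide_less_eq[OF \<rho>] using h(2) by (simp only: h0_def mult.commute)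
    then have "h / \<rho> < \<kappa> / (L + 1)" "h / \<rho> < e / (8 * B)" by simp_all
    then have hL: "L * (h / \<rho>) < \<kappa>" and hB: "2 * B * (h / \<rho>) \<le> e / 4"
    proof -
      have "L * (h / \<rho>) \<le> (L + 1) * (h / \<rho>)" using h(1) \<rho> by (intro mult_right_mono) auto
      also have "\<dots> < \<kappa>" using \<open>h / \<rho> < \<kappa> / (L + 1)\<close> L
        by (simp add: pos_less_divide_eq mult.commute)
      finally show "L * (h / \<rho>) < \<kappa>" .
      show "2 * B * (h / \<rho>) \<le> e / 4"
        using \<open>h / \<rho> < e / (8 * B)\<close> B(1) by (simp add: pos_less_divide_eq algebra_simps)
    qed
    define U where "U \<omega> = clock x (max 0 (t - h * \<omega>))" for \<omega>
    \<comment> \<open>The random clock value, pushed into the interval on which \<open>f\<close> is affine.\<close>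
    define C where "C \<omega> = max l (min r (U \<omega>))" for \<omega>
    have Um: "U \<in> borel_measurable borel"
      unfolding U_def
      using measurable_compose[OF _ cadlag_measurable[OF cadlag_clock], of "\<lambda>\<omega>. t - h * \<omega>" borel] by simp
    have Cm: "C \<in> borel_measurable borel" unfolding C_def using Um by measurable
    have fm: "(\<lambda>\<omega>. f (V \<omega>)) \<in> borel_measurable borel"
      if "V \<in> borel_measurable borel" "\<And>\<omega>. 0 \<le> V \<omega>" for V :: "real \<Rightarrow> real"
    proof -
      have "continuous_on UNIV (\<lambda>u. f (max 0 u))"
        by (rule continuous_on_compose2[OF f]) (auto intro!: continuous_intros)
      then have "(\<lambda>\<omega>. f (max 0 (V \<omega>))) \<in> borel_measurable borel"
        by (intro measurable_compose[OF that(1)] borel_measurable_continuous_onI)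
      then show ?thesis using that(2) by (simp add: max_def)
    qed
    have U0: "0 \<le> U \<omega>" for \<omega> using clock_ge[of "max 0 (t - h * \<omega>)"] by (simp add: U_def)
    have UL: "U \<omega> \<le> L" if "0 < \<omega>" for \<omega>
    proof -
      have "0 \<le> h * \<omega>" using that h by simp
      then show ?thesis unfolding U_def L_def by (intro clock_mono) (use t in auto)
    qed
    have C: "l \<le> C \<omega>" "C \<omega> \<le> r" for \<omega> using lr by (auto simp: C_def)
    have C0: "0 \<le> C \<omega>" "C \<omega> \<le> L" for \<omega> using C[of \<omega>] lr by auto
    have close: "\<bar>U \<omega> - C \<omega>\<bar> < \<kappa>" if \<omega>: "0 < \<omega>" "h * \<omega> < \<rho>" for \<omega>
    proof -
      define s where "s = max 0 (t - h * \<omega>)"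
      have "0 < h * \<omega>" using \<omega> h by simp
      then have s: "0 \<le> s" "t0 - R < s" "s < t0 + R"
        using t \<omega>(2) by (auto simp: s_def \<rho>_def abs_if split: if_splits)
      show ?thesis
      proof (cases "t0 \<le> s")
        case True
        then have "r \<le> U \<omega>" using clock_mono[OF t0(1) True] by (simp add: U_def r_def s_def)
        then show ?thesis using R(2)[OF True s(3)] lr by (simp add: C_def U_def s_def)
      next
        case False
        then have "clock x s \<le> clock_left x t0" using clock_left_diff[OF s(1), of t0] by linarith
        then have "U \<omega> \<le> l" by (simp add: U_def l_def s_def)
        moreover have "\<bar>clock x s - l\<bar> < \<kappa>" using R(3)[OF s(1,2)] False by simp
        then have "\<bar>U \<omega> - l\<bar> < \<kappa>" by (simp add: U_def s_def)
        ultimately show ?thesis using lr by (simp add: C_def)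
      qed
    qed
    have far: "1 \<le> h * \<omega> / \<rho>" if "\<not> h * \<omega> < \<rho>" for \<omega> using that \<rho> by simp
    \<comment> \<open>Long lags are rare: where \<open>h * \<omega> \<ge> \<rho>\<close>, the factor \<open>h * \<omega> / \<rho>\<close> is at least \<open>1\<close>, and its mean is \<open>h / \<rho>\<close>.\<close>
    have d1: "\<bar>U \<omega> - C \<omega>\<bar> \<le> \<kappa> + L * (h / \<rho>) * \<omega>" if \<omega>: "0 < \<omega>" for \<omega>
    proof (cases "h * \<omega> < \<rho>")
      case True
      have "0 \<le> L * (h / \<rho>) * \<omega>" using L h \<rho> \<omega> by simp
      then show ?thesis using close[OF \<omega> True] by simp
    next
      case False
      have "\<bar>U \<omega> - C \<omega>\<bar> \<le> L * 1" using U0[of \<omega>] UL[OF \<omega>] C0[of \<omega>] by simp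
      also have "\<dots> \<le> L * (h * \<omega> / \<rho>)" using L far[OF False] by (intro mult_left_mono) auto
      finally show ?thesis using \<kappa>(1) by (simp add: mult.assoc)
    qed
    have d2: "\<bar>f (U \<omega>) - f (C \<omega>)\<bar> \<le> e / 4 + 2 * B * (h / \<rho>) * \<omega>" if \<omega>: "0 < \<omega>" for \<omega>
    proof (cases "h * \<omega> < \<rho>")
      case True
      have "0 \<le> 2 * B * (h / \<rho>) * \<omega>" using B h \<rho> \<omega> by simp
      moreover have "\<bar>f (U \<omega>) - f (C \<omega>)\<bar> < e / 4"
        by (rule \<kappa>(2)) (use U0[of \<omega>] UL[OF \<omega>] C0[of \<omega>] close[OF \<omega> True] \<kappa>(1) in auto)
      ultimately show ?thesis by simp
    next
      case False
      have "\<bar>f (U \<omega>) - f (C \<omega>)\<bar> \<le> 2 * B * 1"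
        using B(2)[OF U0[of \<omega>] UL[OF \<omega>]] B(2)[OF C0[of \<omega>]] by simp
      also have "\<dots> \<le> 2 * B * (h * \<omega> / \<rho>)" using B far[OF False] by (intro mult_left_mono) auto
      finally show ?thesis using e by (simp add: mult.assoc)
    qed
    have iC: "integrable expo C" by (rule integrable_expo_bounded[OF Cm, of L]) (use C0 in auto)
    have iU: "integrable expo U"
    proof (rule expo.integrable_const_bound[of _ L])
      show "AE \<omega> in expo. norm (U \<omega>) \<le> L" using AE_expo_pos by eventually_elim (use U0 UL in auto)
    qed (use Um in simp)
    have ifU: "integrable expo (\<lambda>\<omega>. f (U \<omega>))"
    proof (rule expo.integrable_const_bound[of _ B])
      show "AE \<omega> in expo. norm (f (U \<omega>)) \<le> B"
        using AE_expo_pos by eventually_elim (use U0 UL B in auto)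
    qed (use fm[OF Um U0] in simp)
    have ifC: "integrable expo (\<lambda>\<omega>. f (C \<omega>))"
      by (rule integrable_expo_bounded[OF fm[OF Cm], of B]) (use C0 B in auto)
    define EC where "EC = (\<integral>\<omega>. C \<omega> \<partial>expo)"
    define EU where "EU = (\<integral>\<omega>. U \<omega> \<partial>expo)"
    have EC: "l \<le> EC" "EC \<le> r"
      unfolding EC_def using C
      by (auto intro!: expo.integral_ge_const[OF iC] expo.integral_le_const[OF iC])
    have EU: "0 \<le> EU" "EU \<le> L" unfolding EU_def
    proof -
      show "0 \<le> (\<integral>\<omega>. U \<omega> \<partial>expo)" using U0 by (intro integral_nonneg_AE) auto
      have "AE \<omega> in expo. U \<omega> \<le> L" using AE_expo_pos by eventually_elim (use UL in auto)
      then show "(\<integral>\<omega>. U \<omega> \<partial>expo) \<le> L" by (rule expo.integral_le_const[OF iU])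
    qed
    have lin: "(\<integral>\<omega>. c + k * \<omega> \<partial>expo) = c + k" "integrable expo (\<lambda>\<omega>. c + k * \<omega>)" for c k :: real
      using expectation_expo expo.prob_space by auto
    have "\<bar>EU - EC\<bar> = \<bar>\<integral>\<omega>. U \<omega> - C \<omega> \<partial>expo\<bar>" using iU iC by (simp add: EU_def EC_def)
    also have "\<dots> \<le> (\<integral>\<omega>. \<bar>U \<omega> - C \<omega>\<bar> \<partial>expo)" by (rule integral_abs_bound)
    also have "\<dots> \<le> (\<integral>\<omega>. \<kappa> + L * (h / \<rho>) * \<omega> \<partial>expo)"
    proof (rule integral_mono_AE[OF _ lin(2)])
      show "AE \<omega> in expo. \<bar>U \<omega> - C \<omega>\<bar> \<le> \<kappa> + L * (h / \<rho>) * \<omega>"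
        using AE_expo_pos by eventually_elim (rule d1)
    qed (use iU iC in auto)
    also have "\<dots> < 2 * \<kappa>" using lin(1)[of \<kappa> "L * (h / \<rho>)"] hL by simp
    finally have "\<bar>f EU - f EC\<bar> < e / 4" using EU EC lr by (intro \<kappa>(2)) auto
    moreover have "(\<integral>\<omega>. f (C \<omega>) \<partial>expo) = f EC"
    proof -
      have "f (C \<omega>) = a + b * C \<omega>" for \<omega> using aff C[of \<omega>] by (simp add: l_def r_def)
      then have "(\<integral>\<omega>. f (C \<omega>) \<partial>expo) = a + b * EC"
        using iC expo.prob_space by (simp add: EC_def)
      also have "\<dots> = f EC" using aff EC by (simp add: l_def r_def)
      finally show ?thesis .
    qed
    moreover have "\<bar>(\<integral>\<omega>. f (U \<omega>) \<partial>expo) - (\<integral>\<omega>. f (C \<omega>) \<partial>expo)\<bar> \<le> e / 2"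
    proof -
      have "\<bar>(\<integral>\<omega>. f (U \<omega>) \<partial>expo) - (\<integral>\<omega>. f (C \<omega>) \<partial>expo)\<bar> = \<bar>\<integral>\<omega>. f (U \<omega>) - f (C \<omega>) \<partial>expo\<bar>"
        using ifU ifC by simp
      also have "\<dots> \<le> (\<integral>\<omega>. \<bar>f (U \<omega>) - f (C \<omega>)\<bar> \<partial>expo)" by (rule integral_abs_bound)
      also have "\<dots> \<le> (\<integral>\<omega>. e / 4 + 2 * B * (h / \<rho>) * \<omega> \<partial>expo)"
      proof (rule integral_mono_AE[OF _ lin(2)])
        show "AE \<omega> in expo. \<bar>f (U \<omega>) - f (C \<omega>)\<bar> \<le> e / 4 + 2 * B * (h / \<rho>) * \<omega>"
          using AE_expo_pos by eventually_elim (rule d2)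
      qed (use ifU ifC in auto)
      also have "\<dots> \<le> e / 2" using lin(1)[of "e / 4" "2 * B * (h / \<rho>)"] hB by simp
      finally show ?thesis .
    qed
    ultimately have "\<bar>(\<integral>\<omega>. f (U \<omega>) \<partial>expo) - f EU\<bar> \<le> e" using e by linarith
    then show "\<bar>smoothing h (\<lambda>s. f (clock x s)) t - f (smoothing h (clock x) t)\<bar> \<le> e"
      by (simp add: smoothing_def EU_def U_def)
  qed
qed

text \<open>
  The local statement holds on a neighbourhood of each time; finitely many neighbourhoods cover
  \<open>[0,K]\<close>.
\<close>

lemma smoothing_commutes:
  assumes f: "continuous_on {0..} f"
    and aff: "\<And>t. 0 \<le> t \<Longrightarrow> \<exists>a b. \<forall>u. clock_left x t \<le> u \<longrightarrow> u \<le> clock x t \<longrightarrow> f u = a + b * u"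
    and e: "0 < e" and K: "0 < K"
  obtains h0 where "0 < h0"
    "\<And>t h. 0 \<le> t \<Longrightarrow> t \<le> K \<Longrightarrow> 0 < h \<Longrightarrow> h < h0 \<Longrightarrow>
       \<bar>smoothing h (\<lambda>s. f (clock x s)) t - f (smoothing h (clock x) t)\<bar> \<le> e"
proof -
  have "\<exists>\<rho> h0. 0 < \<rho> \<and> 0 < h0 \<and> (\<forall>t h. 0 \<le> t \<longrightarrow> t \<le> K \<longrightarrow> \<bar>t - t0\<bar> < \<rho> \<longrightarrow> 0 < h \<longrightarrow> h < h0 \<longrightarrow>
       \<bar>smoothing h (\<lambda>s. f (clock x s)) t - f (smoothing h (clock x) t)\<bar> \<le> e)" if t0: "t0 \<in> {0..K}" for t0
  proof -
    have t0': "0 \<le> t0" "t0 \<le> K" using t0 by auto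
    obtain a b where ab: "\<And>u. clock_left x t0 \<le> u \<Longrightarrow> u \<le> clock x t0 \<Longrightarrow> f u = a + b * u"
      using aff[OF t0'(1)] by blast
    show ?thesis
    proof (rule smoothing_commutes_locally[OF f ab e t0' K])
      fix \<rho> h0
      assume "0 < \<rho>" "0 < h0"
        "\<And>t h. 0 \<le> t \<Longrightarrow> t \<le> K \<Longrightarrow> \<bar>t - t0\<bar> < \<rho> \<Longrightarrow> 0 < h \<Longrightarrow> h < h0 \<Longrightarrow>
           \<bar>smoothing h (\<lambda>s. f (clock x s)) t - f (smoothing h (clock x) t)\<bar> \<le> e"
      then show ?thesis by blast
    qed
  qed
  then obtain \<rho> h0 where \<rho>: "\<And>t0. t0 \<in> {0..K} \<Longrightarrow> 0 < \<rho> t0" and h0: "\<And>t0. t0 \<in> {0..K} \<Longrightarrow> 0 < h0 t0"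
    and loc: "\<And>t0 t h. t0 \<in> {0..K} \<Longrightarrow> 0 \<le> t \<Longrightarrow> t \<le> K \<Longrightarrow> \<bar>t - t0\<bar> < \<rho> t0 \<Longrightarrow> 0 < h \<Longrightarrow> h < h0 t0 \<Longrightarrow>
       \<bar>smoothing h (\<lambda>s. f (clock x s)) t - f (smoothing h (clock x) t)\<bar> \<le> e"
    by metis
  have "{0..K} \<subseteq> (\<Union>t\<in>{0..K}. ball t (\<rho> t))" using \<rho> by force
  then obtain C where C: "C \<subseteq> {0..K}" "finite C" "{0..K} \<subseteq> (\<Union>t\<in>C. ball t (\<rho> t))"
    by (metis compactE_image[of "{0..K}" "{0..K}" "\<lambda>t. ball t (\<rho> t)"] open_ball compact_Icc)
  show ?thesis
  proof (rule that[of "Min (insert 1 (h0 ` C))"])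
    show "0 < Min (insert 1 (h0 ` C))" using C h0 by (subst Min_gr_iff) auto
    fix t h assume t: "0 \<le> t" "t \<le> K" and h: "0 < h" "h < Min (insert 1 (h0 ` C))"
    obtain c where c: "c \<in> C" "\<bar>t - c\<bar> < \<rho> c" using C(3) t by (force simp: dist_real_def)
    then have "h < h0 c" using h(2) C(2) by (subst (asm) Min_gr_iff) auto
    then show "\<bar>smoothing h (\<lambda>s. f (clock x s)) t - f (smoothing h (clock x) t)\<bar> \<le> e"
      using loc[of c t h] C(1) c t h(1) by blast
  qed
qed

end

section \<open>Smoothed paths converge in the M1 sense\<close>

lemma smoothing_cong_nonneg: "(\<And>s. 0 \<le> s \<Longrightarrow> f s = g s) \<Longrightarrow> smoothing h f t = smoothing h g t"
  by (simp add: smoothing_def)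

lemma smoothing_identity:
  assumes "0 < h" "0 \<le> t"
  shows "\<bar>smoothing h (\<lambda>s. s) t - t\<bar> \<le> h"
proof -
  have reg: "regular (\<lambda>s. s)"
    by (intro regular_cadlag cadlag_continuous_on continuous_intros)
  note i = smoothing_integrable[OF reg, of h t]
  have "\<bar>smoothing h (\<lambda>s. s) t - t\<bar> = \<bar>\<integral>r. max 0 (t - h * r) - t \<partial>expo\<bar>"
    unfolding smoothing_def using i assms expo.prob_space by simp
  also have "\<dots> \<le> (\<integral>r. \<bar>max 0 (t - h * r) - t\<bar> \<partial>expo)" by (rule integral_abs_bound)
  also have "\<dots> \<le> (\<integral>r. h * r \<partial>expo)"
  proof (rule integral_mono_AE)
    show "AE r in expo. \<bar>max 0 (t - h * r) - t\<bar> \<le> h * r"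
      using AE_expo_pos by eventually_elim (use assms in auto)
  qed (use i assms expectation_expo(2) in auto)
  also have "\<dots> = h" using expectation_expo by simp
  finally show ?thesis .
qed

context cadlag_path
begin

lemma fill_affine: "0 \<le> t \<Longrightarrow> \<exists>a b. \<forall>u. clock_left x t \<le> u \<longrightarrow> u \<le> clock x t \<longrightarrow> fill x u = a + b * u"
  using fill_right
  by (intro exI[of _ "x t - clock x t * fill_slope x t"] exI[of _ "fill_slope x t"])
    (simp add: algebra_simps)

lemma clock_inv_affine:
  "0 \<le> t \<Longrightarrow> \<exists>a b. \<forall>u. clock_left x t \<le> u \<longrightarrow> u \<le> clock x t \<longrightarrow> clock_inv x u = a + b * u"
  using clock_inv_eqI by (intro exI[of _ t] exI[of _ 0]) simp

lemma smoothing_clock_bounds: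
  assumes "0 < h" "0 \<le> t"
  shows "0 \<le> smoothing h (clock x) t" "smoothing h (clock x) t \<le> clock x t"
proof -
  note i = smoothing_integrable[OF regular_clock, of h t]
  show "0 \<le> smoothing h (clock x) t" unfolding smoothing_def
  proof (rule integral_nonneg_AE, rule AE_I2)
    fix r show "0 \<le> clock x (max 0 (t - h * r))" using clock_ge[of "max 0 (t - h * r)"] by simp
  qed
  show "smoothing h (clock x) t \<le> clock x t" unfolding smoothing_def
  proof (rule expo.integral_le_const)
    show "AE r in expo. clock x (max 0 (t - h * r)) \<le> clock x t"
      using AE_expo_pos by eventually_elim (use assms in \<open>auto intro: clock_mono\<close>)
  qed (use i assms in auto)
qed

lemma smoothing_clock_mono:
  assumes "0 < h" "0 \<le> s" "s \<le> t"
  shows "smoothing h (clock x) s \<le> smoothing h (clock x) t"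
  unfolding smoothing_def
  by (rule integral_mono) (use assms smoothing_integrable[OF regular_clock] in \<open>auto intro: clock_mono\<close>)

lemma smoothing_clock_tendsto:
  assumes h: "\<And>n. 0 < h n" "h \<longlonglongrightarrow> 0" and t: "0 < t" "t \<notin> jumps x"
  shows "(\<lambda>n. smoothing (h n) (clock x) t) \<longlonglongrightarrow> clock x t"
proof -
  obtain B where B: "0 < B" "\<And>s. 0 \<le> s \<Longrightarrow> s \<le> t \<Longrightarrow> \<bar>clock x s\<bar> \<le> B"
    using regular_bounded[OF regular_clock] by blast
  have "jp t = 0" using jp_eq_0_iff[of t] t by simp
  then have "t \<notin> jumps (clock x)" using left_limit_clock[OF t(1)] by (simp add: jumps_def clock_left_def)
  then have cont: "isCont (\<lambda>s. clock x (max 0 s)) t" using isCont_cadlag[OF cadlag_clock] t by simp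
  have "(\<lambda>n. \<integral>r. clock x (max 0 (t - h n * r)) \<partial>expo) \<longlonglongrightarrow> (\<integral>r. clock x t \<partial>expo)"
  proof (rule integral_dominated_convergence[where w = "\<lambda>_. B"])
    show "AE r in expo. (\<lambda>n. clock x (max 0 (t - h n * r))) \<longlonglongrightarrow> clock x t"
    proof (rule AE_I2)
      fix r
      have "(\<lambda>n. t - h n * r) \<longlonglongrightarrow> t - 0 * r" by (intro tendsto_intros h)
      then have "(\<lambda>n. clock x (max 0 (t - h n * r))) \<longlonglongrightarrow> clock x (max 0 t)"
        by (intro isCont_tendsto_compose[OF cont]) simp
      then show "(\<lambda>n. clock x (max 0 (t - h n * r))) \<longlonglongrightarrow> clock x t" using t by simp
    qed
    show "AE r in expo. norm (clock x (max 0 (t - h n * r))) \<le> B" for n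
      using AE_expo_pos by eventually_elim (use B(2) t h(1)[of n] in auto)
  qed (use smoothing_integrable[OF regular_clock] h(1) t in \<open>auto intro!: borel_measurable_integrable simp: less_imp_le\<close>)
  then show ?thesis using expo.prob_space by (simp add: smoothing_def)
qed

text \<open>
  The graph of the smoothed path is parametrized by time, and the completed graph of \<open>x\<close> by the
  smoothed clock. At a time \<open>T\<close> where the smoothed clock has not yet caught up with the clock this
  would stop too early, but such times form a set of small measure.
\<close>

lemma near_smoothing:
  assumes h: "\<And>n. 0 < h n" "h \<longlonglongrightarrow> 0"
    and w: "\<And>n t. 0 \<le> t \<Longrightarrow> w n t = smoothing (h n) x t" and d: "0 < d"
  shows "\<forall>\<^sub>F n in sequentially. near d x (w n)"
proof -
  obtain K where K: "0 < K" "exp (- K) \<le> d / 2" using exists_exp_less[of "d / 2"] d by auto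
  define L where "L = clock x K"
  have wc: "continuous_on {0..} (w n)" for n
    using continuous_smoothing[OF regular_cadlag[OF cadlag] h(1)[of n]] w
    by (subst continuous_on_cong[OF refl, of _ _ "smoothing (h n) x"]) auto
  have Sc: "continuous_on {0..} (smoothing (h n) (clock x))" for n
    by (rule continuous_smoothing[OF regular_clock h(1)])
  have "uniformly_continuous_on {0..L} path"
    by (rule compact_uniformly_continuous) (auto intro: continuous_on_subset[OF continuous_path])
  then obtain \<eta> where \<eta>: "0 < \<eta>" "\<And>u v. u \<in> {0..L} \<Longrightarrow> v \<in> {0..L} \<Longrightarrow> \<bar>u - v\<bar> < \<eta> \<Longrightarrow>
      dist (path u) (path v) < d / 4"
    using d unfolding uniformly_continuous_on_def dist_real_def[symmetric]
    by (metis zero_less_divide_iff zero_less_numeral)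
  \<comment> \<open>The horizons at which the smoothed clock lags behind; in the limit only jump times remain.\<close>
  define Bad where "Bad n = {T. \<eta> \<le> clock x (max 0 T) - smoothing (h n) (clock x) (max 0 T)}" for n
  have Sm: "(\<lambda>T. smoothing (h n) (clock x) (max 0 T)) \<in> borel_measurable borel" for n
    by (intro borel_measurable_continuous_onI continuous_on_compose2[OF Sc]) (auto intro!: continuous_intros)
  have Bad_m: "Bad n \<in> sets borel" for n
    unfolding Bad_def using Sm[of n] cadlag_measurable[OF cadlag_clock] by measurable
  have "(\<lambda>n. \<integral>T. indicator (Bad n) T \<partial>expo) \<longlonglongrightarrow> (\<integral>T. (0::real) \<partial>expo)"
  proof (rule integral_dominated_convergence[where w = "\<lambda>_. 1"])
    show "AE T in expo. (\<lambda>n. indicator (Bad n) T) \<longlonglongrightarrow> (0::real)"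
      using AE_expo_pos AE_expo_countable[OF countable_jumps[OF cadlag]]
    proof eventually_elim
      case (elim T)
      have "(\<lambda>n. smoothing (h n) (clock x) T) \<longlonglongrightarrow> clock x T"
        using smoothing_clock_tendsto[OF h] elim by simp
      then have "\<forall>\<^sub>F n in sequentially. clock x T - \<eta> < smoothing (h n) (clock x) T"
        by (rule order_tendstoD) (use \<eta>(1) in simp)
      then have "\<forall>\<^sub>F n in sequentially. 0 = (indicator (Bad n) T :: real)"
        by eventually_elim (use elim in \<open>auto simp: Bad_def\<close>)
      then show ?case by (rule Lim_transform_eventually[OF tendsto_const])
    qed
  qed (use Bad_m in \<open>auto simp: indicator_def\<close>)
  then have "(\<lambda>n. measure expo (Bad n)) \<longlonglongrightarrow> 0" using Bad_m by simp
  then have ev1: "\<forall>\<^sub>F n in sequentially. measure expo (Bad n) < d / 2"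
    by (rule order_tendstoD) (use d in simp)
  obtain h1 where h1: "0 < h1"
    "\<And>t h. 0 \<le> t \<Longrightarrow> t \<le> K \<Longrightarrow> 0 < h \<Longrightarrow> h < h1 \<Longrightarrow>
       \<bar>smoothing h (\<lambda>s. fill x (clock x s)) t - fill x (smoothing h (clock x) t)\<bar> \<le> d / 4"
    by (rule smoothing_commutes[OF continuous_fill fill_affine _ K(1), of "d / 4"]) (use d in auto)
  obtain h2 where h2: "0 < h2"
    "\<And>t h. 0 \<le> t \<Longrightarrow> t \<le> K \<Longrightarrow> 0 < h \<Longrightarrow> h < h2 \<Longrightarrow>
       \<bar>smoothing h (\<lambda>s. clock_inv x (clock x s)) t - clock_inv x (smoothing h (clock x) t)\<bar> \<le> d / 4"
    by (rule smoothing_commutes[OF continuous_clock_inv clock_inv_affine _ K(1), of "d / 4"]) (use d in auto)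
  have ev2: "\<forall>\<^sub>F n in sequentially. h n < min (min h1 h2) (d / 4)"
    by (rule order_tendstoD(2)[OF h(2)]) (use h1 h2 d in auto)
  show ?thesis using ev1 ev2
  proof eventually_elim
    case (elim n)
    let ?S = "smoothing (h n) (clock x)"
    have pw: "gap (path (?S t)) (w n t, t) \<le> d / 2" if t: "0 \<le> t" "t \<le> K" for t
    proof -
      have "\<bar>w n t - fill x (?S t)\<bar> \<le> d / 4"
        using h1(2)[OF t h(1)[of n]] elim(2) w[OF t(1)]
          smoothing_cong_nonneg[of "\<lambda>s. fill x (clock x s)" x] by simp
      moreover have "\<bar>smoothing (h n) (\<lambda>s. s) t - clock_inv x (?S t)\<bar> \<le> d / 4"
        using h2(2)[OF t h(1)[of n]] elim(2)
          smoothing_cong_nonneg[of "\<lambda>s. clock_inv x (clock x s)" "\<lambda>s. s"] by simp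
      then have "\<bar>t - clock_inv x (?S t)\<bar> \<le> d / 2"
        using smoothing_identity[OF h(1)[of n] t(1)] elim(2) by linarith
      ultimately show ?thesis using d by (simp add: gap_def abs_minus_commute)
    qed
    show "near d x (w n)" unfolding near_def
    proof (intro bexI[of _ "{K<..} \<union> Bad n"] conjI allI impI)
      show "measure expo ({K<..} \<union> Bad n) \<le> d"
        using measure_Un_le[of "{K<..}" expo "Bad n"] Bad_m elim(1) expo_tail[of K] K by simp
      fix T assume T: "0 < T" "T \<notin> {K<..} \<union> Bad n"
      then have TK: "T \<le> K" and S: "clock x T - ?S T < \<eta>" by (auto simp: Bad_def)
      \<comment> \<open>The smoothed clock stops short of \<open>clock x T\<close>; the linear term closes the remaining distance.\<close>
      define \<phi> where "\<phi> v = ?S (T * v) + v * (clock x T - ?S T)" for v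
      have ST: "0 \<le> ?S T" "?S T \<le> clock x T" using smoothing_clock_bounds[OF h(1)] T by auto
      have tc: "time_change (clock x T) \<phi>"
      proof (rule time_changeI)
        have "continuous_on {0..1} (\<lambda>v. ?S (T * v))"
          by (rule continuous_on_compose2[OF Sc]) (use T in \<open>auto intro!: continuous_intros\<close>)
        then show "continuous_on {0..1} \<phi>" unfolding \<phi>_def by (intro continuous_intros)
        show "\<phi> u \<le> \<phi> v" if "0 \<le> u" "u \<le> v" "v \<le> 1" for u v
          unfolding \<phi>_def using that ST T
          by (intro add_mono smoothing_clock_mono[OF h(1)] mult_right_mono mult_left_mono) auto
        have "?S 0 = 0" using smoothing_clock_bounds[OF h(1)[of n], of 0] by simp
        then show "\<phi> 0 = 0" by (simp add: \<phi>_def)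
        show "\<phi> 1 = clock x T" by (simp add: \<phi>_def)
      qed
      have tc': "time_change T (\<lambda>v. T * v)" using T by (intro time_change_linear) simp
      have "M1_dist_on T x (w n) \<le> d / 4 + d / 2"
      proof (rule M1_dist_on_le[OF path_parametrization[OF T(1) tc] graph_parametrization[OF wc tc']])
        fix v :: real assume v: "0 \<le> v" "v \<le> 1"
        have "T * v \<le> T" using T v by (intro mult_left_le) auto
        then have Tv: "0 \<le> T * v" "T * v \<le> K" using T v TK by (simp, linarith)
        have \<phi>L: "\<phi> v \<in> {0..L}"
          using time_change_range[OF tc v] clock_mono[of T K] T TK by (auto simp: L_def)
        have SL: "?S (T * v) \<in> {0..L}"
          using smoothing_clock_bounds[OF h(1)[of n] Tv(1)] clock_mono[OF Tv] by (auto simp: L_def)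
        have "v * (clock x T - ?S T) \<le> clock x T - ?S T" using v ST by (intro mult_left_le_one_le) auto
        moreover have "0 \<le> v * (clock x T - ?S T)" using v ST by simp
        ultimately have "\<bar>\<phi> v - ?S (T * v)\<bar> < \<eta>" using S by (simp add: \<phi>_def)
        then have "gap (path (\<phi> v)) (path (?S (T * v))) \<le> d / 4"
          using \<eta>(2)[OF \<phi>L SL] gap_le_dist[of "path (\<phi> v)" "path (?S (T * v))"] by simp
        then show "gap (path (\<phi> v)) (w n (T * v), T * v) \<le> d / 4 + d / 2"
          using pw[OF Tv] gap_triangle[of "path (\<phi> v)" "(w n (T * v), T * v)" "path (?S (T * v))"]
          by linarith
      qed
      then show "M1_dist_on T x (w n) < d" using d by simp
    qed (use Bad_m in simp)
  qed
qed

end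

section \<open>Approximation by finitely many values of the path\<close>

lemma regular_indicator:
  assumes "0 \<le> a"
  shows "regular (indicator {a<..b})"
  unfolding regular_def
proof (intro conjI allI)
  have "isCont (\<lambda>s. indicator {a<..b} (max 0 s) :: real) s" if s: "s \<notin> {a, b}" for s
  proof -
    have c: "isCont (\<lambda>s. indicator {a<..b} (max 0 s) :: real) s"
      if "open S" "s \<in> S" "\<And>u. u \<in> S \<Longrightarrow> indicator {a<..b} (max 0 u) = (c :: real)" for S c
    proof -
      have "\<forall>\<^sub>F u in nhds s. u \<in> S" using that by (intro eventually_nhds_in_open)
      then have "\<forall>\<^sub>F u in nhds s. indicator {a<..b} (max 0 u) = c" by eventually_elim (rule that(3))
      then have "isCont (\<lambda>s. indicator {a<..b} (max 0 s) :: real) s = isCont (\<lambda>_. c) s" by (rule isCont_cong)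
      then show ?thesis by simp
    qed
    consider "s < a" | "a < s" "s < b" | "b < s" using s by fastforce
    then show ?thesis
    proof cases
      case 1 then show ?thesis using assms by (intro c[of "{..<a}" 0]) (auto simp: indicator_def)
    next
      case 2 then show ?thesis using assms by (intro c[of "{a<..<b}" 1]) auto
    next
      case 3 then show ?thesis by (intro c[of "{b<..}" 0]) auto
    qed
  qed
  then show "\<exists>D. countable D \<and> (\<forall>s. s \<notin> D \<longrightarrow> isCont (\<lambda>s. indicator {a<..b} (max 0 s) :: real) s)"
    by (intro exI[of _ "{a, b}"]) auto
qed (auto simp: indicator_def intro!: exI[of _ 1])

lemma regular_lincomb:
  assumes "regular f" "regular g"
  shows "regular (\<lambda>s. f s + c * g s)"
  unfolding regular_def
proof (intro conjI allI)
  obtain D where D: "countable D" "\<And>s. s \<notin> D \<Longrightarrow> isCont (\<lambda>s. f (max 0 s)) s"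
    using assms(1) unfolding regular_def by blast
  obtain E where E: "countable E" "\<And>s. s \<notin> E \<Longrightarrow> isCont (\<lambda>s. g (max 0 s)) s"
    using assms(2) unfolding regular_def by blast
  show "\<exists>D. countable D \<and> (\<forall>s. s \<notin> D \<longrightarrow> isCont (\<lambda>s. f (max 0 s) + c * g (max 0 s)) s)"
    by (intro exI[of _ "D \<union> E"]) (use D E in \<open>auto intro!: continuous_intros\<close>)
  fix K
  obtain A where A: "\<And>t. 0 \<le> t \<Longrightarrow> t \<le> K \<Longrightarrow> \<bar>f t\<bar> \<le> A"
    using regular_bounded[OF assms(1), of K] by blast
  obtain B where B: "\<And>t. 0 \<le> t \<Longrightarrow> t \<le> K \<Longrightarrow> \<bar>g t\<bar> \<le> B"
    using regular_bounded[OF assms(2), of K] by blast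
  have "\<bar>f t + c * g t\<bar> \<le> A + \<bar>c\<bar> * B" if t: "0 \<le> t" "t \<le> K" for t
  proof -
    have "\<bar>f t + c * g t\<bar> \<le> \<bar>f t\<bar> + \<bar>c\<bar> * \<bar>g t\<bar>" by (metis abs_mult abs_triangle_ineq)
    also have "\<dots> \<le> A + \<bar>c\<bar> * B" using A[OF t] B[OF t] by (intro add_mono mult_left_mono) auto
    finally show ?thesis .
  qed
  then show "\<exists>B. \<forall>t. 0 \<le> t \<longrightarrow> t \<le> K \<longrightarrow> \<bar>f t + c * g t\<bar> \<le> B" by blast
qed

lemma regular_const: "regular (\<lambda>_. c)"
  by (intro regular_cadlag cadlag_continuous_on continuous_intros)

text \<open>
  The value at the right end of a grid cell represents the path on the cell, so that
  right-continuity gives convergence. Using \<open>m * m\<close> cells of length \<open>1 / m\<close> covers \<open>[0,m]\<close>.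
\<close>

definition cell :: "nat \<Rightarrow> nat \<Rightarrow> real set" where
  "cell m k = {real k / real m<..(real k + 1) / real m}"

definition step :: "nat \<Rightarrow> (nat \<Rightarrow> real) \<Rightarrow> real \<Rightarrow> real" where
  "step m a s = (\<Sum>k<m * m. a k * indicator (cell m k) s)"

definition smooth_step :: "real \<Rightarrow> nat \<Rightarrow> (nat \<Rightarrow> real) \<Rightarrow> real \<Rightarrow> real" where
  "smooth_step h m a = (\<lambda>t\<in>{0..}. \<Sum>k<m * m. a k * smoothing h (indicator (cell m k)) t)"

lemma regular_cell: "regular (indicator (cell m k))"
  unfolding cell_def by (rule regular_indicator) simp

lemma regular_step_aux: "regular (\<lambda>s. \<Sum>k<n. a k * indicator (cell m k) s)"
  by (induction n) (simp_all add: regular_const regular_lincomb regular_cell)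

lemma regular_step: "regular (step m a)"
  unfolding step_def by (rule regular_step_aux)

lemma step_0: "step m a 0 = 0"
  by (auto simp: step_def cell_def indicator_def divide_less_0_iff intro!: sum.neutral)

lemma smoothing_step:
  assumes "0 < h" "0 \<le> t"
  shows "smoothing h (step m a) t = smooth_step h m a t"
proof -
  have "smoothing h (step m a) t
      = (\<Sum>k<m * m. \<integral>r. a k * indicator (cell m k) (max 0 (t - h * r)) \<partial>expo)"
    unfolding smoothing_def step_def
    using smoothing_integrable[OF regular_cell] assms
    by (intro Bochner_Integration.integral_sum integrable_mult_right) auto
  then show ?thesis using assms by (simp add: smooth_step_def smoothing_def)
qed

lemma continuous_smooth_step:
  assumes "0 < h"
  shows "continuous_on {0..} (smooth_step h m a)"
proof -
  have "continuous_on {0..} (smoothing h (step m a))"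
    by (rule continuous_smoothing[OF regular_step assms])
  then show ?thesis
    by (rule continuous_on_eq) (simp add: smoothing_step[OF assms])
qed

lemma skorokhod_continuous:
  assumes "continuous_on {0..} w" "w \<in> extensional {0..}"
  shows "w \<in> skorokhod_space"
  using assms cadlag_continuous_on by (simp add: skorokhod_space_def)

lemma skorokhod_smooth_step: "0 < h \<Longrightarrow> smooth_step h m a \<in> skorokhod_space"
  by (rule skorokhod_continuous[OF continuous_smooth_step]) (simp_all add: smooth_step_def)

lemma step_value:
  assumes "0 < s" "s \<le> real m"
  shows "step m (\<lambda>k. f ((real k + 1) / real m)) s = f (of_int \<lceil>real m * s\<rceil> / real m)"
proof -
  have m: "0 < real m" using assms by linarith
  define k0 where "k0 = nat (\<lceil>real m * s\<rceil> - 1)"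
  have c0: "0 < \<lceil>real m * s\<rceil>" using assms m by simp
  have k0: "real k0 + 1 = of_int \<lceil>real m * s\<rceil>" using c0 by (simp add: k0_def of_nat_nat)
  have "\<lceil>real m * s\<rceil> \<le> int (m * m)"
    using mult_left_mono[OF assms(2), of "real m"] by (simp add: ceiling_le_iff)
  then have k0m: "k0 < m * m" using c0 by (simp add: k0_def nat_less_iff)
  have ind: "indicator (cell m k) s = (if k = k0 then 1 else 0 :: real)" for k
  proof -
    have "s \<in> cell m k \<longleftrightarrow> real k < real m * s \<and> real m * s \<le> real k + 1"
      using m by (simp add: cell_def field_simps)
    also have "\<dots> \<longleftrightarrow> \<lceil>real m * s\<rceil> = int k + 1"
      by (subst ceiling_eq_iff) auto
    also have "\<dots> \<longleftrightarrow> k = k0" using c0 by (auto simp: k0_def)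
    finally show ?thesis by (simp add: indicator_def)
  qed
  show ?thesis
    unfolding step_def ind using k0m k0 by (simp add: if_distrib[of "\<lambda>x. _ * x"] cong: if_cong)
qed

lemma ceiling_grid:
  assumes "0 < m"
  shows "s \<le> of_int \<lceil>real m * s\<rceil> / real m" "of_int \<lceil>real m * s\<rceil> / real m \<le> s + 1 / real m"
proof -
  have "real m * s \<le> of_int \<lceil>real m * s\<rceil>" "of_int \<lceil>real m * s\<rceil> \<le> real m * s + 1"
    by (simp, linarith)
  then show "s \<le> of_int \<lceil>real m * s\<rceil> / real m" "of_int \<lceil>real m * s\<rceil> / real m \<le> s + 1 / real m"
    using assms by (auto simp: field_simps)
qed

lemma step_tendsto:
  assumes "cadlag f" "f 0 = 0" "0 \<le> s"
  shows "(\<lambda>m. step m (\<lambda>k. f ((real k + 1) / real m)) s) \<longlonglongrightarrow> f s"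
proof (cases "s = 0")
  case True
  then show ?thesis using assms(2) by (simp add: step_0)
next
  case False
  then have s: "0 < s" using assms(3) by simp
  show ?thesis
  proof (rule LIMSEQ_I)
    fix e :: real assume e: "0 < e"
    obtain r where r: "0 < r" "\<And>u. s \<le> u \<Longrightarrow> u < s + r \<Longrightarrow> \<bar>f u - f s\<bar> < e"
      using cadlag_right_bound[OF assms(1,3) e] by blast
    obtain N :: nat where N: "max s (1 / r) < real N" using reals_Archimedean2 by blast
    show "\<exists>N. \<forall>m\<ge>N. norm (step m (\<lambda>k. f ((real k + 1) / real m)) s - f s) < e"
    proof (intro exI[of _ N] allI impI)
      fix m assume "N \<le> m"
      then have m: "s \<le> real m" "1 / r < real m" using N by auto
      have m0: "0 < m" using m(1) s by (cases m) auto
      have "1 / real m < r" using m(2) r(1) m0 by (simp add: field_simps)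
      then show "norm (step m (\<lambda>k. f ((real k + 1) / real m)) s - f s) < e"
        unfolding step_value[OF s m(1)] real_norm_def
        by (intro r(2)) (use ceiling_grid[OF m0, of s] in linarith)+
    qed
  qed
qed

lemma step_bound:
  assumes "0 < m" "s \<le> real m" "0 \<le> s" "s \<le> K" "\<And>u. 0 \<le> u \<Longrightarrow> u \<le> K + 1 \<Longrightarrow> \<bar>f u\<bar> \<le> B" "0 \<le> B"
  shows "\<bar>step m (\<lambda>k. f ((real k + 1) / real m)) s\<bar> \<le> B"
proof (cases "s = 0")
  case True
  then show ?thesis using assms by (simp add: step_0)
next
  case False
  then have s: "0 < s" using assms(3) by simp
  have "1 / real m \<le> 1" using assms(1) by simp
  then show ?thesis unfolding step_value[OF s assms(2)]
    by (intro assms(5)) (use ceiling_grid[OF assms(1), of s] assms(3,4) in linarith)+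
qed

text \<open>
  The exponential kernel is at most \<open>1\<close>, which turns an integral bound into a bound uniform in time.
\<close>

lemma smoothing_le_integral:
  assumes "regular g" "g 0 = 0" "0 < h" "0 \<le> t" "t \<le> K"
  shows "\<bar>smoothing h g t\<bar> \<le> 1 / h * (LBINT s:{0..K}. \<bar>g s\<bar>)"
proof -
  obtain B where B: "0 < B" "\<And>s. 0 \<le> s \<Longrightarrow> s \<le> K \<Longrightarrow> \<bar>g s\<bar> \<le> B"
    using regular_bounded[OF assms(1)] by blast
  have gm: "(\<lambda>s. indicator {0..K} s * \<bar>g s\<bar>) \<in> borel_measurable borel"
  proof -
    have "(\<lambda>s. indicator {0..K} s * \<bar>g (max 0 s)\<bar>) \<in> borel_measurable borel"
      using regular_measurable[OF assms(1)] by measurable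
    also have "(\<lambda>s. indicator {0..K} s * \<bar>g (max 0 s)\<bar>) = (\<lambda>s. indicator {0..K} s * \<bar>g s\<bar>)"
      by (auto simp: indicator_def)
    finally show ?thesis .
  qed
  have gi: "integrable lborel (\<lambda>s. indicator {0..K} s * \<bar>g s\<bar>)"
  proof (rule Bochner_Integration.integrable_bound)
    show "integrable lborel (\<lambda>s. B * indicator {0..K} s)"
      by (intro integrable_mult_right integrable_real_indicator) (auto simp: emeasure_lborel_Icc_eq)
    show "AE s in lborel. norm (indicator {0..K} s * \<bar>g s\<bar>) \<le> norm (B * indicator {0..K} s)"
      using B by (intro AE_I2) (auto simp: indicator_def)
  qed (use gm in simp)
  have "\<bar>LBINT s:{0..t}. exp (- ((t - s) / h)) * g s\<bar>
      \<le> (\<integral>s. \<bar>indicator {0..t} s *\<^sub>R (exp (- ((t - s) / h)) * g s)\<bar> \<partial>lborel)"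
    unfolding set_lebesgue_integral_def by (rule integral_abs_bound)
  also have "\<dots> \<le> (\<integral>s. indicator {0..K} s * \<bar>g s\<bar> \<partial>lborel)"
  proof (rule integral_mono'[OF gi])
    fix s :: real
    have "exp (- ((t - s) / h)) * \<bar>g s\<bar> \<le> 1 * \<bar>g s\<bar>" if "s \<le> t"
      using that assms(3) by (intro mult_right_mono) auto
    then show "\<bar>indicator {0..t} s *\<^sub>R (exp (- ((t - s) / h)) * g s)\<bar> \<le> indicator {0..K} s * \<bar>g s\<bar>"
      using assms(5) by (auto simp: indicator_def abs_mult)
  qed (auto simp: indicator_def)
  finally have "\<bar>LBINT s:{0..t}. exp (- ((t - s) / h)) * g s\<bar> \<le> (LBINT s:{0..K}. \<bar>g s\<bar>)"
    by (simp add: set_lebesgue_integral_def)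
  then show ?thesis
    unfolding smoothing_formula[OF assms(1-4)] using assms(3) by (simp add: abs_mult divide_right_mono)
qed

text \<open>
  The step functions converge to \<open>f\<close> pointwise and boundedly, hence in the mean on compact
  intervals, and smoothing makes the convergence locally uniform.
\<close>

lemma near_smooth_step:
  assumes f: "cadlag f" "f 0 = 0" and h: "0 < h" and d: "0 < d"
  shows "\<forall>\<^sub>F m in sequentially.
    near d (\<lambda>t\<in>{0..}. smoothing h f t) (smooth_step h m (\<lambda>k. f ((real k + 1) / real m)))"
proof -
  obtain K where K: "0 < K" "exp (- K) \<le> d" using exists_exp_less[OF d] .
  define g where "g m s = f s + (- 1) * step m (\<lambda>k. f ((real k + 1) / real m)) s" for m s
  have greg: "regular (g m)" for m
    unfolding g_def by (intro regular_lincomb regular_cadlag f regular_step)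
  have g0: "g m 0 = 0" for m using f(2) by (simp add: g_def step_0)
  obtain B where B: "0 < B" "\<And>t. 0 \<le> t \<Longrightarrow> t \<le> K + 1 \<Longrightarrow> \<bar>f t\<bar> \<le> B"
    using cadlag_bounded[OF f(1), of "K + 1"] by blast
  obtain m0 :: nat where m0: "max K 1 < real m0" using reals_Archimedean2 by blast
  have "(\<lambda>m. \<integral>s. indicator {0..K} s * \<bar>g (m + m0) s\<bar> \<partial>lborel) \<longlonglongrightarrow> integral\<^sup>L lborel (\<lambda>s :: real. 0 :: real)"
  proof (rule integral_dominated_convergence[where w = "\<lambda>s. 2 * B * indicator {0..K} s"
        and s = "\<lambda>m s. indicator {0..K} s * \<bar>g (m + m0) s\<bar>"])
    show "integrable lborel (\<lambda>s. 2 * B * indicator {0..K} s)"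
      by (intro integrable_mult_right integrable_real_indicator) (auto simp: emeasure_lborel_Icc_eq)
    show "(\<lambda>s. indicator {0..K} s * \<bar>g (m + m0) s\<bar>) \<in> borel_measurable lborel" for m
    proof -
      have "(\<lambda>s. indicator {0..K} s * \<bar>g (m + m0) (max 0 s)\<bar>) \<in> borel_measurable borel"
        using regular_measurable[OF greg] by measurable
      also have "(\<lambda>s. indicator {0..K} s * \<bar>g (m + m0) (max 0 s)\<bar>) = (\<lambda>s. indicator {0..K} s * \<bar>g (m + m0) s\<bar>)"
        by (auto simp: indicator_def)
      finally show ?thesis by simp
    qed
    show "AE s in lborel. (\<lambda>m. indicator {0..K} s * \<bar>g (m + m0) s\<bar>) \<longlonglongrightarrow> 0"
    proof (rule AE_I2)
      fix s :: real
      show "(\<lambda>m. indicator {0..K} s * \<bar>g (m + m0) s\<bar>) \<longlonglongrightarrow> 0"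
      proof (cases "s \<in> {0..K}")
        case True
        have "(\<lambda>m. g m s) \<longlonglongrightarrow> f s + (- 1) * f s" unfolding g_def
          by (intro tendsto_intros step_tendsto f) (use True in simp)
        then have "(\<lambda>m. g (m + m0) s) \<longlonglongrightarrow> 0" by (intro LIMSEQ_ignore_initial_segment) simp
        then have "(\<lambda>m. \<bar>g (m + m0) s\<bar>) \<longlonglongrightarrow> 0" by (rule tendsto_rabs_zero)
        then show ?thesis using True by simp
      qed simp
    qed
    show "AE s in lborel. norm (indicator {0..K} s * \<bar>g (m + m0) s\<bar>) \<le> 2 * B * indicator {0..K} s" for m
    proof (rule AE_I2)
      fix s :: real
      show "norm (indicator {0..K} s * \<bar>g (m + m0) s\<bar>) \<le> 2 * B * indicator {0..K} s"
      proof (cases "s \<in> {0..K}")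
        case True
        have "\<bar>step (m + m0) (\<lambda>k. f ((real k + 1) / real (m + m0))) s\<bar> \<le> B"
          by (rule step_bound[of _ _ K]) (use True m0 B in auto)
        then show ?thesis using B(2)[of s] True by (simp add: g_def)
      qed simp
    qed
  qed simp_all
  then have "(\<lambda>m. \<integral>s. indicator {0..K} s * \<bar>g m s\<bar> \<partial>lborel) \<longlonglongrightarrow> 0"
    by (simp add: LIMSEQ_offset)
  then have "(\<lambda>m. 1 / h * (\<integral>s. indicator {0..K} s * \<bar>g m s\<bar> \<partial>lborel)) \<longlonglongrightarrow> 1 / h * 0"
    by (intro tendsto_intros)
  then have "\<forall>\<^sub>F m in sequentially. 1 / h * (\<integral>s. indicator {0..K} s * \<bar>g m s\<bar> \<partial>lborel) < d"
    by (rule order_tendstoD) (use d in simp)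
  then show ?thesis
  proof eventually_elim
    case (elim m)
    have c: "continuous_on {0..} (\<lambda>t\<in>{0..}. smoothing h f t)"
      by (rule continuous_on_eq[OF continuous_smoothing[OF regular_cadlag[OF f(1)] h]]) simp
    show ?case
    proof (rule near_if_uniformly_close[OF c continuous_smooth_step[OF h] K _ elim])
      fix t assume t: "0 \<le> t" "t \<le> K"
      have "smoothing h (g m) t
          = smoothing h f t - smoothing h (step m (\<lambda>k. f ((real k + 1) / real m))) t"
        unfolding smoothing_def g_def
        using smoothing_integrable[OF regular_cadlag[OF f(1)], of h t] smoothing_integrable[OF regular_step, of h t]
          h t by simp
      moreover have "\<bar>smoothing h (g m) t\<bar> \<le> 1 / h * (LBINT s:{0..K}. \<bar>g m s\<bar>)"
        by (rule smoothing_le_integral[OF greg g0 h t])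
      ultimately show "\<bar>(\<lambda>t\<in>{0..}. smoothing h f t) t - smooth_step h m (\<lambda>k. f ((real k + 1) / real m)) t\<bar>
          \<le> 1 / h * (\<integral>s. indicator {0..K} s * \<bar>g m s\<bar> \<partial>lborel)"
        using t smoothing_step[OF h t(1)] by (simp add: set_lebesgue_integral_def)
    qed
  qed
qed

lemma smoothing_indicator_bounds:
  assumes "0 < h" "0 \<le> t"
  shows "\<bar>smoothing h (indicator (cell m k)) t\<bar> \<le> 1"
proof -
  note i = smoothing_integrable[OF regular_cell, of h t m k]
  have "0 \<le> smoothing h (indicator (cell m k)) t" unfolding smoothing_def
    by (rule integral_nonneg_AE) simp
  moreover have "smoothing h (indicator (cell m k)) t \<le> 1" unfolding smoothing_def
    by (rule expo.integral_le_const) (use i assms in \<open>auto simp: indicator_def\<close>)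
  ultimately show ?thesis by simp
qed

lemma open_vimage_smooth_step:
  assumes U: "near_open U" and h: "0 < h"
  shows "open {a. smooth_step h m a \<in> U}"
proof (subst open_subopen, intro ballI)
  fix a assume a: "a \<in> {a. smooth_step h m a \<in> U}"
  then obtain d where d: "0 < d"
    "\<And>y. y \<in> skorokhod_space \<Longrightarrow> near d (smooth_step h m a) y \<Longrightarrow> y \<in> U"
    using U unfolding near_open_def by blast
  obtain K where K: "0 < K" "exp (- K) \<le> d" using exists_exp_less[OF d(1)] .
  define V where "V = {b :: nat \<Rightarrow> real. (\<Sum>k<m * m. \<bar>a k - b k\<bar>) < d}"
  have "open V" unfolding V_def by (intro open_Collect_less continuous_intros) simp_all
  moreover have "a \<in> V" using d by (simp add: V_def)
  moreover have "V \<subseteq> {a. smooth_step h m a \<in> U}"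
  proof
    fix b assume b: "b \<in> V"
    have "near d (smooth_step h m a) (smooth_step h m b)"
    proof (rule near_if_uniformly_close[OF continuous_smooth_step[OF h] continuous_smooth_step[OF h] K])
      fix t assume t: "0 \<le> t" "t \<le> K"
      have "\<bar>smooth_step h m a t - smooth_step h m b t\<bar>
          = \<bar>\<Sum>k<m * m. (a k - b k) * smoothing h (indicator (cell m k)) t\<bar>"
        using t by (simp add: smooth_step_def sum_subtractf left_diff_distrib)
      also have "\<dots> \<le> (\<Sum>k<m * m. \<bar>(a k - b k) * smoothing h (indicator (cell m k)) t\<bar>)"
        by (rule sum_abs)
      also have "\<dots> \<le> (\<Sum>k<m * m. \<bar>a k - b k\<bar>)"
        using smoothing_indicator_bounds[OF h t(1)]
        by (intro sum_mono) (simp add: abs_mult mult_left_le)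
      finally show "\<bar>smooth_step h m a t - smooth_step h m b t\<bar> \<le> (\<Sum>k<m * m. \<bar>a k - b k\<bar>)" .
    qed (use b in \<open>simp add: V_def\<close>)
    then show "b \<in> {a. smooth_step h m a \<in> U}" using d(2) skorokhod_smooth_step[OF h] by simp
  qed
  ultimately show "\<exists>T. open T \<and> a \<in> T \<and> T \<subseteq> {a. smooth_step h m a \<in> U}" by blast
qed

lemma near_measurable_smooth_step:
  assumes "0 < h" "X \<in> measurable M borel"
  shows "near_measurable M (\<lambda>\<omega>. smooth_step h m (X \<omega>))"
  unfolding near_measurable_def
proof (intro conjI allI impI)
  fix U assume "near_open U"
  then have "{a. smooth_step h m a \<in> U} \<in> sets borel" using open_vimage_smooth_step[OF _ assms(1)] by simp
  then have "X -` {a. smooth_step h m a \<in> U} \<inter> space M \<in> sets M"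
    by (rule measurable_sets[OF assms(2)])
  then show "(\<lambda>\<omega>. smooth_step h m (X \<omega>)) -` U \<inter> space M \<in> sets M" by (simp add: vimage_def)
qed (use skorokhod_smooth_step[OF assms(1)] in simp)

lemma measurable_continuous_smooth_step:
  assumes "continuous_map M1_topology euclideanreal f" "0 < h"
  shows "(\<lambda>a. f (smooth_step h m a)) \<in> borel_measurable borel"
proof (rule borel_measurableI)
  fix S :: "real set" assume "open S"
  then have "openin M1_topology {z \<in> topspace M1_topology. f z \<in> S}"
    using assms(1) by (simp add: continuous_map_def)
  then have "open {a. smooth_step h m a \<in> {z \<in> topspace M1_topology. f z \<in> S}}"
    by (intro open_vimage_smooth_step near_open_M1_open assms)
  then have "open {a. f (smooth_step h m a) \<in> S}"
    using skorokhod_smooth_step[OF assms(2)] by (simp add: topspace_M1_topology)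
  then show "(\<lambda>a. f (smooth_step h m a)) -` S \<inter> space borel \<in> sets borel" by (simp add: vimage_def)
qed

section \<open>The Langevin equation as an exponential smoothing\<close>

lemma cadlag_time_scale:
  assumes "cadlag y" "0 < b"
  shows "cadlag (\<lambda>s. a * y (s / b))"
  unfolding cadlag_def
proof (intro conjI allI impI)
  have cont: "((\<lambda>s. s / b) \<longlongrightarrow> t / b) F" if "((\<lambda>s. s) \<longlongrightarrow> t) F" for t and F :: "real filter"
    using that assms(2) by (intro tendsto_intros) auto
  fix t :: real assume t: "0 \<le> t"
  have "filterlim (\<lambda>s. s / b) (at_right (t / b)) (at_right t)"
    unfolding filterlim_at using eventually_at_right_less[of t] assms(2)
    by (auto intro!: cont elim!: eventually_mono simp: divide_strict_right_mono)
  then show "((\<lambda>s. a * y (s / b)) \<longlongrightarrow> a * y (t / b)) (at_right t)"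
    using cadlag_right[OF assms(1), of "t / b"] t assms(2)
    by (intro tendsto_intros) (auto intro: filterlim_compose)
next
  have cont: "((\<lambda>s. s / b) \<longlongrightarrow> t / b) F" if "((\<lambda>s. s) \<longlongrightarrow> t) F" for t and F :: "real filter"
    using that assms(2) by (intro tendsto_intros) auto
  fix t :: real assume t: "0 < t"
  have "\<forall>\<^sub>F s in at_left t. s < t" by (simp add: eventually_at_filter)
  then have "filterlim (\<lambda>s. s / b) (at_left (t / b)) (at_left t)"
    unfolding filterlim_at using assms(2)
    by (auto intro!: cont elim!: eventually_mono simp: divide_strict_right_mono)
  then have "((\<lambda>s. a * y (s / b)) \<longlongrightarrow> a * left_limit y (t / b)) (at_left t)"
    using cadlag_left[OF assms(1), of "t / b"] t assms(2)
    by (intro tendsto_intros) (auto intro: filterlim_compose)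
  then show "\<exists>c. ((\<lambda>s. a * y (s / b)) \<longlongrightarrow> c) (at_left t)" by blast
qed

lemma cadlag_set_integrable:
  assumes "cadlag v" "continuous_on UNIV g"
  shows "set_integrable lborel {0..t} (\<lambda>s. g s * v s)"
proof -
  obtain B where B: "0 < B" "\<And>s. 0 \<le> s \<Longrightarrow> s \<le> t \<Longrightarrow> \<bar>v s\<bar> \<le> B" using cadlag_bounded[OF assms(1), of t] by blast
  have "compact (g ` {0..t})"
    by (intro compact_continuous_image continuous_on_subset[OF assms(2)]) auto
  then obtain C where C: "0 < C" "\<And>s. 0 \<le> s \<Longrightarrow> s \<le> t \<Longrightarrow> \<bar>g s\<bar> \<le> C"
    using compact_imp_bounded[of "g ` {0..t}"] unfolding bounded_pos by auto
  have "(\<lambda>s. indicator {0..t} s *\<^sub>R (g s * v (max 0 s))) \<in> borel_measurable borel"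
    using cadlag_measurable[OF assms(1)] borel_measurable_continuous_onI[OF assms(2)] by measurable
  also have "(\<lambda>s. indicator {0..t} s *\<^sub>R (g s * v (max 0 s))) = (\<lambda>s. indicator {0..t} s *\<^sub>R (g s * v s))"
    by (auto simp: indicator_def)
  finally have m: "(\<lambda>s. indicator {0..t} s *\<^sub>R (g s * v s)) \<in> borel_measurable lborel" by simp
  show ?thesis unfolding set_integrable_def
  proof (rule Bochner_Integration.integrable_bound[OF _ m])
    show "integrable lborel (\<lambda>s. (C * B) * indicator {0..t} s)"
      by (intro integrable_mult_right integrable_real_indicator) (auto simp: emeasure_lborel_Icc_eq)
    show "AE s in lborel. norm (indicator {0..t} s *\<^sub>R (g s * v s)) \<le> norm ((C * B) * indicator {0..t} s)"
    proof (rule AE_I2)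
      fix s :: real
      have "\<bar>g s * v s\<bar> \<le> C * B" if "0 \<le> s" "s \<le> t"
        unfolding abs_mult using B(1) C(1) by (intro mult_mono C(2) B(2)) (use that in auto)
      then show "norm (indicator {0..t} s *\<^sub>R (g s * v s)) \<le> norm ((C * B) * indicator {0..t} s)"
        using B(1) C(1) by (auto simp: indicator_def)
    qed
  qed
qed

lemma exp_kernel_integral:
  fixes r t A :: real
  assumes "r \<le> t"
  shows "(LBINT s:{r..t}. A * exp (- (A * (t - s)))) = 1 - exp (- (A * (t - r)))"
proof -
  have "(LBINT s:{r..t}. A * exp (- (A * (t - s)))) = exp (- (A * (t - t))) - exp (- (A * (t - r)))"
    unfolding set_lebesgue_integral_def
  proof (rule integral_FTC_atLeastAtMost[OF assms])
    fix s
    have "((\<lambda>s. exp (- (A * (t - s)))) has_real_derivative A * exp (- (A * (t - s)))) (at s within {r..t})"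
      by (auto intro!: derivative_eq_intros)
    then show "((\<lambda>s. exp (- (A * (t - s)))) has_vector_derivative A * exp (- (A * (t - s)))) (at s within {r..t})"
      by (simp add: has_real_derivative_iff_has_vector_derivative)
  qed (intro continuous_intros)
  then show ?thesis by simp
qed

text \<open>
  Integration by parts for the indefinite integral of \<open>v\<close>, in the form of an exchange of the order of
  integration, because \<open>v\<close> may jump.
\<close>

lemma langevin_fubini:
  assumes v: "cadlag v" and A: "0 < A" and t: "0 \<le> t"
  shows "(LBINT s:{0..t}. A * exp (- (A * (t - s))) * (LBINT r:{0..s}. v r))
    = (LBINT r:{0..t}. (1 - exp (- (A * (t - r)))) * v r)"
proof -
  define F where "F s r = (if 0 \<le> r \<and> r \<le> s \<and> s \<le> t then A * exp (- (A * (t - s))) * v (max 0 r) else 0)"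
    for s r :: real
  obtain B where B: "0 < B" "\<And>s. 0 \<le> s \<Longrightarrow> s \<le> t \<Longrightarrow> \<bar>v s\<bar> \<le> B" using cadlag_bounded[OF v, of t] by blast
  have vm: "(\<lambda>r. v (max 0 r)) \<in> borel_measurable borel" by (rule cadlag_measurable[OF v])
  have "case_prod F \<in> borel_measurable (borel \<Otimes>\<^sub>M borel)"
    unfolding F_def split_beta using measurable_compose[OF measurable_snd vm] by measurable
  then have Fm: "case_prod F \<in> borel_measurable (lborel \<Otimes>\<^sub>M lborel)" by simp
  have "integrable (lborel \<Otimes>\<^sub>M lborel) (case_prod F)"
  proof (rule Bochner_Integration.integrable_bound[OF _ Fm])
    show "integrable (lborel \<Otimes>\<^sub>M lborel) (\<lambda>p. (A * B) * indicator ({0..t} \<times> {0..t}) p)"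
      by (intro integrable_mult_right integrable_real_indicator)
        (auto simp: lborel.emeasure_pair_measure_Times emeasure_lborel_Icc_eq ennreal_mult_less_top)
    show "AE p in lborel \<Otimes>\<^sub>M lborel. norm (case_prod F p) \<le> norm ((A * B) * indicator ({0..t} \<times> {0..t}) p)"
    proof (rule AE_I2)
      fix p :: "real \<times> real"
      obtain s r where p: "p = (s, r)" by (cases p)
      have "\<bar>A * exp (- (A * (t - s))) * v r\<bar> \<le> A * B" if "0 \<le> r" "r \<le> s" "s \<le> t"
      proof -
        have "A * exp (- (A * (t - s))) * \<bar>v r\<bar> \<le> (A * 1) * B"
          using that A B by (intro mult_mono) auto
        then show ?thesis using A by (simp add: abs_mult)
      qed
      then show "norm (case_prod F p) \<le> norm ((A * B) * indicator ({0..t} \<times> {0..t}) p)"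
        using A B(1) by (auto simp: p F_def indicator_def)
    qed
  qed
  then have fub: "(\<integral>r. (\<integral>s. F s r \<partial>lborel) \<partial>lborel) = (\<integral>s. (\<integral>r. F s r \<partial>lborel) \<partial>lborel)"
    by (rule lborel_pair.Fubini_integral)
  have "(\<integral>r. F s r \<partial>lborel) = indicator {0..t} s *\<^sub>R (A * exp (- (A * (t - s))) * (LBINT r:{0..s}. v r))" for s
  proof -
    have "(\<integral>r. F s r \<partial>lborel)
        = (\<integral>r. (indicator {0..t} s * (A * exp (- (A * (t - s))))) * (indicator {0..s} r *\<^sub>R v r) \<partial>lborel)"
      by (intro Bochner_Integration.integral_cong refl) (auto simp: F_def indicator_def)
    then show ?thesis by (simp add: set_lebesgue_integral_def)
  qed
  moreover have "(\<integral>s. F s r \<partial>lborel) = indicator {0..t} r *\<^sub>R ((1 - exp (- (A * (t - r)))) * v r)" for r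
  proof (cases "r \<in> {0..t}")
    case True
    have "(\<integral>s. F s r \<partial>lborel) = (\<integral>s. v r * (indicator {r..t} s *\<^sub>R (A * exp (- (A * (t - s))))) \<partial>lborel)"
      using True by (intro Bochner_Integration.integral_cong refl) (auto simp: F_def indicator_def)
    also have "\<dots> = v r * (LBINT s:{r..t}. A * exp (- (A * (t - s))))"
      unfolding set_lebesgue_integral_def by (rule integral_mult_right_zero)
    also have "\<dots> = v r * (1 - exp (- (A * (t - r))))"
      using exp_kernel_integral[of r t A] True by simp
    finally show ?thesis using True by (simp add: mult.commute)
  next
    case False
    then have "F s r = 0" for s by (auto simp: F_def)
    then show ?thesis using False by simp
  qed
  ultimately show ?thesis using fub by (simp add: set_lebesgue_integral_def)
qed

text \<open>
  Variation of constants: the equation expresses the noise as \<open>v + A \<integral> v\<close>, and after smoothing the contributions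
  of \<open>v\<close> under the exponential kernel cancel.
\<close>

lemma langevin_integral_eq_smoothing:
  assumes v: "cadlag v" and A: "0 < A" and y: "cadlag y" "y 0 = 0"
    and eq: "\<And>t. 0 \<le> t \<Longrightarrow> v t = - A * (LBINT s:{0..t}. v s) + y t" and t: "0 \<le> t"
  shows "A * (LBINT s:{0..t}. v s) = smoothing (1 / A) y t"
proof -
  define X where "X s = (LBINT r:{0..s}. v r)" for s
  have yX: "y s = v s + A * X s" if "0 \<le> s" for s using eq[OF that] by (simp add: X_def)
  have i1: "set_integrable lborel {0..t} (\<lambda>s. exp (- (A * (t - s))) * v s)"
    by (rule cadlag_set_integrable[OF v]) (intro continuous_intros)
  have i2: "set_integrable lborel {0..t} (\<lambda>s. exp (- (A * (t - s))) * y s)"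
    by (rule cadlag_set_integrable[OF y(1)]) (intro continuous_intros)
  have i3: "set_integrable lborel {0..t} v"
    using cadlag_set_integrable[OF v, of "\<lambda>_. 1" t] by simp
  have "smoothing (1 / A) y t = A * (LBINT s:{0..t}. exp (- (A * (t - s))) * y s)"
    using smoothing_formula[OF regular_cadlag[OF y(1)] y(2), of "1 / A" t] A t by (simp add: mult.commute)
  also have "(LBINT s:{0..t}. exp (- (A * (t - s))) * y s)
      = (LBINT s:{0..t}. exp (- (A * (t - s))) * v s) + (LBINT s:{0..t}. A * exp (- (A * (t - s))) * X s)"
  proof -
    have "(LBINT s:{0..t}. exp (- (A * (t - s))) * y s) - (LBINT s:{0..t}. exp (- (A * (t - s))) * v s)
        = (LBINT s:{0..t}. exp (- (A * (t - s))) * y s - exp (- (A * (t - s))) * v s)"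
      by (rule set_integral_diff(2)[OF i2 i1, symmetric])
    also have "\<dots> = (LBINT s:{0..t}. A * exp (- (A * (t - s))) * X s)"
      by (rule set_lebesgue_integral_cong) (auto simp: yX algebra_simps)
    finally show ?thesis by simp
  qed
  also have "(LBINT s:{0..t}. A * exp (- (A * (t - s))) * X s)
      = (LBINT s:{0..t}. v s - exp (- (A * (t - s))) * v s)"
    unfolding X_def langevin_fubini[OF v A t] by (simp add: algebra_simps)
  also have "\<dots> = X t - (LBINT s:{0..t}. exp (- (A * (t - s))) * v s)"
    unfolding X_def by (rule set_integral_diff(2)[OF i3 i1])
  finally show ?thesis by (simp add: X_def)
qed

lemma smoothing_time_scale:
  assumes "0 < b"
  shows "smoothing h y (t / b) = smoothing (h * b) (\<lambda>s. y (s / b)) t"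
proof -
  have "max 0 (t / b - h * r) = max 0 (t - h * b * r) / b" for r
    using assms by (auto simp: max_def field_simps)
  then show ?thesis by (simp add: smoothing_def)
qed

section \<open>Self-similarity on a grid\<close>

text \<open>
  The entries beyond \<open>n\<close> are \<open>0\<close>, so that vectors of all lengths live in the same space and the law
  can be computed by recursion on \<open>n\<close>.
\<close>

definition grid_values :: "(real \<Rightarrow> 'w \<Rightarrow> real) \<Rightarrow> real \<Rightarrow> real \<Rightarrow> nat \<Rightarrow> 'w \<Rightarrow> nat \<Rightarrow> real" where
  "grid_values l c \<tau> n \<omega> k = (if k < n then c * l ((real k + 1) * \<tau>) \<omega> else 0)"

text \<open>
  The last known value is the entry \<open>n - 1\<close>, except at the start, where the process is \<open>0\<close>.
\<close>

definition append_increment :: "nat \<Rightarrow> (nat \<Rightarrow> real) \<times> real \<Rightarrow> nat \<Rightarrow> real" where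
  "append_increment n p = (fst p)(n := (if n = 0 then 0 else fst p (n - 1)) + snd p)"

lemma measurable_append_increment: "append_increment n \<in> measurable (borel \<Otimes>\<^sub>M borel) borel"
proof (rule measurable_coordinatewise_then_product)
  fix i
  have c: "(\<lambda>p. fst p j) \<in> borel_measurable (borel \<Otimes>\<^sub>M borel)" for j :: nat
    by (rule measurable_compose[OF measurable_fst measurable_product_coordinates])
  show "(\<lambda>p. append_increment n p i) \<in> borel_measurable (borel \<Otimes>\<^sub>M borel)"
    unfolding append_increment_def using c by (cases "i = n"; cases "n = 0") auto
qed

locale levy_paths = prob_space M for M :: "'w measure" +
  fixes F :: "real \<Rightarrow> 'w measure" and l :: "real \<Rightarrow> 'w \<Rightarrow> real"
  assumes usual: "usual_conditions M F" and levy: "levy_process M F l"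
begin

lemma subalgebra_F: "0 \<le> t \<Longrightarrow> subalgebra M (F t)"
  using usual[unfolded usual_conditions_def, THEN conjunct1] by simp

lemma sets_F_mono: "0 \<le> s \<Longrightarrow> s \<le> t \<Longrightarrow> sets (F s) \<subseteq> sets (F t)"
  using usual[unfolded usual_conditions_def, THEN conjunct2, THEN conjunct1] by simp

lemma path_cadlag: "\<omega> \<in> space M \<Longrightarrow> cadlag (\<lambda>t. l t \<omega>)"
  using levy unfolding levy_process_def cadlag_adapted_def by blast

lemma path_0: "\<omega> \<in> space M \<Longrightarrow> l 0 \<omega> = 0"
  using levy unfolding levy_process_def by blast

lemma adapted: "0 \<le> s \<Longrightarrow> s \<le> t \<Longrightarrow> l s \<in> borel_measurable (F t)"
proof -
  assume st: "0 \<le> s" "s \<le> t"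
  have "l s \<in> borel_measurable (F s)"
    using levy st(1) unfolding levy_process_def cadlag_adapted_def by blast
  moreover have "subalgebra M (F s)" "subalgebra M (F t)" "sets (F s) \<subseteq> sets (F t)"
    using subalgebra_F[of s] subalgebra_F[of t] sets_F_mono[OF st] st by simp_all
  ultimately show ?thesis
    by (intro measurable_from_subalg[of "F t" "F s"]) (auto simp: subalgebra_def)
qed

lemma rv: "0 \<le> s \<Longrightarrow> l s \<in> borel_measurable M"
  using measurable_from_subalg[OF subalgebra_F adapted[of s s]] by simp

lemma distr_increment:
  assumes "0 \<le> s" "s < t"
  shows "distr M borel (\<lambda>\<omega>. c * (l t \<omega> - l s \<omega>)) = distr M borel (\<lambda>\<omega>. c * l (t - s) \<omega>)"
proof -
  have "distr M borel (\<lambda>\<omega>. c * (l t \<omega> - l s \<omega>)) = distr (distr M borel (\<lambda>\<omega>. l t \<omega> - l s \<omega>)) borel (\<lambda>x. c * x)"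
    using rv[of s] rv[of t] assms by (subst distr_distr) (auto simp: comp_def)
  also have "distr M borel (\<lambda>\<omega>. l t \<omega> - l s \<omega>) = distr M borel (l (t - s))"
    using levy assms unfolding levy_process_def by blast
  also have "distr (distr M borel (l (t - s))) borel (\<lambda>x. c * x) = distr M borel (\<lambda>\<omega>. c * l (t - s) \<omega>)"
    using rv[of "t - s"] assms by (subst distr_distr) (auto simp: comp_def)
  finally show ?thesis .
qed

lemma distr_pair_increment:
  assumes X: "X \<in> measurable (F s) N" and st: "0 \<le> s" "s < t"
  shows "distr M (N \<Otimes>\<^sub>M borel) (\<lambda>\<omega>. (X \<omega>, c * (l t \<omega> - l s \<omega>)))
    = distr M N X \<Otimes>\<^sub>M distr M borel (\<lambda>\<omega>. c * (l t \<omega> - l s \<omega>))"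
proof -
  let ?D = "\<lambda>\<omega>. l t \<omega> - l s \<omega>"
  have sub: "subalgebra M (F s)" by (rule subalgebra_F[OF st(1)])
  have XM: "X \<in> measurable M N" by (rule measurable_from_subalg[OF sub X])
  have D: "?D \<in> borel_measurable M" "(\<lambda>\<omega>. c * ?D \<omega>) \<in> borel_measurable M"
    using rv[of s] rv[of t] st by auto
  have pair: "(\<lambda>\<omega>. (X \<omega>, c * ?D \<omega>)) \<in> measurable M (N \<Otimes>\<^sub>M borel)"
    using XM D(2) by (rule measurable_Pair)
  have ind: "indep_set (sets (F s)) {?D -` B \<inter> space M | B. B \<in> sets borel}"
    using levy st unfolding levy_process_def by blast
  interpret X: prob_space "distr M N X" by (rule prob_space_distr[OF XM])
  interpret D: prob_space "distr M borel (\<lambda>\<omega>. c * ?D \<omega>)" by (rule prob_space_distr[OF D(2)])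
  show ?thesis
  proof (rule pair_measure_eqI[symmetric])
    fix A B assume AB: "A \<in> sets (distr M N X)" "B \<in> sets (distr M borel (\<lambda>\<omega>. c * ?D \<omega>))"
    then have A: "A \<in> sets N" and B: "B \<in> sets borel" by simp_all
    have "(\<lambda>x. c * x) -` B \<inter> space borel \<in> sets borel" by (rule measurable_sets[OF _ B]) simp
    then have cB: "(\<lambda>x. c * x) -` B \<in> sets borel" by simp
    have eqB: "(\<lambda>\<omega>. c * ?D \<omega>) -` B \<inter> space M = ?D -` ((\<lambda>x. c * x) -` B) \<inter> space M" by auto
    have "X -` A \<inter> space M \<in> sets (F s)"
      using measurable_sets[OF X A] sub by (simp add: subalgebra_def)
    moreover have "(\<lambda>\<omega>. c * ?D \<omega>) -` B \<inter> space M \<in> {?D -` B \<inter> space M | B. B \<in> sets borel}"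
      unfolding eqB using cB by blast
    ultimately have "prob ((X -` A \<inter> space M) \<inter> ((\<lambda>\<omega>. c * ?D \<omega>) -` B \<inter> space M))
        = prob (X -` A \<inter> space M) * prob ((\<lambda>\<omega>. c * ?D \<omega>) -` B \<inter> space M)"
      by (rule indep_setD[OF ind])
    moreover have "(X -` A \<inter> space M) \<inter> ((\<lambda>\<omega>. c * ?D \<omega>) -` B \<inter> space M)
        = (\<lambda>\<omega>. (X \<omega>, c * ?D \<omega>)) -` (A \<times> B) \<inter> space M" by auto
    ultimately show "emeasure (distr M N X) A * emeasure (distr M borel (\<lambda>\<omega>. c * ?D \<omega>)) B
        = emeasure (distr M (N \<Otimes>\<^sub>M borel) (\<lambda>\<omega>. (X \<omega>, c * ?D \<omega>))) (A \<times> B)"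
      using A B XM D(2) pair
      by (simp add: emeasure_distr emeasure_eq_measure pair_measureI flip: ennreal_mult')
  qed (unfold_locales, simp)
qed

lemma grid_values_measurable:
  assumes "0 \<le> \<tau>"
  shows "grid_values l c \<tau> n \<in> measurable (F (real n * \<tau>)) borel"
proof (rule measurable_coordinatewise_then_product)
  fix k
  have "(real k + 1) * \<tau> \<le> real n * \<tau>" if "k < n"
    using that assms by (intro mult_right_mono) auto
  then have "l ((real k + 1) * \<tau>) \<in> borel_measurable (F (real n * \<tau>))" if "k < n"
    using that assms by (intro adapted) auto
  then show "(\<lambda>\<omega>. grid_values l c \<tau> n \<omega> k) \<in> borel_measurable (F (real n * \<tau>))"
    unfolding grid_values_def by (cases "k < n") auto
qed

lemma grid_values_rv:
  assumes "0 \<le> \<tau>"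
  shows "grid_values l c \<tau> n \<in> measurable M borel"
proof (rule measurable_from_subalg[OF _ grid_values_measurable[OF assms]])
  have "0 \<le> real n * \<tau>" using assms by simp
  then show "subalgebra M (F (real n * \<tau>))" by (rule subalgebra_F)
qed

lemma grid_values_Suc:
  assumes "\<omega> \<in> space M"
  shows "grid_values l c \<tau> (Suc n) \<omega>
    = append_increment n (grid_values l c \<tau> n \<omega>, c * (l (real (Suc n) * \<tau>) \<omega> - l (real n * \<tau>) \<omega>))"
proof
  fix k
  have "grid_values l c \<tau> n \<omega> (n - 1) = c * l (real n * \<tau>) \<omega>" if "n \<noteq> 0"
    using that by (simp add: grid_values_def of_nat_diff)
  moreover have "l (real n * \<tau>) \<omega> = 0" if "n = 0" using that path_0[OF assms] by simp
  ultimately show "grid_values l c \<tau> (Suc n) \<omega> k = append_increment n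
      (grid_values l c \<tau> n \<omega>, c * (l (real (Suc n) * \<tau>) \<omega> - l (real n * \<tau>) \<omega>)) k"
    by (cases "k = n"; cases "n = 0")
      (auto simp: append_increment_def grid_values_def algebra_simps less_Suc_eq)
qed

lemma distr_grid_values_Suc:
  assumes "0 < \<tau>"
  shows "distr M borel (grid_values l c \<tau> (Suc n))
    = distr (distr M borel (grid_values l c \<tau> n) \<Otimes>\<^sub>M distr M borel (\<lambda>\<omega>. c * l \<tau> \<omega>)) borel (append_increment n)"
proof -
  let ?I = "\<lambda>\<omega>. c * (l (real (Suc n) * \<tau>) \<omega> - l (real n * \<tau>) \<omega>)"
  have ord: "0 \<le> real n * \<tau>" "real n * \<tau> < real (Suc n) * \<tau>" using assms by auto
  have rvs: "random_variable borel (grid_values l c \<tau> n)" "random_variable borel ?I"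
    using grid_values_rv[of \<tau>] rv[of "real (Suc n) * \<tau>"] rv[of "real n * \<tau>"] assms by auto
  have "real (Suc n) * \<tau> - real n * \<tau> = \<tau>" by (simp add: algebra_simps)
  then have I: "distr M borel ?I = distr M borel (\<lambda>\<omega>. c * l \<tau> \<omega>)"
    using distr_increment[OF ord, of c] by simp
  have "distr M borel (grid_values l c \<tau> (Suc n))
      = distr M borel (append_increment n \<circ> (\<lambda>\<omega>. (grid_values l c \<tau> n \<omega>, ?I \<omega>)))"
    by (rule distr_cong) (auto simp: grid_values_Suc)
  also have "\<dots> = distr (distr M (borel \<Otimes>\<^sub>M borel) (\<lambda>\<omega>. (grid_values l c \<tau> n \<omega>, ?I \<omega>))) borel (append_increment n)"
    by (rule distr_distr[symmetric, OF measurable_append_increment]) (use rvs in auto)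
  also have "distr M (borel \<Otimes>\<^sub>M borel) (\<lambda>\<omega>. (grid_values l c \<tau> n \<omega>, ?I \<omega>))
      = distr M borel (grid_values l c \<tau> n) \<Otimes>\<^sub>M distr M borel ?I"
    by (rule distr_pair_increment[OF grid_values_measurable ord]) (use assms in simp)
  finally show ?thesis unfolding I .
qed

text \<open>
  The law of the grid values is built by the same recursion from the law of one increment.
\<close>

lemma distr_grid_values_eq:
  assumes "0 < \<tau>" "0 < \<sigma>" "distr M borel (\<lambda>\<omega>. c * l \<tau> \<omega>) = distr M borel (\<lambda>\<omega>. d * l \<sigma> \<omega>)"
  shows "distr M borel (grid_values l c \<tau> n) = distr M borel (grid_values l d \<sigma> n)"
proof (induction n)
  case 0
  show ?case by (rule distr_cong) (auto simp: grid_values_def fun_eq_iff)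
next
  case (Suc n)
  then show ?case by (simp only: distr_grid_values_Suc[OF assms(1)] distr_grid_values_Suc[OF assms(2)] assms(3))
qed

end

lemma stable_exponent_scale:
  assumes "0 < \<epsilon>"
  shows "stable_exponent \<alpha> c \<beta> (\<epsilon> * u) = complex_of_real (\<epsilon> powr \<alpha>) * stable_exponent \<alpha> c \<beta> u"
  using assms by (auto simp: stable_exponent_def abs_mult powr_mult sgn_mult)

lemma (in levy_paths) stable_scaling:
  assumes st: "stable_levy_process M F \<alpha> l" and \<epsilon>: "0 < \<epsilon>" and s: "0 \<le> s"
  shows "distr M borel (\<lambda>\<omega>. \<epsilon> * l (s / \<epsilon> powr \<alpha>) \<omega>) = distr M borel (\<lambda>\<omega>. 1 * l s \<omega>)"
proof (rule Levy_uniqueness)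
  have r: "0 \<le> s / \<epsilon> powr \<alpha>" using s by simp
  show "real_distribution (distr M borel (\<lambda>\<omega>. \<epsilon> * l (s / \<epsilon> powr \<alpha>) \<omega>))"
    by (intro real_distribution_distr borel_measurable_times borel_measurable_const rv r)
  show "real_distribution (distr M borel (\<lambda>\<omega>. 1 * l s \<omega>))"
    by (intro real_distribution_distr borel_measurable_times borel_measurable_const rv s)
  obtain c \<beta> where ch: "\<And>t u. 0 \<le> t \<Longrightarrow> char (distr M borel (l t)) u = exp (complex_of_real t * stable_exponent \<alpha> c \<beta> u)"
    using st by (auto simp: stable_levy_process_def)
  have scale: "char (distr M borel (\<lambda>\<omega>. a * l t \<omega>)) u = char (distr M borel (l t)) (a * u)"
    if "0 \<le> t" for a t u
    unfolding char_def using rv[OF that]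
    by (subst (1 2) integral_distr) (auto simp: mult_ac intro!: borel_measurable_continuous_onI continuous_intros)
  show "char (distr M borel (\<lambda>\<omega>. \<epsilon> * l (s / \<epsilon> powr \<alpha>) \<omega>)) = char (distr M borel (\<lambda>\<omega>. 1 * l s \<omega>))"
  proof
    fix u
    have "complex_of_real (s / \<epsilon> powr \<alpha>) * stable_exponent \<alpha> c \<beta> (\<epsilon> * u)
        = complex_of_real s * stable_exponent \<alpha> c \<beta> u"
      unfolding stable_exponent_scale[OF \<epsilon>] using \<epsilon> by simp
    then show "char (distr M borel (\<lambda>\<omega>. \<epsilon> * l (s / \<epsilon> powr \<alpha>) \<omega>)) u = char (distr M borel (\<lambda>\<omega>. 1 * l s \<omega>)) u"
      unfolding scale[OF r] scale[OF s] ch[OF r] ch[OF s] by simp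
  qed
qed

section \<open>Random smoothed paths\<close>

lemma smooth_step_cong:
  "(\<And>k. k < m * m \<Longrightarrow> a k = b k) \<Longrightarrow> smooth_step h m a = smooth_step h m b"
  by (simp add: smooth_step_def)

lemma cadlag_cong:
  assumes "\<And>t. 0 \<le> t \<Longrightarrow> x t = y t" "cadlag x"
  shows "cadlag y"
  unfolding cadlag_def
proof (intro conjI allI impI)
  fix t :: real assume t: "0 \<le> t"
  have "\<forall>\<^sub>F s in at_right t. x s = y s"
    using eventually_at_right_less[of t] by eventually_elim (use assms(1) t in simp)
  with cadlag_right[OF assms(2) t] show "(y \<longlongrightarrow> y t) (at_right t)"
    using assms(1)[OF t] by (simp add: tendsto_cong)
next
  fix t :: real assume t: "0 < t"
  have "\<forall>\<^sub>F s in at_left t. x s = y s"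
    using eventually_at_left_real[OF t] by eventually_elim (use assms(1) in simp)
  with cadlag_left[OF assms(2) t] show "\<exists>c. (y \<longlongrightarrow> c) (at_left t)"
    by (auto simp: tendsto_cong)
qed

lemma skorokhod_restrict: "cadlag x \<Longrightarrow> (\<lambda>t\<in>{0..}. x t) \<in> skorokhod_space"
  by (auto simp: skorokhod_space_def intro: cadlag_cong[of x])

lemma near_measurable_smoothing:
  assumes Y: "\<And>t. 0 \<le> t \<Longrightarrow> Y t \<in> borel_measurable M"
    and c: "\<And>\<omega>. \<omega> \<in> space M \<Longrightarrow> cadlag (\<lambda>t. Y t \<omega>)" "\<And>\<omega>. \<omega> \<in> space M \<Longrightarrow> Y 0 \<omega> = 0"
    and h: "0 < h"
  shows "near_measurable M (\<lambda>\<omega>. \<lambda>t\<in>{0..}. smoothing h (\<lambda>s. Y s \<omega>) t)"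
proof (rule near_measurable_limit)
  show "near_measurable M (\<lambda>\<omega>. smooth_step h m (\<lambda>k. Y ((real k + 1) / real m) \<omega>))" for m
    by (rule near_measurable_smooth_step[OF h measurable_coordinatewise_then_product]) (simp add: Y)
  show "(\<lambda>\<omega>. \<lambda>t\<in>{0..}. smoothing h (\<lambda>s. Y s \<omega>) t) \<in> space M \<rightarrow> skorokhod_space"
    using skorokhod_restrict[OF cadlag_continuous_on[OF continuous_smoothing[OF regular_cadlag[OF c(1)] h]]]
    by auto
  show "\<forall>\<^sub>F m in sequentially. near d (\<lambda>t\<in>{0..}. smoothing h (\<lambda>s. Y s \<omega>) t)
      (smooth_step h m (\<lambda>k. Y ((real k + 1) / real m) \<omega>))" if "\<omega> \<in> space M" "0 < d" for \<omega> d
    by (rule near_smooth_step[OF c(1) c(2) h]) (use that in auto)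
qed

lemma near_smoothing_restrict:
  assumes x: "cadlag x" and h: "\<And>n. 0 < h n" "h \<longlonglongrightarrow> 0" and d: "0 < d"
  shows "\<forall>\<^sub>F n in sequentially. near d (\<lambda>t\<in>{0..}. x t) (\<lambda>t\<in>{0..}. smoothing (h n) x t)"
proof -
  have "cadlag (\<lambda>t\<in>{0..}. x t)" using skorokhod_restrict[OF x] by (rule skorokhod_cadlag)
  then interpret r: cadlag_path "\<lambda>t\<in>{0..}. x t" by unfold_locales
  show ?thesis
  proof (rule r.near_smoothing[OF h _ d])
    show "(\<lambda>t\<in>{0..}. smoothing (h n) x t) t = smoothing (h n) (\<lambda>t\<in>{0..}. x t) t" if "0 \<le> t" for n t
      using that by (simp add: smoothing_def)
  qed
qed

lemma measurable_AE_eq: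
  assumes M: "complete_measure M" and X: "X \<in> measurable M N"
    and Y: "Y \<in> space M \<rightarrow> space N" and eq: "AE \<omega> in M. Y \<omega> = X \<omega>"
  shows "Y \<in> measurable M N"
proof (rule measurableI)
  fix A assume A: "A \<in> sets N"
  have "AE \<omega> in M. \<omega> \<in> X -` A \<inter> space M \<longleftrightarrow> \<omega> \<in> Y -` A \<inter> space M"
    using eq by eventually_elim auto
  then show "Y -` A \<inter> space M \<in> sets M"
    by (rule complete_measure.in_sets_AE[OF M _ measurable_sets[OF X A]]) auto
qed (use Y in auto)

lemma space_borel_of_M1: "space (borel_of M1_topology) = skorokhod_space"
  by (auto simp: borel_of_def topspace_M1_topology openin_M1_topology space_measure_of_conv)

lemma measurable_continuous_M1:
  assumes f: "continuous_map M1_topology euclideanreal f"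
  shows "f \<in> borel_measurable (borel_of M1_topology)"
proof (rule borel_measurableI)
  fix S :: "real set" assume "open S"
  then have o: "openin M1_topology {z \<in> topspace M1_topology. f z \<in> S}"
    using f by (simp add: continuous_map_def)
  have "f -` S \<inter> space (borel_of M1_topology) = {z \<in> topspace M1_topology. f z \<in> S}"
    by (auto simp: space_borel_of_M1 topspace_M1_topology)
  moreover have "{z \<in> topspace M1_topology. f z \<in> S} \<in> sets (borel_of M1_topology)"
    unfolding borel_of_def using o openin_subset[of M1_topology] by (intro in_measure_of) auto
  ultimately show "f -` S \<inter> space (borel_of M1_topology) \<in> sets (borel_of M1_topology)" by simp
qed

text \<open>
  Along a near-convergent sequence of random paths, the expectations of a bounded continuous
  functional converge.
\<close>

lemma (in prob_space) expectation_near_limit: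
  assumes f: "continuous_map M1_topology euclideanreal f" "\<And>z. z \<in> skorokhod_space \<Longrightarrow> \<bar>f z\<bar> \<le> B"
    and X: "\<And>n. near_measurable M (X n)" and Z: "near_measurable M Z"
    and lim: "\<And>\<omega> d. \<omega> \<in> space M \<Longrightarrow> 0 < d \<Longrightarrow> \<forall>\<^sub>F n in sequentially. near d (Z \<omega>) (X n \<omega>)"
  shows "(\<lambda>n. \<integral>\<omega>. f (X n \<omega>) \<partial>M) \<longlonglongrightarrow> (\<integral>\<omega>. f (Z \<omega>) \<partial>M)"
proof (rule integral_dominated_convergence[where w = "\<lambda>_. B"])
  have m: "(\<lambda>\<omega>. f (Y \<omega>)) \<in> borel_measurable M" if "near_measurable M Y" for Y
    by (rule measurable_compose[OF near_measurable_imp_measurable[OF that] measurable_continuous_M1[OF f(1)]])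
  show "(\<lambda>\<omega>. f (Z \<omega>)) \<in> borel_measurable M" "(\<lambda>\<omega>. f (X n \<omega>)) \<in> borel_measurable M" for n
    using m X Z by auto
  have XS: "X n \<omega> \<in> skorokhod_space" if "\<omega> \<in> space M" for n \<omega>
    using X[of n] that by (auto simp: near_measurable_def)
  show "AE \<omega> in M. norm (f (X n \<omega>)) \<le> B" for n using XS f(2) by (intro AE_I2) auto
  show "AE \<omega> in M. (\<lambda>n. f (X n \<omega>)) \<longlonglongrightarrow> f (Z \<omega>)"
  proof (rule AE_I2)
    fix \<omega> assume \<omega>: "\<omega> \<in> space M"
    show "(\<lambda>n. f (X n \<omega>)) \<longlonglongrightarrow> f (Z \<omega>)"
      by (rule tendsto_M1_continuous[OF f(1) _ lim[OF \<omega>]])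
        (use Z \<omega> XS in \<open>auto simp: near_measurable_def\<close>)
  qed
qed simp

context levy_paths
begin

definition smoothed_path :: "real \<Rightarrow> 'w \<Rightarrow> real \<Rightarrow> real" where
  "smoothed_path h \<omega> = (\<lambda>t\<in>{0..}. smoothing h (\<lambda>s. l s \<omega>) t)"

definition rescaled_path :: "real \<Rightarrow> real \<Rightarrow> real \<Rightarrow> 'w \<Rightarrow> real \<Rightarrow> real" where
  "rescaled_path \<epsilon> \<alpha> h \<omega> = (\<lambda>t\<in>{0..}. smoothing h (\<lambda>s. \<epsilon> * l (s / \<epsilon> powr \<alpha>) \<omega>) t)"

lemma near_measurable_smoothed_path: "0 < h \<Longrightarrow> near_measurable M (smoothed_path h)"
  unfolding smoothed_path_def
  by (rule near_measurable_smoothing) (use rv path_cadlag path_0 in auto)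

lemma near_measurable_rescaled_path:
  assumes "0 < \<epsilon>" "0 < h"
  shows "near_measurable M (rescaled_path \<epsilon> \<alpha> h)"
  unfolding rescaled_path_def
proof (rule near_measurable_smoothing[OF _ _ _ assms(2)])
  show "(\<lambda>\<omega>. \<epsilon> * l (t / \<epsilon> powr \<alpha>) \<omega>) \<in> borel_measurable M" if "0 \<le> t" for t
    using rv[of "t / \<epsilon> powr \<alpha>"] that by simp
qed (use path_cadlag path_0 assms in \<open>auto intro!: cadlag_time_scale[of "\<lambda>t. l t _"]\<close>)

text \<open>
  The path is the limit of its own smoothings.
\<close>

lemma near_measurable_path: "near_measurable M (\<lambda>\<omega>. \<lambda>t\<in>{0..}. l t \<omega>)"
proof (rule near_measurable_limit)
  show "near_measurable M (smoothed_path (inverse (real (Suc n))))" for n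
    by (rule near_measurable_smoothed_path) simp
  show "(\<lambda>\<omega>. \<lambda>t\<in>{0..}. l t \<omega>) \<in> space M \<rightarrow> skorokhod_space"
    using skorokhod_restrict path_cadlag by auto
  show "\<forall>\<^sub>F n in sequentially. near d (\<lambda>t\<in>{0..}. l t \<omega>) (smoothed_path (inverse (real (Suc n))) \<omega>)"
    if "\<omega> \<in> space M" "0 < d" for \<omega> d
    unfolding smoothed_path_def
    by (rule near_smoothing_restrict[OF path_cadlag _ LIMSEQ_inverse_real_of_nat]) (use that in auto)
qed

text \<open>
  Both expectations are limits of expectations of one functional of grid values, and the grid values of the
  rescaled and of the original process have the same law.
\<close>

lemma expectation_rescaled_path:
  assumes st: "stable_levy_process M F \<alpha> l" and \<epsilon>: "0 < \<epsilon>" and h: "0 < h"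
    and f: "continuous_map M1_topology euclideanreal f" "\<And>z. z \<in> skorokhod_space \<Longrightarrow> \<bar>f z\<bar> \<le> B"
  shows "(\<integral>\<omega>. f (rescaled_path \<epsilon> \<alpha> h \<omega>) \<partial>M) = (\<integral>\<omega>. f (smoothed_path h \<omega>) \<partial>M)"
proof -
  define b where "b = \<epsilon> powr \<alpha>"
  have b: "0 < b" using \<epsilon> by (simp add: b_def)
  define X where "X m \<omega> = smooth_step h m (grid_values l 1 (1 / real m) (m * m) \<omega>)" for m \<omega>
  define X' where "X' m \<omega> = smooth_step h m (grid_values l \<epsilon> (1 / real m / b) (m * m) \<omega>)" for m \<omega>
  have Xe: "X m \<omega> = smooth_step h m (\<lambda>k. l ((real k + 1) / real m) \<omega>)" for m \<omega>
    unfolding X_def by (rule smooth_step_cong) (simp add: grid_values_def)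
  have X'e: "X' m \<omega> = smooth_step h m (\<lambda>k. \<epsilon> * l ((real k + 1) / real m / b) \<omega>)" for m \<omega>
    unfolding X'_def by (rule smooth_step_cong) (simp add: grid_values_def)
  have rvs: "grid_values l 1 (1 / real m) n \<in> measurable M borel"
    "grid_values l \<epsilon> (1 / real m / b) n \<in> measurable M borel" for m n
    using b by (intro grid_values_rv; simp)+
  have lim: "(\<lambda>m. \<integral>\<omega>. f (X m \<omega>) \<partial>M) \<longlonglongrightarrow> (\<integral>\<omega>. f (smoothed_path h \<omega>) \<partial>M)"
  proof (rule expectation_near_limit[OF f _ near_measurable_smoothed_path[OF h]])
    show "near_measurable M (X m)" for m
      unfolding X_def by (rule near_measurable_smooth_step[OF h rvs(1)])
    show "\<forall>\<^sub>F m in sequentially. near d (smoothed_path h \<omega>) (X m \<omega>)" if "\<omega> \<in> space M" "0 < d" for \<omega> d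
      unfolding Xe smoothed_path_def
      by (rule near_smooth_step[OF path_cadlag path_0 h]) (use that in auto)
  qed
  have lim': "(\<lambda>m. \<integral>\<omega>. f (X' m \<omega>) \<partial>M) \<longlonglongrightarrow> (\<integral>\<omega>. f (rescaled_path \<epsilon> \<alpha> h \<omega>) \<partial>M)"
  proof (rule expectation_near_limit[OF f _ near_measurable_rescaled_path[OF \<epsilon> h]])
    show "near_measurable M (X' m)" for m
      unfolding X'_def by (rule near_measurable_smooth_step[OF h rvs(2)])
    show "\<forall>\<^sub>F m in sequentially. near d (rescaled_path \<epsilon> \<alpha> h \<omega>) (X' m \<omega>)" if "\<omega> \<in> space M" "0 < d" for \<omega> d
      unfolding X'e rescaled_path_def b_def[symmetric]
      by (rule near_smooth_step[OF cadlag_time_scale[OF path_cadlag b]]) (use that path_0 h in auto)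
  qed
  have "(\<integral>\<omega>. f (X' m \<omega>) \<partial>M) = (\<integral>\<omega>. f (X m \<omega>) \<partial>M)" if "0 < m" for m
  proof -
    have "distr M borel (grid_values l \<epsilon> (1 / real m / b) (m * m)) = distr M borel (grid_values l 1 (1 / real m) (m * m))"
      by (rule distr_grid_values_eq)
        (use that b stable_scaling[OF st \<epsilon>, of "1 / real m"] in \<open>auto simp: b_def\<close>)
    then have "(\<integral>a. f (smooth_step h m a) \<partial>distr M borel (grid_values l \<epsilon> (1 / real m / b) (m * m)))
        = (\<integral>a. f (smooth_step h m a) \<partial>distr M borel (grid_values l 1 (1 / real m) (m * m)))"
      by simp
    then show ?thesis unfolding X_def X'_def
      using integral_distr[OF rvs(1) measurable_continuous_smooth_step[OF f(1) h]]
        integral_distr[OF rvs(2) measurable_continuous_smooth_step[OF f(1) h]] by simp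
  qed
  then have "\<forall>\<^sub>F m in sequentially. (\<integral>\<omega>. f (X' m \<omega>) \<partial>M) = (\<integral>\<omega>. f (X m \<omega>) \<partial>M)"
    by (rule eventually_mono[OF eventually_gt_at_top[of "0 :: nat"]])
  with lim' have "(\<lambda>m. \<integral>\<omega>. f (X m \<omega>) \<partial>M) \<longlonglongrightarrow> (\<integral>\<omega>. f (rescaled_path \<epsilon> \<alpha> h \<omega>) \<partial>M)"
    by (rule Lim_transform_eventually)
  then show ?thesis using lim by (rule LIMSEQ_unique)
qed

lemma langevin_eq_rescaled_path:
  assumes sol: "langevin_solution M F l A \<epsilon> v x" and \<epsilon>: "0 < \<epsilon>" and A: "0 < A"
  shows "AE \<omega> in M. (\<lambda>t\<in>{0..}. A * x (t / \<epsilon> powr \<alpha>) \<omega>) = rescaled_path \<epsilon> \<alpha> (\<epsilon> powr \<alpha> / A) \<omega>"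
proof -
  have vc: "cadlag (\<lambda>t. v t \<omega>)" if "\<omega> \<in> space M" for \<omega>
    using sol that unfolding langevin_solution_def cadlag_adapted_def by blast
  have "AE \<omega> in M. \<forall>t\<ge>0. v t \<omega> = - A * (LBINT s:{0..t}. v s \<omega>) + \<epsilon> * l t \<omega>"
    "AE \<omega> in M. \<forall>t\<ge>0. x t \<omega> = (LBINT s:{0..t}. v s \<omega>)"
    using sol unfolding langevin_solution_def by blast+
  then show ?thesis using AE_space
  proof eventually_elim
    case (elim \<omega>)
    have b: "0 < \<epsilon> powr \<alpha>" using \<epsilon> by simp
    have yc: "cadlag (\<lambda>t. \<epsilon> * l t \<omega>)"
      using cadlag_time_scale[OF path_cadlag[OF elim(3)], of 1 \<epsilon>] by simp
    have "A * x (t / \<epsilon> powr \<alpha>) \<omega> = smoothing (\<epsilon> powr \<alpha> / A) (\<lambda>s. \<epsilon> * l (s / \<epsilon> powr \<alpha>) \<omega>) t"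
      if t: "0 \<le> t" for t
    proof -
      have t': "0 \<le> t / \<epsilon> powr \<alpha>" using t by simp
      have "A * x (t / \<epsilon> powr \<alpha>) \<omega> = A * (LBINT s:{0..t / \<epsilon> powr \<alpha>}. v s \<omega>)" using elim(2) t' by simp
      also have "\<dots> = smoothing (1 / A) (\<lambda>s. \<epsilon> * l s \<omega>) (t / \<epsilon> powr \<alpha>)"
        by (rule langevin_integral_eq_smoothing[OF vc A yc]) (use elim path_0 t' in auto)
      also have "\<dots> = smoothing (\<epsilon> powr \<alpha> / A) (\<lambda>s. \<epsilon> * l (s / \<epsilon> powr \<alpha>) \<omega>) t"
        by (subst smoothing_time_scale[OF b]) simp
      finally show ?thesis .
    qed
    then show ?case by (auto simp: rescaled_path_def)
  qed
qed

end

theorem theorem2p1: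
  fixes M :: "'w measure"
    and F :: "real \<Rightarrow> 'w measure"
    and l :: "real \<Rightarrow> 'w \<Rightarrow> real"
    and v x :: "real \<Rightarrow> real \<Rightarrow> 'w \<Rightarrow> real"
    and \<alpha> A :: real
  assumes "prob_space M"
    and "usual_conditions M F"
    and "0 < \<alpha>" and "\<alpha> < 2"
    and "stable_levy_process M F \<alpha> l"
    and "0 < A"
    and "\<And>\<epsilon>. \<epsilon> > 0 \<Longrightarrow> langevin_solution M F l A \<epsilon> (v \<epsilon>) (x \<epsilon>)"
  shows "converges_weakly M M1_topology
           (\<lambda>\<epsilon> \<omega>. \<lambda>t\<in>{0..}. A * x \<epsilon> (t / \<epsilon> powr \<alpha>) \<omega>)
           (\<lambda>\<omega>. \<lambda>t\<in>{0..}. l t \<omega>)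
           (at_right 0)"
proof -
  interpret P: prob_space M by (rule assms(1))
  interpret levy_paths M F l
    by unfold_locales (use assms(2,5) in \<open>auto simp: stable_levy_process_def\<close>)
  define Y where "Y \<epsilon> \<omega> = (\<lambda>t\<in>{0..}. A * x \<epsilon> (t / \<epsilon> powr \<alpha>) \<omega>)" for \<epsilon> \<omega>
  define h where "h \<epsilon> = \<epsilon> powr \<alpha> / A" for \<epsilon>
  have h: "0 < h \<epsilon>" if "0 < \<epsilon>" for \<epsilon> using that assms(6) by (simp add: h_def)
  have YW: "AE \<omega> in M. Y \<epsilon> \<omega> = rescaled_path \<epsilon> \<alpha> (h \<epsilon>) \<omega>" if "0 < \<epsilon>" for \<epsilon>
    unfolding Y_def h_def by (rule langevin_eq_rescaled_path[OF assms(7)[OF that] that assms(6)])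
  have Wm: "rescaled_path \<epsilon> \<alpha> (h \<epsilon>) \<in> measurable M (borel_of M1_topology)" if "0 < \<epsilon>" for \<epsilon>
    by (rule near_measurable_imp_measurable[OF near_measurable_rescaled_path[OF that h[OF that]]])
  have Ym: "Y \<epsilon> \<in> measurable M (borel_of M1_topology)" if \<epsilon>: "0 < \<epsilon>" for \<epsilon>
  proof (rule measurable_AE_eq[OF _ Wm[OF \<epsilon>] _ YW[OF \<epsilon>]])
    show "complete_measure M" using assms(2) by (simp add: usual_conditions_def)
    have "cadlag (\<lambda>t. x \<epsilon> t \<omega>)" if "\<omega> \<in> space M" for \<omega>
      using assms(7)[OF \<epsilon>] that unfolding langevin_solution_def cadlag_adapted_def by blast
    then show "Y \<epsilon> \<in> space M \<rightarrow> space (borel_of M1_topology)"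
      unfolding Y_def space_borel_of_M1 using \<epsilon>
      by (auto intro!: skorokhod_restrict cadlag_time_scale[of "\<lambda>t. x \<epsilon> t _"])
  qed
  have Zm: "(\<lambda>\<omega>. \<lambda>t\<in>{0..}. l t \<omega>) \<in> measurable M (borel_of M1_topology)"
    by (rule near_measurable_imp_measurable[OF near_measurable_path])
  have pos: "\<forall>\<^sub>F \<epsilon> in at_right (0::real). 0 < \<epsilon>" by (rule eventually_at_right_less)
  have "((\<lambda>\<epsilon>. \<integral>\<omega>. f (Y \<epsilon> \<omega>) \<partial>M) \<longlongrightarrow> (\<integral>\<omega>. f (\<lambda>t\<in>{0..}. l t \<omega>) \<partial>M)) (at_right 0)"
    if f: "continuous_map M1_topology euclideanreal f" "bounded (f ` topspace M1_topology)" for f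
  proof -
    obtain B where B: "\<And>z. z \<in> skorokhod_space \<Longrightarrow> \<bar>f z\<bar> \<le> B"
      using f(2) unfolding bounded_iff topspace_M1_topology by auto
    have E: "(\<integral>\<omega>. f (Y \<epsilon> \<omega>) \<partial>M) = (\<integral>\<omega>. f (smoothed_path (h \<epsilon>) \<omega>) \<partial>M)" if \<epsilon>: "0 < \<epsilon>" for \<epsilon>
    proof -
      have "(\<integral>\<omega>. f (Y \<epsilon> \<omega>) \<partial>M) = (\<integral>\<omega>. f (rescaled_path \<epsilon> \<alpha> (h \<epsilon>) \<omega>) \<partial>M)"
      proof (rule integral_cong_AE)
        show "AE \<omega> in M. f (Y \<epsilon> \<omega>) = f (rescaled_path \<epsilon> \<alpha> (h \<epsilon>) \<omega>)"
          using YW[OF \<epsilon>] by eventually_elim simp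
      qed (use measurable_compose[OF Ym[OF \<epsilon>] measurable_continuous_M1[OF f(1)]]
          measurable_compose[OF Wm[OF \<epsilon>] measurable_continuous_M1[OF f(1)]] in auto)
      also have "\<dots> = (\<integral>\<omega>. f (smoothed_path (h \<epsilon>) \<omega>) \<partial>M)"
        by (rule expectation_rescaled_path[OF assms(5) \<epsilon> h[OF \<epsilon>] f(1) B])
      finally show ?thesis .
    qed
    have "((\<lambda>\<epsilon>. \<integral>\<omega>. f (smoothed_path (h \<epsilon>) \<omega>) \<partial>M) \<longlongrightarrow> (\<integral>\<omega>. f (\<lambda>t\<in>{0..}. l t \<omega>) \<partial>M)) (at_right 0)"
    proof (rule tendsto_at_right_sequentially[of 0 1])
      fix \<epsilon> :: "nat \<Rightarrow> real"
      assume \<epsilon>: "\<And>n. 0 < \<epsilon> n" "\<epsilon> \<longlonglongrightarrow> 0"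
      have "(\<lambda>n. \<epsilon> n powr \<alpha>) \<longlonglongrightarrow> 0 powr \<alpha>"
        by (rule tendsto_powr'[OF \<epsilon>(2) tendsto_const]) (use assms(3) \<epsilon>(1) in \<open>auto intro!: always_eventually less_imp_le\<close>)
      then have "(\<lambda>n. h (\<epsilon> n)) \<longlonglongrightarrow> 0 powr \<alpha> / A"
        unfolding h_def by (rule tendsto_divide[OF _ tendsto_const]) (use assms(6) in simp)
      then have h0: "(\<lambda>n. h (\<epsilon> n)) \<longlonglongrightarrow> 0" by simp
      show "(\<lambda>n. \<integral>\<omega>. f (smoothed_path (h (\<epsilon> n)) \<omega>) \<partial>M) \<longlonglongrightarrow> (\<integral>\<omega>. f (\<lambda>t\<in>{0..}. l t \<omega>) \<partial>M)"
      proof (rule P.expectation_near_limit[OF f(1) B near_measurable_smoothed_path[OF h[OF \<epsilon>(1)]] near_measurable_path])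
        show "\<forall>\<^sub>F n in sequentially. near d (\<lambda>t\<in>{0..}. l t \<omega>) (smoothed_path (h (\<epsilon> n)) \<omega>)"
          if "\<omega> \<in> space M" "0 < d" for \<omega> d
          unfolding smoothed_path_def
          by (rule near_smoothing_restrict[OF path_cadlag[OF that(1)] h[OF \<epsilon>(1)] h0 that(2)])
      qed
    qed simp
    moreover have "\<forall>\<^sub>F \<epsilon> in at_right 0. (\<integral>\<omega>. f (smoothed_path (h \<epsilon>) \<omega>) \<partial>M) = (\<integral>\<omega>. f (Y \<epsilon> \<omega>) \<partial>M)"
      using pos by eventually_elim (simp add: E)
    ultimately show ?thesis by (rule Lim_transform_eventually)
  qed
  moreover have "\<forall>\<^sub>F \<epsilon> in at_right 0. Y \<epsilon> \<in> measurable M (borel_of M1_topology)"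
    using pos by eventually_elim (rule Ym)
  ultimately show ?thesis
    unfolding converges_weakly_def Y_def using Zm by blast
qed

end
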